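(* Let $\varepsilon\in(0,1)$ and $m\in(1,\infty)$. If the mapping $\kappa\mapsto\bar\lambda(\kappa;m,\varepsilon)$ is strictly increasing for $0<\kappa<\kappa^+(m,\varepsilon)$, then $$\inf_{\lambda>0}\ \sup_{F\in\mathcal F_\varepsilon}\mathcal V_m^\circ(\lambda,F)=\inf_{\kappa>0}\ \sup_{F\in\mathcal F_\varepsilon}\mathcal V_m(\kappa,F),$$ where the minimax on the left concerns the formal variance of Huber $(M)$-estimates parametrized by $\lambda$, and that on the right concerns the formal variance of floating-threshold state evolutions parametrized by $\kappa$. The minimax tuning of the Huber $(M)$-estimator (when $m\,I(F_\varepsilon^* )>1$, so that $\underline\kappa^*(\varepsilon)$ is defined) is achieved by the tuning parameter $$\lambda^*(\varepsilon)=\bar\lambda(\underline\kappa^*(\varepsilon);m,\varepsilon),$$ i.e. the infimum over $\lambda$ on the left-hand side is attained at $\lambda=\lambda^*(\varepsilon)$.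
   Context: $\Phi$ is the standard normal CDF; $\mathcal F_\varepsilon=\{(1-\varepsilon)\Phi+\varepsilon H: H\text{ a probability distribution on }\mathbb R\}$. $I(F)=\int (f')^2/f$ is Fisher information for location and $F_\varepsilon^*$ minimizes $I$ over $\mathcal F_\varepsilon$. Scores: $\psi_\lambda(x)=\min(\lambda,\max(-\lambda,x))$, $\psi'_\lambda(x)=1_{\{|x|\le\lambda\}}$. For $r\ge0$, $\Psi_\lambda(z;r)=r\,\psi_\lambda(z/(1+r))$ with $z$-derivative $\Psi'_\lambda(z;r)=\frac r{1+r}1_{\{|z|\le\lambda(1+r)\}}$. Floating-threshold state evolution: for $\kappa>0$, $\tau\ge0$, $\sigma=\sqrt{1+\tau^2}$, $W\sim F$ and $Z\sim N(0,1)$ independent, $\mathcal A(\tau^2,r;\kappa,F)=\mathbb E\Psi^2_{\kappa\sigma}(W+\tau Z;r)$; $\mathcal R(\tau;m,\kappa,F)$ is the smallest $r\ge0$ with $\frac1m=\mathbb E\Psi'_{\kappa\sigma}(W+\tau Z;r)$; $\mathcal T(\tau^2;m,\kappa,F)=m\,\mathcal A(\tau^2,\mathcal R(\tau;m,\kappa,F);\kappa,F)$. $\tau_\infty^2(m,\kappa,F)$ is the fixed point of $\tau^2\mapsto\mathcal T(\tau^2;m,\kappa,F)$ in $[0,\infty)$ (taken to be unique), and $\mathcal V_m(\kappa,F)=m\,\tau^2_\infty(m,\kappa,F)$ is the formal variance ($+\infty$ if there is no fixed point). Calibration: $\lambda_\infty(m,\kappa,F)=\kappa\sqrt{1+\tau_\infty^2(m,\kappa,F)}$;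 the inverse correspondence is $\kappa=\kappa_\infty(m,\lambda,F)$. The formal asymptotic variance of the Huber $(M)$-estimator with parameter $\lambda$ is $\mathcal V_m^\circ(\lambda,F)=m\,\tau_\infty^2(m,\kappa,F)$ where $\lambda=\lambda_\infty(m,\kappa,F)$. $\kappa^+(m,\varepsilon)=\sup\{\kappa:\sup_{F\in\mathcal F_\varepsilon}\mathcal V_m(\kappa,F)<\infty\}$ and $\bar\lambda(\kappa;m,\varepsilon)=\sup_{F\in\mathcal F_\varepsilon}\lambda_\infty(m,\kappa,F)$. $\bar A(\kappa,\varepsilon)=(1-\varepsilon)\int\psi_\kappa^2d\Phi+\varepsilon\kappa^2$, $\bar B(\kappa,\varepsilon)=(1-\varepsilon)(2\Phi(\kappa)-1)$, $\bar V=\bar A/\bar B^2$; $\kappa^*(\varepsilon)$ (Huber's minimax capping parameter) is the minimizer of $\bar V(\cdot,\varepsilon)$ over $\kappa>0$. For $m(1-\varepsilon)>1$, $\bar{\bar r}(m,\varepsilon,\kappa)$ is the unique $r>0$ with $\frac r{1+r}\bar B(\kappa(1+r),\varepsilon)=\frac1m$, and $\underline\kappa^*(\varepsilon)$ is the solution $\kappa>0$ of $\kappa(1+\bar{\bar r}(m,\varepsilon,\kappa))=\kappa^*(\varepsilon)$. *)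

theory Defs
  imports "HOL-Probability.Probability"
begin

section \<open>The contamination class\<close>

definition std_normal :: "real measure" where
  "std_normal = density lborel (\<lambda>x. ennreal (std_normal_density x))"

definition Phi :: "real \<Rightarrow> real" where
  "Phi = cdf std_normal"

text \<open>A distribution on the line is a measure on the Borel sets; the mixture equation
  is the usual one between distribution functions.\<close>

definition contam :: "real \<Rightarrow> real measure set" where
  "contam \<epsilon> = {F. real_distribution F \<and>
     (\<exists>H. real_distribution H \<and> (\<forall>x. cdf F x = (1 - \<epsilon>) * Phi x + \<epsilon> * cdf H x))}"

text \<open>Fisher information for location: \<open>f\<close> is the locally absolutely continuous density of
  \<open>F\<close> and \<open>f'\<close> its almost everywhere derivative, expressed by the fundamental theorem of
  calculus. Both are determined by \<open>F\<close> (the latter almost everywhere), so the infimum ranges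
  over at most one value; it is infinite if \<open>F\<close> has no such density. Where \<open>f\<close> vanishes, so does
  \<open>f'\<close> almost everywhere, and the integrand is \<open>0 / 0 = 0\<close>.\<close>

definition fisher_information :: "real measure \<Rightarrow> ennreal" where
  "fisher_information F = Inf {(\<integral>\<^sup>+ x. ennreal ((f' x)\<^sup>2 / f x) \<partial>lborel) | f f'.
     (\<forall>x. 0 \<le> f x) \<and> F = density lborel (\<lambda>x. ennreal (f x)) \<and>
     (\<forall>a b. a \<le> b \<longrightarrow> set_integrable lborel {a..b} f' \<and>
                      f b - f a = (LBINT x:{a..b}. f' x))}"

definition fisher_minimizer :: "real \<Rightarrow> real measure \<Rightarrow> bool" where
  "fisher_minimizer \<epsilon> F \<longleftrightarrow> is_arg_min fisher_information (\<lambda>G. G \<in> contam \<epsilon>) F"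


section \<open>Huber scores\<close>

definition psi :: "real \<Rightarrow> real \<Rightarrow> real" where
  "psi lam x = min lam (max (- lam) x)"

definition Psi :: "real \<Rightarrow> real \<Rightarrow> real \<Rightarrow> real" where
  "Psi lam z r = r * psi lam (z / (1 + r))"

definition Psi' :: "real \<Rightarrow> real \<Rightarrow> real \<Rightarrow> real" where
  "Psi' lam z r = r / (1 + r) * (if \<bar>z\<bar> \<le> lam * (1 + r) then 1 else 0)"


section \<open>Floating-threshold state evolution\<close>

text \<open>The law of \<open>W + \<tau> Z\<close> for independent \<open>W \<sim> F\<close> and \<open>Z \<sim> N(0,1)\<close>.\<close>

definition noisy :: "real measure \<Rightarrow> real \<Rightarrow> real measure" where
  "noisy F \<tau> = distr (F \<Otimes>\<^sub>M std_normal) borel (\<lambda>(w, z). w + \<tau> * z)"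

text \<open>In \<open>se_A\<close>, \<open>se_T\<close> and \<open>is_fixed_point\<close> the argument \<open>t\<close> is the variance \<open>\<tau>\<^sup>2\<close>;
  \<open>se_R\<close> takes \<open>\<tau>\<close> itself.\<close>

definition se_A :: "real \<Rightarrow> real \<Rightarrow> real \<Rightarrow> real measure \<Rightarrow> real" where
  "se_A t r \<kappa> F = (\<integral>y. (Psi (\<kappa> * sqrt (1 + t)) y r)\<^sup>2 \<partial>noisy F (sqrt t))"

definition se_R_eq :: "real \<Rightarrow> real \<Rightarrow> real \<Rightarrow> real measure \<Rightarrow> real \<Rightarrow> bool" where
  "se_R_eq \<tau> m \<kappa> F r \<longleftrightarrow>
     0 \<le> r \<and> 1 / m = (\<integral>y. Psi' (\<kappa> * sqrt (1 + \<tau>\<^sup>2)) y r \<partial>noisy F \<tau>)"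

definition se_R :: "real \<Rightarrow> real \<Rightarrow> real \<Rightarrow> real measure \<Rightarrow> real" where
  "se_R \<tau> m \<kappa> F = (LEAST r. se_R_eq \<tau> m \<kappa> F r)"

definition se_T :: "real \<Rightarrow> real \<Rightarrow> real \<Rightarrow> real measure \<Rightarrow> real" where
  "se_T t m \<kappa> F = m * se_A t (se_R (sqrt t) m \<kappa> F) \<kappa> F"

text \<open>At \<open>t = 0\<close> the law \<open>F\<close> may have atoms, and the equation for \<open>r\<close> may then have no solution;
  the state evolution map is undefined there, and \<open>0\<close> does not count as a fixed point.\<close>

definition is_fixed_point :: "real \<Rightarrow> real \<Rightarrow> real measure \<Rightarrow> real \<Rightarrow> bool" where
  "is_fixed_point m \<kappa> F t \<longleftrightarrow>
     0 \<le> t \<and> (\<exists>r. se_R_eq (sqrt t) m \<kappa> F r) \<and> se_T t m \<kappa> F = t"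

text \<open>Only meaningful when the fixed point exists and is unique: uniqueness is a standing
  assumption, stated as a hypothesis where it is needed; existence is tested in \<open>V_float\<close> and
  \<open>lambda_inf\<close>.\<close>

definition tau2_inf :: "real \<Rightarrow> real \<Rightarrow> real measure \<Rightarrow> real" where
  "tau2_inf m \<kappa> F = (THE t. is_fixed_point m \<kappa> F t)"

definition V_float :: "real \<Rightarrow> real \<Rightarrow> real measure \<Rightarrow> ereal" where
  "V_float m \<kappa> F =
     (if \<exists>t. is_fixed_point m \<kappa> F t then ereal (m * tau2_inf m \<kappa> F) else \<infinity>)"


section \<open>Calibration\<close>

definition lambda_inf :: "real \<Rightarrow> real \<Rightarrow> real measure \<Rightarrow> ereal" where
  "lambda_inf m \<kappa> F =
     (if \<exists>t. is_fixed_point m \<kappa> F t then ereal (\<kappa> * sqrt (1 + tau2_inf m \<kappa> F)) else \<infinity>)"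

definition kappa_inf :: "real \<Rightarrow> real \<Rightarrow> real measure \<Rightarrow> real" where
  "kappa_inf m lam F = (THE \<kappa>. 0 < \<kappa> \<and> lambda_inf m \<kappa> F = ereal lam)"

text \<open>The formal variance of the Huber M-estimator with parameter \<open>lam\<close>; as for \<open>V_float\<close>, it is
  infinite if \<open>lam\<close> corresponds to no state evolution fixed point.\<close>

definition V_huber :: "real \<Rightarrow> real \<Rightarrow> real measure \<Rightarrow> ereal" where
  "V_huber m lam F =
     (if \<exists>\<kappa>>0. lambda_inf m \<kappa> F = ereal lam then V_float m (kappa_inf m lam F) F else \<infinity>)"

definition kappa_plus :: "real \<Rightarrow> real \<Rightarrow> ereal" where
  "kappa_plus m \<epsilon> = Sup {ereal \<kappa> | \<kappa>. 0 < \<kappa> \<and> (SUP F\<in>contam \<epsilon>. V_float m \<kappa> F) < \<infinity>}"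

definition lambda_bar :: "real \<Rightarrow> real \<Rightarrow> real \<Rightarrow> ereal" where
  "lambda_bar \<kappa> m \<epsilon> = (SUP F\<in>contam \<epsilon>. lambda_inf m \<kappa> F)"


section \<open>Minimax capping\<close>

definition A_bar :: "real \<Rightarrow> real \<Rightarrow> real" where
  "A_bar \<kappa> \<epsilon> = (1 - \<epsilon>) * (\<integral>x. (psi \<kappa> x)\<^sup>2 \<partial>std_normal) + \<epsilon> * \<kappa>\<^sup>2"

definition B_bar :: "real \<Rightarrow> real \<Rightarrow> real" where
  "B_bar \<kappa> \<epsilon> = (1 - \<epsilon>) * (2 * Phi \<kappa> - 1)"

definition V_bar :: "real \<Rightarrow> real \<Rightarrow> real" where
  "V_bar \<kappa> \<epsilon> = A_bar \<kappa> \<epsilon> / (B_bar \<kappa> \<epsilon>)\<^sup>2"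

definition kappa_star :: "real \<Rightarrow> real" where
  "kappa_star \<epsilon> = (THE \<kappa>. is_arg_min (\<lambda>k. V_bar k \<epsilon>) (\<lambda>k. 0 < k) \<kappa>)"

definition r_bar :: "real \<Rightarrow> real \<Rightarrow> real \<Rightarrow> real" where
  "r_bar m \<epsilon> \<kappa> = (THE r. 0 < r \<and> r / (1 + r) * B_bar (\<kappa> * (1 + r)) \<epsilon> = 1 / m)"

definition kappa_under_star :: "real \<Rightarrow> real \<Rightarrow> real" where
  "kappa_under_star m \<epsilon> = (THE \<kappa>. 0 < \<kappa> \<and> \<kappa> * (1 + r_bar m \<epsilon> \<kappa>) = kappa_star \<epsilon>)"

end

theory Submission
  imports Defs
begin

text \<open>Substituting \<open>u = \<kappa> (1 + r)\<close>, the worst contamination, which escapes to infinity, turns the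
  state evolution into \<open>\<kappa> = u (1 - 1 / (m B))\<close> and \<open>\<tau>\<^sup>2 / (1 + \<tau>\<^sup>2) = V / m\<close>, where \<open>B\<close> and \<open>V\<close>
  are \<open>B_bar\<close> and \<open>V_bar\<close> at \<open>u\<close>. Hence the worst-case variance at \<open>\<kappa>\<close> is \<open>m V / (m - V)\<close>
  if \<open>V < m\<close> and infinite otherwise. It is minimal at Huber's \<open>u = \<kappa>\<^sup>*\<close>, where \<open>V = 1 / B\<close>; the
  density of Huber's least favourable law has information \<open>B\<close>, so \<open>m I > 1\<close> gives \<open>V < m\<close>.

  A threshold \<open>\<lambda>\<close> determines a unique solution \<open>(\<tau>, r)\<close> for every \<open>F\<close>, hence a unique \<open>\<kappa>\<close>:
  uniqueness is monotonicity of the score combined with Stein's identity. Letting the contamination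
  escape at fixed \<open>\<lambda>\<close>, a bounded variance accumulates at the worst-case variance of some \<open>\<kappa>\<close>,
  so the minimax over \<open>\<lambda>\<close> is at least that over \<open>\<kappa>\<close>. The converse is the monotonicity hypothesis
  applied with \<open>\<lambda> = lambda_bar \<kappa>\<close>.\<close>

section \<open>The normal law and Stein's identity\<close>

text \<open>The worst-case value is approached along point masses tending to infinity, not read off
  from one law. Upper bounds therefore hold law by law, through monotonicity in \<open>r\<close>,
  while lower bounds come from compactness along the escaping sequence.

  The floating threshold is proportional to the standard deviation of the noisy Gaussian part. With
  the contamination at infinity the equation for \<open>r\<close> therefore no longer contains
  \<open>\<tau>\<close>, and the two equations decouple. At a fixed \<open>\<lambda>\<close> this
  decoupling is lost, but the score is then the same at every noise level, which is what the
  monotonicity argument for uniqueness requires. The price is that the \<open>\<kappa>\<close>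
  matching \<open>\<lambda>\<close> varies with the law, so the compactness argument has to carry a
  varying \<open>\<kappa>\<close>.

  Huber's cap stays optimal because \<open>V / (m - V)\<close> increases with \<open>V\<close> below
  \<open>m\<close>.\<close>

interpretation std_normal: prob_space std_normal
  unfolding std_normal_def by (rule prob_space_normal_density) simp

lemma sets_std_normal [simp, measurable_cong]: "sets std_normal = sets borel"
  by (simp add: std_normal_def)

lemma space_std_normal [simp]: "space std_normal = UNIV"
  by (simp add: std_normal_def)

interpretation std_normal: real_distribution std_normal
  by unfold_locales auto

lemma integral_std_normal:
  fixes f :: "real \<Rightarrow> real"
  assumes "f \<in> borel_measurable borel"
  shows "(\<integral>x. f x \<partial>std_normal) = (\<integral>x. std_normal_density x * f x \<partial>lborel)"
  using assms unfolding std_normal_def by (subst integral_density) auto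

lemma integrable_std_normal_iff:
  fixes f :: "real \<Rightarrow> real"
  assumes "f \<in> borel_measurable borel"
  shows "integrable std_normal f \<longleftrightarrow> integrable lborel (\<lambda>x. std_normal_density x * f x)"
  using assms unfolding std_normal_def by (subst integrable_density) auto

lemma continuous_on_std_normal_density: "continuous_on S std_normal_density"
  unfolding std_normal_density_def by (intro continuous_intros) auto

lemma has_derivative_std_normal_density [derivative_intros]:
  "(std_normal_density has_real_derivative - x * std_normal_density x) (at x within S)"
  unfolding std_normal_density_def
  by (auto intro!: derivative_eq_intros simp: field_simps)

lemma measure_std_normal_Icc:
  "measure std_normal {a..b} = integral {a..b} std_normal_density"
proof -
  have "measure std_normal {a..b} = (\<integral>x. indicator {a..b} x \<partial>std_normal)"
    by simp
  also have "\<dots> = (LINT x:{a..b}|lborel. std_normal_density x)"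
    by (subst integral_std_normal) (auto simp: set_lebesgue_integral_def mult.commute)
  also have "\<dots> = integral {a..b} std_normal_density"
    by (intro set_borel_integral_eq_integral(2) borel_integrable_atLeastAtMost'
        continuous_on_std_normal_density)
  finally show ?thesis .
qed

lemma measure_std_normal_singleton [simp]: "measure std_normal {a} = 0"
  using measure_std_normal_Icc[of a a] by simp

lemma AE_std_normal_neq: "AE z in std_normal. z \<noteq> a"
  by (rule AE_I[of _ _ "{a}"]) (auto simp: std_normal.emeasure_eq_measure)

lemma Phi_diff:
  assumes "a \<le> b"
  shows "Phi b - Phi a = integral {a..b} std_normal_density"
proof (cases "a = b")
  case False
  have "measure std_normal {a<..b} = measure std_normal {a..b}"
    by (rule std_normal.finite_measure_eq_AE) (use AE_std_normal_neq[of a] in auto)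
  then show ?thesis
    using False assms unfolding Phi_def
    by (subst std_normal.cdf_diff_eq) (auto simp: measure_std_normal_Icc)
qed auto

lemma Phi_has_real_derivative [derivative_intros]:
  "(Phi has_real_derivative std_normal_density x) (at x)"
proof -
  have "((\<lambda>y. Phi (x - 1) + integral {x - 1..y} std_normal_density)
      has_real_derivative std_normal_density x) (at x within {x - 1..x + 1})"
    by (auto intro!: derivative_eq_intros integral_has_real_derivative
        continuous_on_std_normal_density)
  then have "(Phi has_real_derivative std_normal_density x) (at x within {x - 1..x + 1})"
    by (rule has_field_derivative_transform_within[of _ _ _ _ 1]) (auto simp: Phi_diff[symmetric])
  then show ?thesis
    by (simp add: at_within_Icc_at)
qed

lemma continuous_on_Phi: "continuous_on S Phi"
  by (meson DERIV_isCont Phi_has_real_derivative continuous_at_imp_continuous_on)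

lemma Phi_strict_mono: "a < b \<Longrightarrow> Phi a < Phi b"
  by (rule DERIV_pos_imp_increasing) (use Phi_has_real_derivative in \<open>force intro: normal_density_pos\<close>)+

text \<open>The sum \<open>Phi x + Phi (- x)\<close> has derivative zero because the density is
  even; the constant is read off at infinity.\<close>

lemma Phi_minus: "Phi (- x) = 1 - Phi x"
proof -
  have 1: "((\<lambda>x. Phi x + Phi (- x)) has_real_derivative 0) (at x)" for x
    by (auto intro!: derivative_eq_intros DERIV_chain'[of uminus, OF _ Phi_has_real_derivative]
        simp: std_normal_density_def)
  have "(\<lambda>y. Phi y + Phi (- y)) = (\<lambda>_. Phi x + Phi (- x))"
    using DERIV_isconst_all[of "\<lambda>x. Phi x + Phi (- x)"] 1 by blast
  then have "((\<lambda>y. Phi y + Phi (- y)) \<longlongrightarrow> Phi x + Phi (- x)) at_top"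
    by simp
  moreover have "((\<lambda>y. Phi y + Phi (- y)) \<longlongrightarrow> 1 + 0) at_top"
    unfolding Phi_def
    by (intro tendsto_add std_normal.cdf_lim_at_top_prob
        filterlim_compose[OF std_normal.cdf_lim_at_bot] filterlim_uminus_at_bot_at_top)
  ultimately show ?thesis
    using tendsto_unique[OF trivial_limit_at_top_linorder] by force
qed

lemma Phi_0 [simp]: "Phi 0 = 1 / 2"
  using Phi_minus[of 0] by simp

lemma measure_std_normal_abs_le:
  assumes "0 \<le> u"
  shows "measure std_normal {z. \<bar>z\<bar> \<le> u} = 2 * Phi u - 1"
proof -
  have "{z. \<bar>z\<bar> \<le> u} = {-u..u}" by auto
  then show ?thesis
    using Phi_diff[of "-u" u] assms by (simp add: measure_std_normal_Icc Phi_minus)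
qed


section \<open>Gaussian tails and integration by parts\<close>

lemma std_normal_density_tendsto_0: "(std_normal_density \<longlongrightarrow> 0) at_top"
proof -
  have "filterlim (\<lambda>x::real. x * x) at_top at_top"
    by (intro filterlim_at_top_mult_at_top filterlim_ident)
  then have "filterlim (\<lambda>x::real. - x\<^sup>2 / 2) at_bot at_top"
    by (simp add: power2_eq_square filterlim_uminus_at_top[symmetric]
        filterlim_tendsto_pos_mult_at_top[OF tendsto_const, of "1/2", simplified])
  from filterlim_compose[OF exp_at_bot this] show ?thesis
    unfolding std_normal_density_def by (rule tendsto_mult_right_zero)
qed

lemma std_normal_density_minus: "std_normal_density (- x) = std_normal_density x"
  by (simp add: std_normal_density_def)

lemma integrable_std_normal_ident: "integrable std_normal (\<lambda>z. z)"
  using integrable_std_normal_moment[of 1] by (simp add: integrable_std_normal_iff)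

lemma integral_std_normal_ident: "(\<integral>z. z \<partial>std_normal) = 0"
  using integral_std_normal_moment_odd[of 0] by (simp add: integral_std_normal)

lemma integrable_std_normal_bounded:
  fixes f :: "real \<Rightarrow> real"
  assumes "f \<in> borel_measurable borel" "\<And>x. \<bar>f x\<bar> \<le> C"
  shows "integrable std_normal f"
  using assms by (intro std_normal.integrable_const_bound[where B = C]) (auto)

lemma integrable_std_normal_mult_bounded:
  fixes f :: "real \<Rightarrow> real"
  assumes [measurable]: "f \<in> borel_measurable borel" and "\<And>x. \<bar>f x\<bar> \<le> C"
  shows "integrable std_normal (\<lambda>z. z * f z)"
proof (rule Bochner_Integration.integrable_bound[of _ "\<lambda>z. z * C"])
  show "AE z in std_normal. norm (z * f z) \<le> norm (z * C)"
    using order_trans[OF assms(2) abs_ge_self] by (auto simp: abs_mult intro!: mult_left_mono)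
qed (auto intro: integrable_std_normal_ident)

lemma clamp_has_real_derivative:
  fixes a b z :: real
  assumes "a \<le> b" "z \<notin> {a, b}"
  shows "((\<lambda>z. min b (max a z)) has_real_derivative indicator {a..b} z) (at z)"
proof -
  define c where "c = (\<lambda>z. min b (max a z))"
  consider "z < a" | "a < z" "z < b" | "b < z"
    using assms(2) by force
  then show ?thesis
  proof cases
    case 1
    have "((\<lambda>_. a) has_real_derivative 0) (at z)" by simp
    then have "(c has_real_derivative 0) (at z)"
      by (rule has_field_derivative_transform_within_open[of _ _ _ "{..<a}"])
        (use 1 assms in \<open>auto simp: c_def\<close>)
    then show ?thesis using 1 by (simp add: c_def)
  next
    case 2
    have "((\<lambda>z. z) has_real_derivative 1) (at z)" by simp
    then have "(c has_real_derivative 1) (at z)"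
      by (rule has_field_derivative_transform_within_open[of _ _ _ "{a<..<b}"])
        (use 2 assms in \<open>auto simp: c_def\<close>)
    then show ?thesis using 2 by (simp add: c_def)
  next
    case 3
    have "((\<lambda>_. b) has_real_derivative 0) (at z)" by simp
    then have "(c has_real_derivative 0) (at z)"
      by (rule has_field_derivative_transform_within_open[of _ _ _ "{b<..}"])
        (use 3 assms in \<open>auto simp: c_def\<close>)
    then show ?thesis using 3 by (simp add: c_def)
  qed
qed

text \<open>Stein's identity \<open>E (Z f(Z)) = E f'(Z)\<close>, from \<open>(f \<phi>)' = (f' - z f) \<phi>\<close>.\<close>

lemma stein_clamp:
  fixes a b :: real
  assumes "a \<le> b"
  shows "(\<integral>z. z * min b (max a z) \<partial>std_normal) = measure std_normal {a..b}"
proof -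
  define c where "c = (\<lambda>z. min b (max a z))"
  define C where "C = \<bar>a\<bar> + \<bar>b\<bar>"
  have [measurable]: "c \<in> borel_measurable borel"
    unfolding c_def by measurable
  have c_bound: "\<bar>c z\<bar> \<le> C" for z
    using assms by (auto simp: c_def C_def)
  have c_cont: "continuous_on S c" for S
    unfolding c_def by (intro continuous_intros)
  define h where "h = (\<lambda>z. indicator {a..b} z - z * c z)"
  define g where "g = (\<lambda>z. std_normal_density z * h z)"
  have [measurable]: "h \<in> borel_measurable borel"
    unfolding h_def by measurable
  have int_zc: "integrable std_normal (\<lambda>z. z * c z)"
    using c_bound by (rule integrable_std_normal_mult_bounded[rotated]) simp
  have int_h: "integrable std_normal h"
    unfolding h_def by (intro Bochner_Integration.integrable_diff int_zc)
      (auto simp: std_normal.emeasure_eq_measure)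
  then have int_g: "integrable lborel g"
    by (simp add: g_def integrable_std_normal_iff)
  have deriv: "((\<lambda>z. c z * std_normal_density z) has_real_derivative g z) (at z)"
    if "z \<notin> {a, b}" for z
  proof -
    have "(c has_real_derivative indicator {a..b} z) (at z)"
      unfolding c_def by (rule clamp_has_real_derivative) (use assms that in auto)
    then show ?thesis
      unfolding g_def h_def
      by (auto intro!: derivative_eq_intros simp: algebra_simps)
  qed
  \<comment> \<open>The antiderivative, \<open>c\<close> times the density, is continuous everywhere
    and differentiable off the two kinks, an exceptional set that the fundamental theorem
    tolerates.\<close>
  have FTC: "(\<integral>z. indicator {-real n..real n} z * g z \<partial>lborel)
     = c (real n) * std_normal_density (real n) - c (- real n) * std_normal_density (real n)" for n
  proof -
    have "(g has_integral (c (real n) * std_normal_density (real n)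
        - c (- real n) * std_normal_density (- real n))) {-real n..real n}"
      by (rule fundamental_theorem_of_calculus_interior_strong[of "{a, b}"])
        (use deriv in \<open>auto intro!: continuous_intros c_cont continuous_on_std_normal_density
          simp: has_real_derivative_iff_has_vector_derivative\<close>)
    moreover have "set_integrable lborel {-real n..real n} g"
      unfolding set_integrable_def by (intro integrable_mult_indicator int_g) auto
    ultimately show ?thesis
      using set_borel_integral_eq_integral(2)[of "{-real n..real n}" g]
      by (simp add: integral_unique set_lebesgue_integral_def std_normal_density_minus)
  qed
  have "(\<lambda>n. \<integral>z. indicator {-real n..real n} z * g z \<partial>lborel) \<longlonglongrightarrow> (\<integral>z. g z \<partial>lborel)"
  proof (rule integral_dominated_convergence[where w = "\<lambda>z. \<bar>g z\<bar>"])
    show "AE z in lborel. (\<lambda>n. indicator {- real n..real n} z * g z) \<longlonglongrightarrow> g z"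
    proof (rule AE_I2)
      fix z
      obtain N where "\<bar>z\<bar> \<le> real N" using real_arch_simple by blast
      then have "eventually (\<lambda>n. indicator {- real n..real n} z * g z = g z) sequentially"
        by (intro eventually_sequentiallyI[of N]) (auto simp: indicator_def abs_le_iff)
      then show "(\<lambda>n. indicator {- real n..real n} z * g z) \<longlonglongrightarrow> g z"
        by (rule tendsto_eventually)
    qed
  qed (use int_g in \<open>auto simp: g_def indicator_def\<close>)
  moreover have "(\<lambda>n. c (real n) * std_normal_density (real n)
      - c (- real n) * std_normal_density (real n)) \<longlonglongrightarrow> 0"
  proof (rule tendsto_diff[of _ 0 _ _ 0, simplified])
    have lim: "(\<lambda>n. std_normal_density (real n)) \<longlonglongrightarrow> 0"
      using filterlim_compose[OF std_normal_density_tendsto_0 filterlim_real_sequentially] .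
    have "(\<lambda>n. C * std_normal_density (real n)) \<longlonglongrightarrow> 0"
      using tendsto_mult_right_zero[OF lim] .
    note lim' = Lim_null_comparison[OF always_eventually[OF allI] this]
    show "(\<lambda>n. c (real n) * std_normal_density (real n)) \<longlonglongrightarrow> 0"
      "(\<lambda>n. c (- real n) * std_normal_density (real n)) \<longlonglongrightarrow> 0"
      by (rule lim'; use c_bound in \<open>auto simp: abs_mult intro!: mult_right_mono\<close>)+
  qed
  ultimately have "(\<integral>z. g z \<partial>lborel) = 0"
    by (simp add: FTC LIMSEQ_unique)
  then have "(\<integral>z. h z \<partial>std_normal) = 0"
    by (simp add: integral_std_normal g_def)
  then show ?thesis
    using int_zc unfolding h_def c_def[symmetric]
    by (subst (asm) Bochner_Integration.integral_diff)
      (auto simp: std_normal.emeasure_eq_measure c_def)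
qed

lemma psi_bound: "0 \<le> l \<Longrightarrow> \<bar>psi l x\<bar> \<le> l"
  by (auto simp: psi_def)

lemma psi_measurable [measurable]: "psi l \<in> borel_measurable borel"
  unfolding psi_def by measurable

text \<open>On the core \<open>Phi z - z * std_normal_density z\<close> is an antiderivative of
  \<open>z\<^sup>2\<close> times the density; outside, the integrand is the constant
  \<open>u\<^sup>2\<close>. The closed form supplies the continuity in \<open>u\<close> and the
  derivative of \<open>A_bar\<close>.\<close>

lemma integral_psi_square:
  assumes "0 \<le> u"
  shows "(\<integral>z. (psi u z)\<^sup>2 \<partial>std_normal)
    = (2 * Phi u - 1) - 2 * u * std_normal_density u + u\<^sup>2 * (2 - 2 * Phi u)"
proof -
  have "(\<integral>z. indicator {-u..u} z * z\<^sup>2 \<partial>std_normal)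
      = (LINT z:{-u..u}|lborel. std_normal_density z * z\<^sup>2)"
    by (subst integral_std_normal) (auto simp: set_lebesgue_integral_def algebra_simps)
  also have "\<dots> = integral {-u..u} (\<lambda>z. std_normal_density z * z\<^sup>2)"
    by (intro set_borel_integral_eq_integral(2) borel_integrable_atLeastAtMost'
        continuous_intros continuous_on_std_normal_density)
  also have "\<dots> = (Phi u - u * std_normal_density u) - (Phi (-u) - (-u) * std_normal_density (-u))"
    by (intro integral_unique fundamental_theorem_of_calculus)
      (use assms in \<open>auto intro!: derivative_eq_intros
         DERIV_subset[OF Phi_has_real_derivative]
         simp: has_real_derivative_iff_has_vector_derivative[symmetric] power2_eq_square\<close>)
  finally have 1: "(\<integral>z. indicator {-u..u} z * z\<^sup>2 \<partial>std_normal)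
      = 2 * Phi u - 1 - 2 * u * std_normal_density u"
    by (simp add: Phi_minus std_normal_density_minus)
  have "(\<integral>z. (psi u z)\<^sup>2 \<partial>std_normal)
      = (\<integral>z. indicator {-u..u} z * z\<^sup>2 + u\<^sup>2 * (1 - indicator {-u..u} z) \<partial>std_normal)"
    by (intro Bochner_Integration.integral_cong)
      (use assms in \<open>auto simp: psi_def indicator_def min_def max_def\<close>)
  also have "\<dots> = (\<integral>z. indicator {-u..u} z * z\<^sup>2 \<partial>std_normal)
      + (\<integral>z. u\<^sup>2 * (1 - indicator {-u..u} z) \<partial>std_normal)"
  proof (rule Bochner_Integration.integral_add)
    show "integrable std_normal (\<lambda>z. indicator {-u..u} z * z\<^sup>2)"
      by (rule integrable_std_normal_bounded[where C = "u\<^sup>2"])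
        (use assms in \<open>auto simp: indicator_def abs_le_square_iff[symmetric]\<close>)
    show "integrable std_normal (\<lambda>z. u\<^sup>2 * (1 - indicator {-u..u} z))"
      by (rule integrable_std_normal_bounded[where C = "u\<^sup>2"]) (auto simp: indicator_def)
  qed
  also have "(\<integral>z. u\<^sup>2 * (1 - indicator {-u..u} z) \<partial>std_normal)
      = u\<^sup>2 * (1 - measure std_normal {-u..u})"
    by (simp add: std_normal.emeasure_eq_measure std_normal.prob_space[simplified])
  also have "measure std_normal {-u..u} = 2 * Phi u - 1"
    using Phi_diff[of "-u" u] assms by (simp add: measure_std_normal_Icc Phi_minus)
  finally show ?thesis
    unfolding 1 by (simp add: algebra_simps)
qed


section \<open>Minimax capping and the least favourable density\<close>

lemma B_bar_has_real_derivative [derivative_intros]: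
  "((\<lambda>u. B_bar u \<epsilon>) has_real_derivative 2 * (1 - \<epsilon>) * std_normal_density u) (at u)"
  unfolding B_bar_def by (auto intro!: derivative_eq_intros)

lemma continuous_on_B_bar: "continuous_on S (\<lambda>u. B_bar u \<epsilon>)"
  unfolding B_bar_def by (intro continuous_intros continuous_on_Phi)

lemma B_bar_0 [simp]: "B_bar 0 \<epsilon> = 0"
  by (simp add: B_bar_def)

lemma Phi_less_1: "Phi x < 1"
  using Phi_strict_mono[of x "x + 1"] std_normal.cdf_bounded_prob[of "x + 1"]
  unfolding Phi_def by simp

lemma B_bar_strict_mono: "\<epsilon> < 1 \<Longrightarrow> u < v \<Longrightarrow> B_bar u \<epsilon> < B_bar v \<epsilon>"
  using Phi_strict_mono[of u v] by (simp add: B_bar_def)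

lemma B_bar_pos: "\<epsilon> < 1 \<Longrightarrow> 0 < u \<Longrightarrow> 0 < B_bar u \<epsilon>"
  using B_bar_strict_mono[of \<epsilon> 0 u] by simp

lemma B_bar_less: "\<epsilon> < 1 \<Longrightarrow> B_bar u \<epsilon> < 1 - \<epsilon>"
  using Phi_less_1[of u] by (simp add: B_bar_def)

text \<open>Here \<open>2 * (1 - \<epsilon>) * std_normal_density u\<close> is the derivative of
  \<open>B_bar\<close>, so \<open>A_bar\<close>, and with it \<open>V_bar\<close>, is expressed by
  \<open>B_bar\<close> and its derivative alone. The factor \<open>1 - B_bar u \<epsilon>\<close>
  gathers the Gaussian tails and the whole contamination, where the squared score counts as
  \<open>u\<^sup>2\<close>.\<close>

lemma A_bar_eq:
  assumes "0 \<le> u"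
  shows "A_bar u \<epsilon> = B_bar u \<epsilon> - u * (2 * (1 - \<epsilon>) * std_normal_density u)
    + u\<^sup>2 * (1 - B_bar u \<epsilon>)"
  using assms by (simp add: A_bar_def B_bar_def integral_psi_square algebra_simps)

text \<open>The second derivative of \<open>B_bar\<close> is \<open>- u\<close> times the first, so
  all terms containing the density cancel.\<close>

lemma A_bar_has_real_derivative:
  assumes "0 < u"
  shows "((\<lambda>u. A_bar u \<epsilon>) has_real_derivative 2 * u * (1 - B_bar u \<epsilon>)) (at u)"
proof (rule has_field_derivative_transform_within_open[of _ _ _ "{0<..}"])
  show "((\<lambda>u. B_bar u \<epsilon> - u * (2 * (1 - \<epsilon>) * std_normal_density u)
      + u\<^sup>2 * (1 - B_bar u \<epsilon>)) has_real_derivative 2 * u * (1 - B_bar u \<epsilon>)) (at u)"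
    by (auto intro!: derivative_eq_intros simp: algebra_simps power2_eq_square)
qed (use assms in \<open>auto simp: A_bar_eq\<close>)

text \<open>After one factor \<open>B_bar\<close> is divided out, the numerator of the quotient rule
  splits into two factors, of which only the second can change sign.\<close>

lemma V_bar_has_real_derivative:
  assumes "\<epsilon> < 1" "0 < u"
  defines "D \<equiv> 2 * (1 - \<epsilon>) * std_normal_density u"
  shows "((\<lambda>u. V_bar u \<epsilon>) has_real_derivative
    2 * (B_bar u \<epsilon> - u * D) * (u * (1 - B_bar u \<epsilon>) - D) / (B_bar u \<epsilon>) ^ 3) (at u)"
proof -
  have B: "B_bar u \<epsilon> \<noteq> 0"
    using B_bar_pos[OF assms(1,2)] by simp
  have alg: "((2 * u * (1 - b)) * b ^ 2 - (b - u * d + u\<^sup>2 * (1 - b)) * (2 * b * d)) / (b ^ 2 * b ^ 2)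
      = 2 * (b - u * d) * (u * (1 - b) - d) / b ^ 3" if "b \<noteq> 0" for b d :: real
    using that by (simp add: divide_simps) algebra
  have BD: "((\<lambda>u. B_bar u \<epsilon>) has_real_derivative D) (at u)"
    unfolding D_def by (rule B_bar_has_real_derivative)
  have A: "A_bar u \<epsilon> = B_bar u \<epsilon> - u * D + u\<^sup>2 * (1 - B_bar u \<epsilon>)"
    using assms(2) by (simp add: A_bar_eq D_def)
  have "((\<lambda>u. A_bar u \<epsilon> / (B_bar u \<epsilon>)\<^sup>2) has_real_derivative
      ((2 * u * (1 - B_bar u \<epsilon>)) * (B_bar u \<epsilon>)\<^sup>2 - A_bar u \<epsilon> * (2 * B_bar u \<epsilon> * D))
        / ((B_bar u \<epsilon>)\<^sup>2 * (B_bar u \<epsilon>)\<^sup>2)) (at u)"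
    by (rule DERIV_cong[OF DERIV_divide[OF A_bar_has_real_derivative[OF \<open>0 < u\<close>]
          DERIV_power[OF BD, of 2]]])
      (use B in \<open>simp_all add: mult_ac\<close>)
  then show ?thesis
    unfolding V_bar_def A alg[OF B] .
qed

lemma continuous_on_V_bar:
  assumes "\<epsilon> < 1"
  shows "continuous_on {0<..} (\<lambda>u. V_bar u \<epsilon>)"
  by (intro continuous_at_imp_continuous_on ballI DERIV_isCont[OF V_bar_has_real_derivative[OF assms]])
    auto

text \<open>The sign of the derivative of \<open>V_bar\<close> is that of \<open>u (1 - B) - D\<close>, which increases.\<close>

lemma V_bar_unique_minimum:
  assumes "0 < \<epsilon>" "\<epsilon> < 1"
  obtains k where "0 < k" "k * (1 - B_bar k \<epsilon>) = 2 * (1 - \<epsilon>) * std_normal_density k"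
    "\<And>u. 0 < u \<Longrightarrow> u \<noteq> k \<Longrightarrow> V_bar k \<epsilon> < V_bar u \<epsilon>"
proof -
  define D where "D = (\<lambda>u. 2 * (1 - \<epsilon>) * std_normal_density u)"
  define g where "g = (\<lambda>u. u * (1 - B_bar u \<epsilon>) - D u)"
  have Dpos: "0 < D u" for u
    using assms by (auto simp: D_def intro!: mult_pos_pos normal_density_pos)
  have D_le: "D u \<le> D 0" for u
    using assms by (auto simp: D_def std_normal_density_def intro!: divide_right_mono)
  have D_deriv: "(D has_real_derivative - u * D u) (at u)" for u
    unfolding D_def by (auto intro!: derivative_eq_intros)
  \<comment> \<open>The term \<open>- u * D u\<close> from differentiating \<open>B_bar\<close> is
    cancelled by the derivative of \<open>D\<close>, leaving \<open>1 - B_bar u \<epsilon>\<close>,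
    which exceeds \<open>\<epsilon>\<close>.\<close>
  have g_deriv: "(g has_real_derivative 1 - B_bar u \<epsilon>) (at u)" for u
    unfolding g_def by (auto intro!: derivative_eq_intros D_deriv simp: D_def)
  have g_mono: "g u < g v" if "u < v" for u v
    by (rule DERIV_pos_imp_increasing[OF that])
      (use g_deriv B_bar_less[OF assms(2)] assms in \<open>force intro: order.strict_trans2\<close>)
  \<comment> \<open>The difference starts at zero and has derivative \<open>u\<^sup>2 * D u\<close>;
    this expresses the concavity of \<open>B_bar\<close>.\<close>
  have B_gt: "u * D u < B_bar u \<epsilon>" if "0 < u" for u
  proof -
    have "B_bar 0 \<epsilon> - 0 * D 0 < B_bar u \<epsilon> - u * D u"
    proof (rule DERIV_pos_imp_increasing_open[OF that])
      fix x :: real assume "0 < x"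
      have "((\<lambda>u. B_bar u \<epsilon> - u * D u) has_real_derivative x * x * D x) (at x)"
        by (auto intro!: derivative_eq_intros D_deriv simp: D_def algebra_simps)
      then show "\<exists>y. ((\<lambda>u. B_bar u \<epsilon> - u * D u) has_real_derivative y) (at x) \<and> 0 < y"
        using \<open>0 < x\<close> Dpos[of x] by (intro exI[of _ "x * x * D x"] conjI) auto
    qed (auto simp: D_def intro!: continuous_intros continuous_on_B_bar continuous_on_std_normal_density)
    then show ?thesis by simp
  qed
  \<comment> \<open>At \<open>D 0 / \<epsilon>\<close> the bound
    \<open>1 - B_bar > \<epsilon>\<close> makes the first term of \<open>g\<close> at least
    \<open>D 0\<close>, the maximum of \<open>D\<close>. Positive contamination thus keeps the
    optimal cap finite.\<close>
  have "\<exists>k\<ge>0. k \<le> D 0 / \<epsilon> \<and> g k = 0"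
  proof (rule IVT')
    show "g 0 \<le> 0" using Dpos[of 0] by (simp add: g_def)
    have "D 0 / \<epsilon> * \<epsilon> \<le> D 0 / \<epsilon> * (1 - B_bar (D 0 / \<epsilon>) \<epsilon>)"
      using assms Dpos[of 0] B_bar_less[OF assms(2), of "D 0 / \<epsilon>"]
      by (intro mult_left_mono) (auto intro: less_imp_le)
    then show "0 \<le> g (D 0 / \<epsilon>)"
      using D_le[of "D 0 / \<epsilon>"] assms by (simp add: g_def)
    show "0 \<le> D 0 / \<epsilon>" using Dpos[of 0] assms by simp
    show "continuous_on {0..D 0 / \<epsilon>} g"
      by (meson g_deriv DERIV_isCont continuous_at_imp_continuous_on)
  qed
  then obtain k where k: "0 \<le> k" "g k = 0" by auto
  moreover have "g 0 < 0" using Dpos[of 0] by (simp add: g_def)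
  ultimately have "0 < k" by (cases "k = 0") auto
  define V' where "V' = (\<lambda>u. 2 * (B_bar u \<epsilon> - u * D u) * g u / (B_bar u \<epsilon>) ^ 3)"
  have V_deriv: "((\<lambda>u. V_bar u \<epsilon>) has_real_derivative V' u) (at u)" if "0 < u" for u
    using V_bar_has_real_derivative[OF assms(2) that] by (simp add: D_def g_def V'_def)
  have cont: "continuous_on {a..b} (\<lambda>u. V_bar u \<epsilon>)" if "0 < a" for a b
    using continuous_on_V_bar[OF assms(2)] by (rule continuous_on_subset) (use that in auto)
  have "V_bar k \<epsilon> < V_bar u \<epsilon>" if "0 < u" "u \<noteq> k" for u
  proof (cases "u < k")
    case True
    show ?thesis
    proof (rule DERIV_neg_imp_decreasing_open[OF True])
      fix x assume x: "u < x" "x < k"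
      then have "g x < 0" using g_mono[of x k] k by simp
      moreover have "0 < B_bar x \<epsilon>" "x * D x < B_bar x \<epsilon>"
        using x that B_bar_pos[OF assms(2), of x] B_gt[of x] by auto
      ultimately show "\<exists>y. ((\<lambda>u. V_bar u \<epsilon>) has_real_derivative y) (at x) \<and> y < 0"
        using x that
        by (intro exI[of _ "V' x"] conjI V_deriv) (auto simp: V'_def intro!: divide_neg_pos mult_pos_neg)
    qed (use cont that in auto)
  next
    case False
    then have "k < u" using that by simp
    then show ?thesis
    proof (rule DERIV_pos_imp_increasing_open)
      fix x assume x: "k < x" "x < u"
      then have "0 < g x" using g_mono[of k x] k by simp
      moreover have "0 < B_bar x \<epsilon>" "x * D x < B_bar x \<epsilon>"
        using x \<open>0 < k\<close> B_bar_pos[OF assms(2), of x] B_gt[of x] by auto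
      ultimately show "\<exists>y. ((\<lambda>u. V_bar u \<epsilon>) has_real_derivative y) (at x) \<and> 0 < y"
        using x \<open>0 < k\<close>
        by (intro exI[of _ "V' x"] conjI V_deriv) (auto simp: V'_def intro!: divide_pos_pos mult_pos_pos)
    qed (use cont \<open>0 < k\<close> in auto)
  qed
  with \<open>0 < k\<close> k show ?thesis
    by (intro that[of k]) (auto simp: g_def D_def)
qed

lemma
  assumes "0 < \<epsilon>" "\<epsilon> < 1"
  shows kappa_star_pos: "0 < kappa_star \<epsilon>"
    and kappa_star_stationary: "kappa_star \<epsilon> * (1 - B_bar (kappa_star \<epsilon>) \<epsilon>)
      = 2 * (1 - \<epsilon>) * std_normal_density (kappa_star \<epsilon>)"
    and kappa_star_minimum: "0 < u \<Longrightarrow> V_bar (kappa_star \<epsilon>) \<epsilon> \<le> V_bar u \<epsilon>"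
proof -
  obtain k where k: "0 < k" "k * (1 - B_bar k \<epsilon>) = 2 * (1 - \<epsilon>) * std_normal_density k"
    "\<And>u. 0 < u \<Longrightarrow> u \<noteq> k \<Longrightarrow> V_bar k \<epsilon> < V_bar u \<epsilon>"
    using V_bar_unique_minimum[OF assms] by blast
  have "kappa_star \<epsilon> = k"
    unfolding kappa_star_def is_arg_min_def
  proof (rule the_equality)
    show "0 < k \<and> (\<nexists>y. 0 < y \<and> V_bar y \<epsilon> < V_bar k \<epsilon>)"
      using k(1,3) less_asym by blast
    show "j = k" if "0 < j \<and> (\<nexists>y. 0 < y \<and> V_bar y \<epsilon> < V_bar j \<epsilon>)" for j
      using that k(1,3) by blast
  qed
  with k show "0 < kappa_star \<epsilon>" "kappa_star \<epsilon> * (1 - B_bar (kappa_star \<epsilon>) \<epsilon>)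
      = 2 * (1 - \<epsilon>) * std_normal_density (kappa_star \<epsilon>)"
      "0 < u \<Longrightarrow> V_bar (kappa_star \<epsilon>) \<epsilon> \<le> V_bar u \<epsilon>"
    by (auto intro: less_imp_le)
qed

text \<open>At the stationary cap the last two terms of \<open>A_bar_eq\<close> cancel. Hence
  \<open>V_bar\<close> equals \<open>1 / B_bar\<close> there, which ties the minimax cap to Fisher
  information.\<close>

lemma A_bar_kappa_star:
  assumes "0 < \<epsilon>" "\<epsilon> < 1"
  shows "A_bar (kappa_star \<epsilon>) \<epsilon> = B_bar (kappa_star \<epsilon>) \<epsilon>"
  using kappa_star_stationary[OF assms] kappa_star_pos[OF assms]
  by (simp add: A_bar_eq power2_eq_square)

text \<open>Huber's loss: \<open>x\<^sup>2 / 2\<close> for \<open>\<bar>x\<bar> \<le> k\<close> and \<open>k \<bar>x\<bar> - k\<^sup>2 / 2\<close> beyond.\<close>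

definition huber_rho :: "real \<Rightarrow> real \<Rightarrow> real" where
  "huber_rho k x = psi k x * x - (psi k x)\<^sup>2 / 2"

text \<open>A Gaussian core with exponential tails, whose location score \<open>- f' / f\<close> is
  \<open>psi k\<close>. The constant is that of the Gaussian share, not a normalization: total mass
  one singles out the stationary cap.\<close>

definition huber_density :: "real \<Rightarrow> real \<Rightarrow> real \<Rightarrow> real" where
  "huber_density \<epsilon> k x = (1 - \<epsilon>) / sqrt (2 * pi) * exp (- huber_rho k x)"

lemma huber_density_measurable [measurable]: "huber_density \<epsilon> k \<in> borel_measurable borel"
  unfolding huber_density_def[abs_def] huber_rho_def by measurable

lemma huber_density_inner: "\<bar>x\<bar> \<le> k \<Longrightarrow> huber_density \<epsilon> k x = (1 - \<epsilon>) * std_normal_density x"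
  by (auto simp: huber_density_def huber_rho_def std_normal_density_def psi_def power2_eq_square)

lemma huber_density_outer:
  assumes "0 < k" "k \<le> \<bar>x\<bar>"
  shows "huber_density \<epsilon> k x = (1 - \<epsilon>) * std_normal_density k * exp (- k * (\<bar>x\<bar> - k))"
proof -
  have "huber_rho k x = k\<^sup>2 / 2 + k * (\<bar>x\<bar> - k)"
  proof -
    have "psi k x = k \<and> \<bar>x\<bar> = x \<or> psi k x = - k \<and> \<bar>x\<bar> = - x"
      using assms by (auto simp: psi_def)
    then show ?thesis
      by (auto simp: huber_rho_def power2_eq_square field_simps)
  qed
  then have "exp (- huber_rho k x) = exp (- k\<^sup>2 / 2) * exp (- k * (\<bar>x\<bar> - k))"
    by (simp add: exp_add[symmetric])
  then show ?thesis
    by (simp add: huber_density_def std_normal_density_def)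
qed

text \<open>The gap \<open>x\<^sup>2 / 2 - huber_rho k x\<close> is
  \<open>(x - psi k x)\<^sup>2 / 2\<close>. The excess of the density over its Gaussian share is
  therefore nonnegative and can serve as contamination.\<close>

lemma huber_density_ge:
  assumes "0 < k" "\<epsilon> < 1"
  shows "(1 - \<epsilon>) * std_normal_density x \<le> huber_density \<epsilon> k x"
proof -
  have "0 \<le> (x - psi k x)\<^sup>2" by simp
  then have "huber_rho k x \<le> x\<^sup>2 / 2"
    by (simp add: huber_rho_def power2_eq_square algebra_simps)
  with assms show ?thesis
    by (auto simp: huber_density_def std_normal_density_def intro!: divide_right_mono mult_left_mono)
qed

text \<open>Differentiating \<open>huber_rho\<close> gives \<open>psi + psi' * (x - psi)\<close>,
  and the second summand vanishes because \<open>psi k x = x\<close> wherever the slope is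
  one.\<close>

lemma huber_density_has_real_derivative:
  assumes "0 < k" "x \<notin> {-k, k}"
  shows "(huber_density \<epsilon> k has_real_derivative - psi k x * huber_density \<epsilon> k x) (at x)"
proof -
  have "(psi k has_real_derivative indicator {-k..k} x) (at x)"
    using clamp_has_real_derivative[of "-k" k x] assms by (simp add: psi_def[abs_def])
  moreover have "psi k x = x" if "\<bar>x\<bar> \<le> k"
    using that by (auto simp: psi_def)
  ultimately have "((\<lambda>x. c * exp (- (psi k x * x - (psi k x)\<^sup>2 / 2))) has_real_derivative
      - psi k x * (c * exp (- (psi k x * x - (psi k x)\<^sup>2 / 2)))) (at x)" for c
    by (auto intro!: derivative_eq_intros simp: indicator_def abs_le_iff)
  then show ?thesis
    unfolding huber_density_def[abs_def] huber_rho_def .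
qed

lemma continuous_on_psi [continuous_intros]:
  "continuous_on S f \<Longrightarrow> continuous_on S g \<Longrightarrow> continuous_on S (\<lambda>x. psi (f x) (g x))"
  unfolding psi_def by (intro continuous_intros)

lemma continuous_on_huber_density: "continuous_on S (huber_density \<epsilon> k)"
  unfolding huber_density_def[abs_def] huber_rho_def by (intro continuous_intros) auto

lemma huber_density_tail:
  assumes "0 < k" "\<epsilon> < 1"
  shows "(\<integral>\<^sup>+x. ennreal (huber_density \<epsilon> k x) * indicator {k..} x \<partial>lborel)
    = ennreal ((1 - \<epsilon>) * std_normal_density k / k)"
proof -
  define c where "c = (1 - \<epsilon>) * std_normal_density k"
  have "0 \<le> c" using assms by (simp add: c_def)
  have "(\<integral>\<^sup>+x. ennreal (huber_density \<epsilon> k x) * indicator {k..} x \<partial>lborel)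
      = (\<integral>\<^sup>+x. ennreal (c * exp (- k * (x - k))) * indicator {k..} x \<partial>lborel)"
    using assms by (intro nn_integral_cong) (auto simp: indicator_def huber_density_outer c_def)
  also have "\<dots> = ennreal (0 - (- c / k * exp (- k * (k - k))))"
  proof (rule nn_integral_FTC_atLeast[where F = "\<lambda>x. - c / k * exp (- k * (x - k))"])
    have "((\<lambda>x. - c / k * exp (- k * (x - k))) \<longlongrightarrow> - c / k * 0) at_top"
    proof (intro tendsto_mult_left filterlim_compose[OF exp_at_bot])
      have "filterlim (\<lambda>x. k * (- k + x)) at_top at_top"
        using assms by (intro filterlim_tendsto_pos_mult_at_top[OF tendsto_const]
            filterlim_tendsto_add_at_top[OF tendsto_const] filterlim_ident)
      then show "filterlim (\<lambda>x. - k * (x - k)) at_bot at_top"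
        by (simp add: filterlim_uminus_at_top algebra_simps)
    qed
    then show "((\<lambda>x. - c / k * exp (- k * (x - k))) \<longlongrightarrow> 0) at_top" by simp
  qed (use assms \<open>0 \<le> c\<close> in \<open>auto intro!: derivative_eq_intros\<close>)
  finally show ?thesis by (simp add: c_def)
qed

lemma psi_minus: "0 \<le> k \<Longrightarrow> psi k (- x) = - psi k x"
  by (auto simp: psi_def)

lemma huber_density_even: "0 < k \<Longrightarrow> huber_density \<epsilon> k (- x) = huber_density \<epsilon> k x"
  by (simp add: huber_density_def huber_rho_def psi_minus)

lemma nn_integral_even:
  fixes f :: "real \<Rightarrow> ennreal"
  assumes [measurable]: "f \<in> borel_measurable borel" and "\<And>x. f (- x) = f x"
  shows "(\<integral>\<^sup>+x. f x \<partial>lborel) = 2 * (\<integral>\<^sup>+x. f x * indicator {0..} x \<partial>lborel)"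
proof -
  have "(\<integral>\<^sup>+x. f x \<partial>lborel)
      = (\<integral>\<^sup>+x. f x * indicator {0..} x + f x * indicator {..0} x \<partial>lborel)"
    by (rule nn_integral_cong_AE)
      (use AE_lborel_singleton[of 0] in \<open>auto simp: indicator_def\<close>)
  also have "\<dots> = (\<integral>\<^sup>+x. f x * indicator {0..} x \<partial>lborel) + (\<integral>\<^sup>+x. f x * indicator {..0} x \<partial>lborel)"
    by (rule nn_integral_add) auto
  also have "(\<integral>\<^sup>+x. f x * indicator {..0} x \<partial>lborel)
      = (\<integral>\<^sup>+x. f (- x) * indicator {..0} (- x) \<partial>lborel)"
    by (subst nn_integral_real_affine[of _ "- 1" 0]) auto
  also have "\<dots> = (\<integral>\<^sup>+x. f x * indicator {0..} x \<partial>lborel)"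
    by (intro nn_integral_cong) (auto simp: assms(2) indicator_def)
  finally show ?thesis by (simp add: mult_2)
qed

lemma nn_integral_huber_density:
  assumes "0 < k" "\<epsilon> < 1"
  shows "(\<integral>\<^sup>+x. ennreal (huber_density \<epsilon> k x) \<partial>lborel)
    = ennreal (B_bar k \<epsilon> + 2 * (1 - \<epsilon>) * std_normal_density k / k)"
proof -
  let ?f = "huber_density \<epsilon> k"
  have f_nn: "0 \<le> ?f x" for x
    using assms by (simp add: huber_density_def)
  have "(\<integral>\<^sup>+x. ennreal (?f x) * indicator {0..k} x \<partial>lborel)
      = (\<integral>\<^sup>+x. ennreal (1 - \<epsilon>) * (ennreal (std_normal_density x) * indicator {0..k} x) \<partial>lborel)"
    using assms
    by (intro nn_integral_cong) (auto simp: indicator_def huber_density_inner ennreal_mult')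
  also have "\<dots> = ennreal (1 - \<epsilon>) * emeasure std_normal {0..k}"
    by (subst nn_integral_cmult) (auto simp: std_normal_def emeasure_density)
  also have "\<dots> = ennreal ((1 - \<epsilon>) * (Phi k - 1 / 2))"
    using assms Phi_diff[of 0 k]
    by (simp add: std_normal.emeasure_eq_measure measure_std_normal_Icc ennreal_mult'[symmetric])
  finally have 1: "(\<integral>\<^sup>+x. ennreal (?f x) * indicator {0..k} x \<partial>lborel)
      = ennreal ((1 - \<epsilon>) * (Phi k - 1 / 2))" .
  have "(\<integral>\<^sup>+x. ennreal (?f x) \<partial>lborel) = 2 * (\<integral>\<^sup>+x. ennreal (?f x) * indicator {0..} x \<partial>lborel)"
    using assms by (intro nn_integral_even)
      (auto simp: huber_density_even)
  also have "(\<integral>\<^sup>+x. ennreal (?f x) * indicator {0..} x \<partial>lborel)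
      = (\<integral>\<^sup>+x. ennreal (?f x) * indicator {0..k} x + ennreal (?f x) * indicator {k..} x \<partial>lborel)"
    by (rule nn_integral_cong_AE)
      (use AE_lborel_singleton[of k] assms in \<open>auto simp: indicator_def\<close>)
  also have "\<dots> = ennreal ((1 - \<epsilon>) * (Phi k - 1 / 2)) + ennreal ((1 - \<epsilon>) * std_normal_density k / k)"
    by (subst nn_integral_add) (auto simp: 1 huber_density_tail[OF assms])
  also have "2 * \<dots> = ennreal (2 * ((1 - \<epsilon>) * (Phi k - 1 / 2) + (1 - \<epsilon>) * std_normal_density k / k))"
    using assms Phi_strict_mono[of 0 k]
    by (subst ennreal_mult') (auto simp: ennreal_plus)
  also have "2 * ((1 - \<epsilon>) * (Phi k - 1 / 2) + (1 - \<epsilon>) * std_normal_density k / k)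
      = B_bar k \<epsilon> + 2 * (1 - \<epsilon>) * std_normal_density k / k"
    using assms by (simp add: B_bar_def field_simps)
  finally show ?thesis .
qed


lemma emeasure_density_mixture:
  fixes f g h :: "real \<Rightarrow> real"
  assumes [measurable]: "f \<in> borel_measurable borel" "g \<in> borel_measurable borel"
      "h \<in> borel_measurable borel" "A \<in> sets borel"
    and "0 \<le> a" "0 \<le> b" "\<And>x. 0 \<le> g x" "\<And>x. 0 \<le> h x" "\<And>x. f x = a * g x + b * h x"
  shows "emeasure (density lborel f) A
    = ennreal a * emeasure (density lborel g) A + ennreal b * emeasure (density lborel h) A"
proof -
  have "ennreal (f x) * indicator A x
      = ennreal a * (ennreal (g x) * indicator A x) + ennreal b * (ennreal (h x) * indicator A x)" for x
    using assms(5-) by (auto simp: indicator_def ennreal_plus ennreal_mult)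
  then show ?thesis
    by (simp add: emeasure_density nn_integral_add nn_integral_cmult)
qed

text \<open>Huber's density is admissible in the infimum, which bounds the information by the
  integral of \<open>(psi k)\<^sup>2\<close> against it. The contamination lives where the score is
  saturated, so this integral is \<open>A_bar\<close>, and at the stationary cap that is
  \<open>B_bar\<close>.\<close>

lemma fisher_information_huber_le:
  assumes "0 < \<epsilon>" "\<epsilon> < 1"
  obtains F where "F \<in> contam \<epsilon>" "fisher_information F \<le> ennreal (B_bar (kappa_star \<epsilon>) \<epsilon>)"
proof -
  define k where "k = kappa_star \<epsilon>"
  have k: "0 < k" "k * (1 - B_bar k \<epsilon>) = 2 * (1 - \<epsilon>) * std_normal_density k"
    using kappa_star_pos kappa_star_stationary assms by (auto simp: k_def)
  define f where "f = huber_density \<epsilon> k"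
  define h where "h = (\<lambda>x. (f x - (1 - \<epsilon>) * std_normal_density x) / \<epsilon>)"
  define F where "F = density lborel (\<lambda>x. ennreal (f x))"
  define H where "H = density lborel (\<lambda>x. ennreal (h x))"
  have f_meas [measurable]: "f \<in> borel_measurable borel"
    by (simp add: f_def)
  have h_meas [measurable]: "h \<in> borel_measurable borel"
    unfolding h_def by measurable
  have f_nn: "0 \<le> f x" and h_nn: "0 \<le> h x" for x
    using assms huber_density_ge[OF k(1) assms(2), of x] by (auto simp: f_def huber_density_def h_def)
  have f_eq: "f x = (1 - \<epsilon>) * std_normal_density x + \<epsilon> * h x" for x
    using assms by (simp add: h_def)
  have mix: "emeasure F A = ennreal (1 - \<epsilon>) * emeasure std_normal A + ennreal \<epsilon> * emeasure H A"
    if "A \<in> sets borel" for A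
    unfolding F_def H_def std_normal_def
    by (rule emeasure_density_mixture) (use assms h_nn f_eq that in auto)
  \<comment> \<open>Stationarity of \<open>k\<close> says exactly that the masses of core and tails
    add up to one.\<close>
  have F_UNIV: "emeasure F UNIV = 1"
  proof -
    have "B_bar k \<epsilon> + 2 * (1 - \<epsilon>) * std_normal_density k / k = 1"
      unfolding k(2)[symmetric] using k(1) by simp
    then show ?thesis
      using nn_integral_huber_density[OF k(1) assms(2)] by (simp add: F_def emeasure_density f_def)
  qed
  interpret F: prob_space F
    by (rule prob_spaceI) (use F_UNIV in \<open>simp add: F_def\<close>)
  have mix_UNIV: "1 = ennreal (1 - \<epsilon>) + ennreal \<epsilon> * emeasure H UNIV"
    using mix[of UNIV] F_UNIV std_normal.emeasure_space_1 by simp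
  have H_UNIV: "emeasure H UNIV = 1"
  proof (cases "emeasure H UNIV")
    case (real x)
    then have "1 = (1 - \<epsilon>) + \<epsilon> * x"
      using mix_UNIV assms
      by (simp add: ennreal_mult[symmetric] ennreal_plus[symmetric] del: ennreal_plus)
    then show ?thesis using assms real by simp
  next
    case top
    then show ?thesis using mix_UNIV assms by (simp add: ennreal_mult_top)
  qed
  interpret H: prob_space H
    by (rule prob_spaceI) (use H_UNIV in \<open>simp add: H_def\<close>)
  have F_rd: "real_distribution F" and H_rd: "real_distribution H"
    by (unfold_locales; simp add: F_def H_def)+
  have "cdf F x = (1 - \<epsilon>) * Phi x + \<epsilon> * cdf H x" for x
    using mix[of "{..x}"] assms
    by (simp add: cdf_def Phi_def F.emeasure_eq_measure H.emeasure_eq_measure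
        std_normal.emeasure_eq_measure ennreal_mult[symmetric] ennreal_plus[symmetric]
        del: ennreal_plus)
  with F_rd H_rd have "F \<in> contam \<epsilon>"
    by (auto simp: contam_def)
  moreover have "fisher_information F \<le> ennreal (B_bar k \<epsilon>)"
  proof -
    define f' where "f' = (\<lambda>x. - psi k x * f x)"
    have cont_f': "continuous_on S f'" and cont_f: "continuous_on S f" for S
      unfolding f'_def f_def by (intro continuous_intros continuous_on_huber_density)+
    have "fisher_information F \<le> (\<integral>\<^sup>+x. ennreal ((f' x)\<^sup>2 / f x) \<partial>lborel)"
      unfolding fisher_information_def
    proof (rule Inf_lower, intro CollectI exI conjI allI impI)
      show "F = density lborel (\<lambda>x. ennreal (f x))" by (simp add: F_def)
      fix a b :: real assume "a \<le> b"
      show int: "set_integrable lborel {a..b} f'"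
        by (rule borel_integrable_atLeastAtMost'[OF cont_f'])
      have "(f' has_integral (f b - f a)) {a..b}"
        by (rule fundamental_theorem_of_calculus_interior_strong[of "{-k, k}"])
          (use \<open>a \<le> b\<close> cont_f huber_density_has_real_derivative[OF k(1)]
            in \<open>auto simp: f_def f'_def has_real_derivative_iff_has_vector_derivative[symmetric]\<close>)
      then show "f b - f a = (LBINT x:{a..b}. f' x)"
        using set_borel_integral_eq_integral(2)[OF int] by (simp add: integral_unique)
    qed (use f_nn in auto)
    also have "\<dots> = (\<integral>\<^sup>+x. ennreal (1 - \<epsilon>) * ennreal (std_normal_density x * (psi k x)\<^sup>2)
        + ennreal (\<epsilon> * k\<^sup>2) * ennreal (h x) \<partial>lborel)"
    proof (rule nn_integral_cong)
      fix x
      have "f x \<noteq> 0" using assms by (simp add: f_def huber_density_def)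
      then have "(f' x)\<^sup>2 / f x = (psi k x)\<^sup>2 * f x"
        by (simp add: f'_def power2_eq_square)
      \<comment> \<open>Inside the core \<open>h\<close> is zero, so
        \<open>(psi k x)\<^sup>2\<close> may be replaced by \<open>k\<^sup>2\<close> in front of it
        everywhere.\<close>
      also have "\<dots> = (1 - \<epsilon>) * (std_normal_density x * (psi k x)\<^sup>2) + \<epsilon> * k\<^sup>2 * h x"
      proof (cases "\<bar>x\<bar> \<le> k")
        case True
        then have "h x = 0" by (simp add: h_def f_def huber_density_inner)
        then show ?thesis by (simp add: f_eq)
      next
        case False
        then have "(psi k x)\<^sup>2 = k\<^sup>2" using k(1) by (auto simp: psi_def min_def max_def)
        then show ?thesis by (simp add: f_eq algebra_simps)
      qed
      finally show "ennreal ((f' x)\<^sup>2 / f x)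
          = ennreal (1 - \<epsilon>) * ennreal (std_normal_density x * (psi k x)\<^sup>2)
            + ennreal (\<epsilon> * k\<^sup>2) * ennreal (h x)"
        using assms h_nn[of x] by (simp add: ennreal_mult[symmetric] ennreal_plus[symmetric] del: ennreal_plus)
    qed
    also have "\<dots> = ennreal (1 - \<epsilon>) * (\<integral>\<^sup>+x. ennreal (std_normal_density x * (psi k x)\<^sup>2) \<partial>lborel)
        + ennreal (\<epsilon> * k\<^sup>2) * (\<integral>\<^sup>+x. ennreal (h x) \<partial>lborel)"
      by (subst nn_integral_add) (auto simp: nn_integral_cmult)
    also have "(\<integral>\<^sup>+x. ennreal (h x) \<partial>lborel) = 1"
      using H_UNIV by (simp add: H_def emeasure_density)
    also have "(\<integral>\<^sup>+x. ennreal (std_normal_density x * (psi k x)\<^sup>2) \<partial>lborel)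
        = ennreal (\<integral>x. (psi k x)\<^sup>2 \<partial>std_normal)"
    proof -
      have "integrable std_normal (\<lambda>x. (psi k x)\<^sup>2)"
        by (rule integrable_std_normal_bounded[where C = "k\<^sup>2"])
          (use psi_bound[of k] k(1) in \<open>auto simp: abs_le_square_iff[symmetric]\<close>)
      then show ?thesis
        by (simp add: integral_std_normal integrable_std_normal_iff nn_integral_eq_integral)
    qed
    also have "ennreal (1 - \<epsilon>) * ennreal (\<integral>x. (psi k x)\<^sup>2 \<partial>std_normal) + ennreal (\<epsilon> * k\<^sup>2) * 1
        = ennreal (A_bar k \<epsilon>)"
      using assms
      by (simp add: A_bar_def ennreal_mult[symmetric] ennreal_plus[symmetric] del: ennreal_plus)
    finally show ?thesis
      using A_bar_kappa_star[OF assms] by (simp add: k_def)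
  qed
  ultimately show ?thesis
    using that by (simp add: k_def)
qed

text \<open>Minimality puts the information of \<open>F\<close> below that of Huber's law, so the
  hypothesis passes to the larger value.\<close>

lemma fisher_minimizer_B_bar:
  assumes "0 < \<epsilon>" "\<epsilon> < 1" "0 < m" "fisher_minimizer \<epsilon> F" "ennreal m * fisher_information F > 1"
  shows "1 < m * B_bar (kappa_star \<epsilon>) \<epsilon>"
proof -
  obtain G where G: "G \<in> contam \<epsilon>" "fisher_information G \<le> ennreal (B_bar (kappa_star \<epsilon>) \<epsilon>)"
    using fisher_information_huber_le[OF assms(1,2)] .
  have "fisher_information F \<le> fisher_information G"
    using assms(4) G(1) unfolding fisher_minimizer_def is_arg_min_def by (meson not_le)
  then have "ennreal m * fisher_information F \<le> ennreal m * ennreal (B_bar (kappa_star \<epsilon>) \<epsilon>)"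
    using G(2) by (intro mult_left_mono) auto
  then have "1 < ennreal (m * B_bar (kappa_star \<epsilon>) \<epsilon>)"
    using assms by (simp add: ennreal_mult')
  then show ?thesis
    by (simp add: ennreal_less_iff flip: ennreal_1)
qed


section \<open>Contaminated laws with Gaussian noise\<close>

lemma contamE:
  assumes "F \<in> contam \<epsilon>"
  obtains H where "real_distribution F" "real_distribution H"
    "\<And>x. cdf F x = (1 - \<epsilon>) * Phi x + \<epsilon> * cdf H x"
  using assms by (auto simp: contam_def)

text \<open>The class is given by distribution functions. Half-lines are an intersection-stable
  generator, and as all three laws have mass one the identity survives complements as well as
  disjoint unions.\<close>

lemma contam_measure:
  assumes "real_distribution F" "real_distribution H"
    and "\<And>x. cdf F x = (1 - \<epsilon>) * Phi x + \<epsilon> * cdf H x"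
    and "A \<in> sets borel"
  shows "measure F A = (1 - \<epsilon>) * measure std_normal A + \<epsilon> * measure H A"
proof -
  interpret F: real_distribution F by fact
  interpret H: real_distribution H by fact
  have A: "A \<in> sigma_sets UNIV (range (\<lambda>a::real. {..a}))"
    using assms(4) by (simp add: borel_eq_atMost)
  have "Int_stable (range (\<lambda>a::real. {..a}))"
    by (auto simp: Int_stable_def)
  moreover have "range (\<lambda>a::real. {..a}) \<subseteq> Pow UNIV" by simp
  ultimately show ?thesis using A
  proof (induction A rule: sigma_sets_induct_disjoint)
    case (basic A)
    then show ?case using assms(3) by (auto simp: cdf_def Phi_def)
  next
    case (compl A)
    then have "A \<in> sets borel" by (simp add: borel_eq_atMost)
    then have co: "measure F (UNIV - A) = 1 - measure F A" "measure H (UNIV - A) = 1 - measure H A"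
        "measure std_normal (UNIV - A) = 1 - measure std_normal A"
      using F.prob_compl[of A] H.prob_compl[of A] std_normal.prob_compl[of A] by simp_all
    show ?case
      unfolding co compl.IH by (simp add: algebra_simps)
  next
    case (union A)
    then have [measurable]: "A i \<in> sets borel" for i by (auto simp: borel_eq_atMost)
    have "(\<lambda>i. (1 - \<epsilon>) * measure std_normal (A i) + \<epsilon> * measure H (A i))
        sums ((1 - \<epsilon>) * measure std_normal (\<Union>i. A i) + \<epsilon> * measure H (\<Union>i. A i))"
      using union(1)
      by (intro sums_add sums_mult std_normal.finite_measure_UNION H.finite_measure_UNION) auto
    moreover have "(\<lambda>i. measure F (A i)) sums measure F (\<Union>i. A i)"
      using union(1) by (intro F.finite_measure_UNION) auto
    ultimately show ?case using union.IH by (simp add: sums_unique2)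
  qed auto
qed

lemma nn_integral_mixture:
  assumes "sets F = sets M" "sets G = sets M"
    and "\<And>A. A \<in> sets M \<Longrightarrow> emeasure F A = a * emeasure M A + b * emeasure G A"
    and "f \<in> borel_measurable M"
  shows "(\<integral>\<^sup>+x. f x \<partial>F) = a * (\<integral>\<^sup>+x. f x \<partial>M) + b * (\<integral>\<^sup>+x. f x \<partial>G)"
proof -
  note [measurable_cong] = assms(1,2)
  have sp: "space F = space M" "space G = space M"
    using assms(1,2) by (simp_all cong: sets_eq_imp_space_eq)
  show ?thesis
    using assms(4)
  proof (induction f rule: borel_measurable_induct)
    case (cong f g)
    have "integral\<^sup>N F f = integral\<^sup>N F g" "integral\<^sup>N M f = integral\<^sup>N M g"
        "integral\<^sup>N G f = integral\<^sup>N G g"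
      using cong(3) by (auto intro!: nn_integral_cong simp: sp)
    then show ?case using cong by simp
  next
    case (set A)
    then show ?case using assms by simp
  next
    case (mult u c)
    then show ?case by (simp add: nn_integral_cmult algebra_simps)
  next
    case (add u v)
    then show ?case by (simp add: nn_integral_add algebra_simps)
  next
    case (seq U)
    have mono: "U i x \<le> U j x" if "i \<le> j" for i j x
      using \<open>incseq U\<close> that by (auto simp: incseq_def le_fun_def)
    have "(SUP i. a * (\<integral>\<^sup>+x. U i x \<partial>M) + b * (\<integral>\<^sup>+x. U i x \<partial>G))
      = a * (SUP i. \<integral>\<^sup>+x. U i x \<partial>M) + b * (SUP i. \<integral>\<^sup>+x. U i x \<partial>G)"
      by (subst ennreal_SUP_add)
        (auto simp: SUP_mult_left_ennreal incseq_def intro!: mult_left_mono nn_integral_mono mono)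
    moreover have "f = (\<lambda>x. SUP i. U i x)"
      using seq by (simp add: fun_eq_iff image_comp)
    ultimately show ?case
      using seq by (simp add: nn_integral_monotone_convergence_SUP cong: SUP_cong)
  qed
qed

lemma contam_integral:
  fixes f :: "real \<Rightarrow> real"
  assumes "0 \<le> \<epsilon>" "\<epsilon> \<le> 1" "real_distribution F" "real_distribution H"
    and "\<And>x. cdf F x = (1 - \<epsilon>) * Phi x + \<epsilon> * cdf H x"
    and [measurable]: "f \<in> borel_measurable borel" and "\<And>x. 0 \<le> f x" "\<And>x. f x \<le> C"
  shows "(\<integral>x. f x \<partial>F) = (1 - \<epsilon>) * (\<integral>x. f x \<partial>std_normal) + \<epsilon> * (\<integral>x. f x \<partial>H)"
proof -
  interpret F: real_distribution F by fact
  interpret H: real_distribution H by fact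
  have int: "integrable F f" "integrable H f" "integrable std_normal f"
    using assms(7,8)
    by (auto intro!: F.integrable_const_bound[where B = C] H.integrable_const_bound[where B = C]
        std_normal.integrable_const_bound[where B = C])
  have "(\<integral>\<^sup>+x. ennreal (f x) \<partial>F)
      = ennreal (1 - \<epsilon>) * (\<integral>\<^sup>+x. ennreal (f x) \<partial>std_normal) + ennreal \<epsilon> * (\<integral>\<^sup>+x. ennreal (f x) \<partial>H)"
  proof (rule nn_integral_mixture)
    show "emeasure F A = ennreal (1 - \<epsilon>) * emeasure std_normal A + ennreal \<epsilon> * emeasure H A"
      if "A \<in> sets std_normal" for A
      using contam_measure[OF assms(3-5), of A] that assms(1,2)
      by (simp add: F.emeasure_eq_measure H.emeasure_eq_measure std_normal.emeasure_eq_measure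
          ennreal_mult[symmetric] ennreal_plus[symmetric] del: ennreal_plus)
  qed auto
  then have "ennreal (\<integral>x. f x \<partial>F)
      = ennreal ((1 - \<epsilon>) * (\<integral>x. f x \<partial>std_normal) + \<epsilon> * (\<integral>x. f x \<partial>H))"
    using int assms(1,2,7)
    by (simp add: nn_integral_eq_integral ennreal_mult[symmetric] ennreal_plus[symmetric]
        integral_nonneg_AE del: ennreal_plus)
  then show ?thesis
    using assms(1,2,7) by (subst (asm) ennreal_inj) (auto intro!: integral_nonneg_AE add_nonneg_nonneg mult_nonneg_nonneg)
qed

section \<open>Laws convolved with Gaussian noise\<close>

context real_distribution begin

interpretation pair: pair_prob_space M std_normal ..

lemma integral_noisy:
  fixes f :: "real \<Rightarrow> 'a :: {banach, second_countable_topology}"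
  assumes [measurable]: "f \<in> borel_measurable borel"
  shows "(\<integral>y. f y \<partial>noisy M \<tau>) = (\<integral>p. f (fst p + \<tau> * snd p) \<partial>(M \<Otimes>\<^sub>M std_normal))"
  unfolding noisy_def by (subst integral_distr) (auto simp: case_prod_unfold)

lemma real_distribution_noisy: "real_distribution (noisy M \<tau>)"
  unfolding noisy_def by (rule pair.real_distribution_distr) (simp add: case_prod_unfold)

lemma integrable_pair_bounded:
  fixes f :: "real \<times> real \<Rightarrow> real"
  assumes "f \<in> borel_measurable (M \<Otimes>\<^sub>M std_normal)" "\<And>p. \<bar>f p\<bar> \<le> C"
  shows "integrable (M \<Otimes>\<^sub>M std_normal) f"
  using assms by (intro pair.integrable_const_bound[where B = C]) auto

lemma integral_noisy_iterated:
  fixes f :: "real \<Rightarrow> real"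
  assumes [measurable]: "f \<in> borel_measurable borel" and "\<And>x. \<bar>f x\<bar> \<le> C"
  shows "(\<integral>y. f y \<partial>noisy M \<tau>) = (\<integral>w. (\<integral>z. f (w + \<tau> * z) \<partial>std_normal) \<partial>M)"
proof -
  have "integrable (M \<Otimes>\<^sub>M std_normal) (\<lambda>(w, z). f (w + \<tau> * z))"
    by (rule integrable_pair_bounded[where C = C]) (use assms(2) in auto)
  from pair.integral_fst[OF this] show ?thesis
    by (simp add: integral_noisy case_prod_unfold)
qed

lemma char_noisy: "char (noisy M \<tau>) t = char M t * char std_normal (t * \<tau>)"
proof -
  have "integrable (M \<Otimes>\<^sub>M std_normal) (\<lambda>(w, z). iexp (t * (w + \<tau> * z)))"
    by (intro pair.integrable_const_bound[where B = 1]) auto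
  then have "char (noisy M \<tau>) t = (\<integral>w. (\<integral>z. iexp (t * (w + \<tau> * z)) \<partial>std_normal) \<partial>M)"
    unfolding char_def using pair.integral_fst[of "\<lambda>w z. iexp (t * (w + \<tau> * z))"]
    by (subst integral_noisy) (auto simp: case_prod_unfold)
  also have "\<dots> = (\<integral>w. iexp (t * w) * (\<integral>z. iexp (t * \<tau> * z) \<partial>std_normal) \<partial>M)"
    by (subst Bochner_Integration.integral_mult_right_zero[symmetric])
      (simp add: exp_add[symmetric] algebra_simps)
  finally show ?thesis by (simp add: char_def)
qed

end

text \<open>Variances of independent Gaussians add, as the product of the characteristic functions
  shows. A threshold \<open>\<kappa> * sqrt (1 + \<tau>\<^sup>2)\<close> therefore lies
  \<open>\<kappa>\<close> standard deviations out on the uncontaminated part.\<close>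

lemma noisy_std_normal: "noisy std_normal \<tau> = distr std_normal borel (\<lambda>z. sqrt (1 + \<tau>\<^sup>2) * z)"
proof (rule Levy_uniqueness)
  show "char (noisy std_normal \<tau>) = char (distr std_normal borel (\<lambda>z. sqrt (1 + \<tau>\<^sup>2) * z))"
  proof
    fix t
    have std: "char std_normal = (\<lambda>t. complex_of_real (exp (- (t\<^sup>2) / 2)))"
      using char_std_normal_distribution by (simp add: std_normal_def)
    have "char (distr std_normal borel (\<lambda>z. sqrt (1 + \<tau>\<^sup>2) * z)) t = char std_normal (t * sqrt (1 + \<tau>\<^sup>2))"
      unfolding char_def by (subst integral_distr) (auto simp: mult.assoc)
    moreover have "exp (- (t\<^sup>2) / 2) * exp (- ((t * \<tau>)\<^sup>2) / 2) = exp (- ((t * sqrt (1 + \<tau>\<^sup>2))\<^sup>2) / 2)"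
      by (simp add: exp_add[symmetric] power_mult_distrib field_simps)
    ultimately show "char (noisy std_normal \<tau>) t = char (distr std_normal borel (\<lambda>z. sqrt (1 + \<tau>\<^sup>2) * z)) t"
      unfolding std_normal.char_noisy by (simp add: std flip: of_real_mult)
  qed
qed (auto intro: std_normal.real_distribution_noisy std_normal.real_distribution_distr)

text \<open>Averaging over the noise first gives a bounded nonnegative function \<open>K\<close> of
  \<open>w\<close>, to which the mixture formula applies; the averaging is then undone on each
  component.\<close>

lemma contam_integral_noisy:
  fixes f :: "real \<Rightarrow> real"
  assumes "0 \<le> \<epsilon>" "\<epsilon> \<le> 1" "real_distribution F" "real_distribution H"
    and "\<And>x. cdf F x = (1 - \<epsilon>) * Phi x + \<epsilon> * cdf H x"
    and [measurable]: "f \<in> borel_measurable borel" and "\<And>x. 0 \<le> f x" "\<And>x. f x \<le> C"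
  shows "(\<integral>x. f x \<partial>noisy F \<tau>)
    = (1 - \<epsilon>) * (\<integral>z. f (sqrt (1 + \<tau>\<^sup>2) * z) \<partial>std_normal) + \<epsilon> * (\<integral>x. f x \<partial>noisy H \<tau>)"
proof -
  interpret F: real_distribution F by fact
  interpret H: real_distribution H by fact
  define K where "K = (\<lambda>w. \<integral>z. f (w + \<tau> * z) \<partial>std_normal)"
  have abs_f: "\<bar>f x\<bar> \<le> C" for x using assms(7,8) by simp
  have "C \<ge> 0" using assms(7,8) order_trans by blast
  have K_meas: "K \<in> borel_measurable borel"
    unfolding K_def by (rule std_normal.borel_measurable_lebesgue_integral) simp
  have K: "0 \<le> K w" "K w \<le> C" for w
  proof -
    show "0 \<le> K w" using assms(7) by (simp add: K_def)
    have "K w \<le> (\<integral>z. C \<partial>std_normal)"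
      unfolding K_def
      by (intro integral_mono integrable_std_normal_bounded[where C = C]) (use abs_f \<open>0 \<le> C\<close> assms(8) in auto)
    then show "K w \<le> C" using std_normal.prob_space by simp
  qed
  have "(\<integral>x. f x \<partial>noisy F \<tau>) = (\<integral>w. K w \<partial>F)"
    unfolding K_def by (rule F.integral_noisy_iterated[OF _ abs_f]) simp
  also have "\<dots> = (1 - \<epsilon>) * (\<integral>w. K w \<partial>std_normal) + \<epsilon> * (\<integral>w. K w \<partial>H)"
    by (rule contam_integral[OF assms(1-5) K_meas K])
  also have "(\<integral>w. K w \<partial>std_normal) = (\<integral>x. f x \<partial>noisy std_normal \<tau>)"
    unfolding K_def by (rule std_normal.integral_noisy_iterated[OF _ abs_f, symmetric]) simp
  also have "\<dots> = (\<integral>z. f (sqrt (1 + \<tau>\<^sup>2) * z) \<partial>std_normal)"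
    unfolding noisy_std_normal by (subst integral_distr) auto
  also have "(\<integral>w. K w \<partial>H) = (\<integral>x. f x \<partial>noisy H \<tau>)"
    unfolding K_def by (rule H.integral_noisy_iterated[OF _ abs_f, symmetric]) simp
  finally show ?thesis .
qed

text \<open>The mixed distribution function is nondecreasing and right-continuous with limits zero
  and one, so its Stieltjes measure is the required law.\<close>

lemma contam_mixture_exists:
  assumes "0 \<le> \<epsilon>" "\<epsilon> \<le> 1" "real_distribution H"
  obtains F where "F \<in> contam \<epsilon>" "real_distribution F"
    "\<And>x. cdf F x = (1 - \<epsilon>) * Phi x + \<epsilon> * cdf H x"
proof -
  interpret H: real_distribution H by fact
  define c where "c = (\<lambda>x. (1 - \<epsilon>) * Phi x + \<epsilon> * cdf H x)"
  have 1: "c x \<le> c y" if "x \<le> y" for x y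
    using assms that std_normal.cdf_nondecreasing[of x y] H.cdf_nondecreasing[of x y]
    by (auto simp: c_def Phi_def intro!: add_mono mult_left_mono)
  have 2: "continuous (at_right a) c" for a
    unfolding c_def Phi_def
    by (intro continuous_intros std_normal.cdf_is_right_cont H.cdf_is_right_cont)
  have "(c \<longlongrightarrow> (1 - \<epsilon>) * 0 + \<epsilon> * 0) at_bot"
    unfolding c_def Phi_def by (intro tendsto_intros std_normal.cdf_lim_at_bot H.cdf_lim_at_bot)
  then have 3: "(c \<longlongrightarrow> 0) at_bot" by simp
  have "(c \<longlongrightarrow> (1 - \<epsilon>) * 1 + \<epsilon> * 1) at_top"
    unfolding c_def Phi_def
    by (intro tendsto_intros std_normal.cdf_lim_at_top_prob H.cdf_lim_at_top_prob)
  then have 4: "(c \<longlongrightarrow> 1) at_top" by simp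
  have rd: "real_distribution (interval_measure c)"
    using 1 2 3 4 by (rule real_distribution_interval_measure)
  have cdf: "cdf (interval_measure c) = c"
    using 1 2 3 by (rule cdf_interval_measure)
  show ?thesis
    by (rule that[OF _ rd]) (use rd cdf assms in \<open>auto simp: contam_def c_def\<close>)
qed


section \<open>The state evolution with a general threshold\<close>

text \<open>The state evolution with an arbitrary threshold \<open>l\<close>: \<open>core_mass\<close> and \<open>moment\<close> are the
  expectations of \<open>\<Psi>'\<close> (up to the factor \<open>r / (1 + r)\<close>) and \<open>\<Psi>\<^sup>2\<close>.\<close>

definition core_mass :: "real measure \<Rightarrow> real \<Rightarrow> real \<Rightarrow> real" where
  "core_mass F \<tau> c = measure (noisy F \<tau>) {y. \<bar>y\<bar> \<le> c}"

definition moment :: "real measure \<Rightarrow> real \<Rightarrow> real \<Rightarrow> real \<Rightarrow> real" where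
  "moment F \<tau> l r = (\<integral>y. (Psi l y r)\<^sup>2 \<partial>noisy F \<tau>)"

text \<open>The equation behind \<open>se_R\<close>, since \<open>r / (1 + r)\<close> is the value
  of \<open>Psi'\<close> on the core. Strict monotonicity will make the least solution the only
  one.\<close>

definition root :: "real measure \<Rightarrow> real \<Rightarrow> real \<Rightarrow> real \<Rightarrow> real \<Rightarrow> bool" where
  "root F \<tau> m l r \<longleftrightarrow> 0 \<le> r \<and> 1 / m = r / (1 + r) * core_mass F \<tau> (l * (1 + r))"

lemma abs_psi_le: "\<bar>psi l x\<bar> \<le> \<bar>l\<bar>"
  by (auto simp: psi_def)

lemma abs_psi: "0 \<le> l \<Longrightarrow> \<bar>psi l x\<bar> = min l \<bar>x\<bar>"
  by (auto simp: psi_def)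

lemma Psi_measurable [measurable]: "(\<lambda>y. Psi l y r) \<in> borel_measurable borel"
  unfolding Psi_def by measurable

lemma abs_Psi_le: "\<bar>Psi l y r\<bar> \<le> \<bar>r * l\<bar>"
  using abs_psi_le[of l] by (auto simp: Psi_def abs_mult intro!: mult_left_mono)

lemma Psi_square_le: "(Psi l y r)\<^sup>2 \<le> (r * l)\<^sup>2"
  using abs_Psi_le by (simp add: abs_le_square_iff)

lemma abs_Psi: "0 \<le> l \<Longrightarrow> 0 \<le> r \<Longrightarrow> \<bar>Psi l y r\<bar> = min (r * l) (r / (1 + r) * \<bar>y\<bar>)"
  by (simp add: Psi_def abs_mult abs_psi min_mult_distrib_left)

lemma frac_mono: "0 \<le> r \<Longrightarrow> r \<le> r' \<Longrightarrow> r / (1 + r) \<le> r' / (1 + (r'::real))"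
  by (simp add: field_simps)

lemma frac_strict_mono: "0 \<le> r \<Longrightarrow> r < r' \<Longrightarrow> r / (1 + r) < r' / (1 + (r'::real))"
  by (simp add: field_simps)

lemma Psi_square_mono:
  assumes "0 \<le> l" "0 \<le> r" "l \<le> l'" "r \<le> r'" "\<bar>y\<bar> \<le> \<bar>y'\<bar>"
  shows "(Psi l y r)\<^sup>2 \<le> (Psi l' y' r')\<^sup>2"
proof -
  have "min (r * l) (r / (1 + r) * \<bar>y\<bar>) \<le> min (r' * l') (r' / (1 + r') * \<bar>y'\<bar>)"
    using assms by (intro min.mono mult_mono frac_mono) auto
  then have "\<bar>Psi l y r\<bar> \<le> \<bar>Psi l' y' r'\<bar>"
    using assms by (simp add: abs_Psi)
  then show ?thesis by (simp add: abs_le_square_iff)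
qed

text \<open>Measured in units of \<open>s\<close>, the clipping depends on the threshold only
  through the cap \<open>k * (1 + r)\<close>; this is the source of the substitution by
  \<open>u\<close>.\<close>

lemma Psi_scale:
  assumes "0 < s" "0 \<le> r"
  shows "Psi (k * s) (s * x) r = s * (r / (1 + r)) * psi (k * (1 + r)) x"
proof -
  have "psi (k * s) (s * x / (1 + r)) = s / (1 + r) * psi (k * (1 + r)) x"
  proof -
    have "s / (1 + r) * psi (k * (1 + r)) x
        = min (s / (1 + r) * (k * (1 + r))) (max (s / (1 + r) * - (k * (1 + r))) (s / (1 + r) * x))"
      using assms unfolding psi_def
      by (simp add: min_mult_distrib_left max_mult_distrib_left)
    then show ?thesis using assms by (simp add: psi_def mult.commute)
  qed
  then show ?thesis by (simp add: Psi_def)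
qed

context real_distribution begin

interpretation pair: pair_prob_space M std_normal ..

lemma core_mass_eq: "core_mass M \<tau> c
    = (\<integral>p. indicator {p. \<bar>fst p + \<tau> * snd p\<bar> \<le> c} p \<partial>(M \<Otimes>\<^sub>M std_normal))"
proof -
  interpret Y: real_distribution "noisy M \<tau>" by (rule real_distribution_noisy)
  have "core_mass M \<tau> c = (\<integral>y. indicator {y. \<bar>y\<bar> \<le> c} y \<partial>noisy M \<tau>)"
    by (simp add: core_mass_def)
  also have "\<dots> = (\<integral>p. indicator {y. \<bar>y\<bar> \<le> c} (fst p + \<tau> * snd p) \<partial>(M \<Otimes>\<^sub>M std_normal))"
    by (rule integral_noisy) simp
  finally show ?thesis by (simp add: indicator_def)
qed

lemma moment_eq: "moment M \<tau> l r = (\<integral>p. (Psi l (fst p + \<tau> * snd p) r)\<^sup>2 \<partial>(M \<Otimes>\<^sub>M std_normal))"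
  unfolding moment_def by (rule integral_noisy) simp

lemma core_mass_nonneg: "0 \<le> core_mass M \<tau> c"
  by (simp add: core_mass_def)

lemma core_mass_le_1: "core_mass M \<tau> c \<le> 1"
proof -
  interpret Y: real_distribution "noisy M \<tau>" by (rule real_distribution_noisy)
  show ?thesis by (simp add: core_mass_def)
qed

lemma core_mass_mono: "c \<le> d \<Longrightarrow> core_mass M \<tau> c \<le> core_mass M \<tau> d"
proof -
  interpret Y: real_distribution "noisy M \<tau>" by (rule real_distribution_noisy)
  show "c \<le> d \<Longrightarrow> core_mass M \<tau> c \<le> core_mass M \<tau> d"
    unfolding core_mass_def by (rule Y.finite_measure_mono) auto
qed

lemma moment_nonneg: "0 \<le> moment M \<tau> l r"
  by (simp add: moment_def)

lemma integrable_Psi_square: "integrable (noisy M \<tau>) (\<lambda>y. (Psi l y r)\<^sup>2)"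
proof -
  interpret Y: real_distribution "noisy M \<tau>" by (rule real_distribution_noisy)
  show ?thesis
    by (rule Y.integrable_const_bound[where B = "(r * l)\<^sup>2"]) (auto simp: Psi_square_le)
qed

lemma moment_mono:
  assumes "0 \<le> l" "0 \<le> r" "l \<le> l'" "r \<le> r'"
  shows "moment M \<tau> l r \<le> moment M \<tau> l' r'"
  unfolding moment_def by (intro integral_mono integrable_Psi_square Psi_square_mono assms) simp

text \<open>For each \<open>w\<close> at most two values of the noise hit the boundary of the core.
  Hence the indicator of the core is almost surely continuous in the parameters, although
  \<open>M\<close> may have atoms.\<close>

lemma AE_pair_abs_neq:
  assumes "\<tau> \<noteq> 0"
  shows "AE p in M \<Otimes>\<^sub>M std_normal. \<bar>fst p + \<tau> * snd p\<bar> \<noteq> c"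
proof (rule pair.AE_pair_measure)
  have "AE z in std_normal. \<bar>w + \<tau> * z\<bar> \<noteq> c" for w
    using AE_std_normal_neq[of "(c - w) / \<tau>"] AE_std_normal_neq[of "(- c - w) / \<tau>"]
    by eventually_elim (use assms in \<open>auto simp: field_simps abs_if split: if_splits\<close>)
  then show "AE w in M. AE z in std_normal. \<bar>fst (w, z) + \<tau> * snd (w, z)\<bar> \<noteq> c"
    by simp
qed measurable

lemma core_mass_tendsto:
  fixes t c :: "nat \<Rightarrow> real"
  assumes "t \<longlonglongrightarrow> \<tau>" "\<tau> \<noteq> 0" "c \<longlonglongrightarrow> d"
  shows "(\<lambda>n. core_mass M (t n) (c n)) \<longlonglongrightarrow> core_mass M \<tau> d"
  unfolding core_mass_eq
proof (rule integral_dominated_convergence[where w = "\<lambda>_. 1"])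
  show "AE p in M \<Otimes>\<^sub>M std_normal. (\<lambda>n. indicator {p. \<bar>fst p + t n * snd p\<bar> \<le> c n} p :: real)
      \<longlonglongrightarrow> indicator {p. \<bar>fst p + \<tau> * snd p\<bar> \<le> d} p"
    using AE_pair_abs_neq[OF assms(2), of d]
  proof eventually_elim
    fix p assume p: "\<bar>fst p + \<tau> * snd p\<bar> \<noteq> d"
    have lim: "(\<lambda>n. c n - \<bar>fst p + t n * snd p\<bar>) \<longlonglongrightarrow> d - \<bar>fst p + \<tau> * snd p\<bar>"
      by (intro tendsto_intros assms)
    show "(\<lambda>n. indicator {p. \<bar>fst p + t n * snd p\<bar> \<le> c n} p :: real)
        \<longlonglongrightarrow> indicator {p. \<bar>fst p + \<tau> * snd p\<bar> \<le> d} p"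
    proof (cases "\<bar>fst p + \<tau> * snd p\<bar> < d")
      case True
      then have "eventually (\<lambda>n. 0 < c n - \<bar>fst p + t n * snd p\<bar>) sequentially"
        using order_tendstoD(1)[OF lim, of 0] by simp
      then show ?thesis
        by (intro tendsto_eventually) (use True in \<open>auto elim!: eventually_mono\<close>)
    next
      case False
      then have "eventually (\<lambda>n. c n - \<bar>fst p + t n * snd p\<bar> < 0) sequentially"
        using order_tendstoD(2)[OF lim, of 0] p by simp
      then show ?thesis
        by (intro tendsto_eventually) (use False p in \<open>auto elim!: eventually_mono\<close>)
    qed
  qed
qed (auto simp: pair.emeasure_space_1)

text \<open>The squared score is continuous, so in contrast to the mass the limit
  \<open>\<tau>\<close> may be zero; boundedness of a convergent sequence supplies the dominating
  constant.\<close>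

lemma moment_tendsto:
  fixes t l r :: "nat \<Rightarrow> real"
  assumes "t \<longlonglongrightarrow> \<tau>" "l \<longlonglongrightarrow> l'" "r \<longlonglongrightarrow> r'" "0 \<le> r'"
  shows "(\<lambda>n. moment M (t n) (l n) (r n)) \<longlonglongrightarrow> moment M \<tau> l' r'"
proof -
  have "Bseq (\<lambda>n. (r n * l n)\<^sup>2)"
    using assms by (intro convergent_imp_Bseq convergentI) (auto intro: tendsto_intros)
  then obtain K where "\<And>n. norm ((r n * l n)\<^sup>2) \<le> K"
    by (auto simp: Bseq_def)
  then have K: "(r n * l n)\<^sup>2 \<le> K" for n by simp
  show ?thesis
    unfolding moment_eq
  proof (rule integral_dominated_convergence[where w = "\<lambda>_. K"])
    show "AE p in M \<Otimes>\<^sub>M std_normal. (\<lambda>n. (Psi (l n) (fst p + t n * snd p) (r n))\<^sup>2)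
        \<longlonglongrightarrow> (Psi l' (fst p + \<tau> * snd p) r')\<^sup>2"
      unfolding Psi_def psi_def using assms(4)
      by (intro AE_I2 tendsto_intros assms) auto
    show "AE p in M \<Otimes>\<^sub>M std_normal. norm ((Psi (l n) (fst p + t n * snd p) (r n))\<^sup>2) \<le> K" for n
      using order_trans[OF Psi_square_le K] by auto
  qed (auto)
qed

section \<open>Roots of the equation for \<open>r\<close>\<close>

lemma root_pos: "root M \<tau> m l r \<Longrightarrow> 1 < m \<Longrightarrow> 0 < r"
  by (cases "r = 0") (auto simp: root_def)

text \<open>The factor \<open>a / (1 + a)\<close> increases strictly and the mass is nondecreasing
  in \<open>a\<close>. Where the mass vanishes, strictness comes from \<open>0 < 1 / m\<close>
  instead.\<close>

lemma root_less:
  assumes "root M \<tau> m l r" "1 < m" "0 < l" "0 \<le> a" "a < r"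
  shows "a / (1 + a) * core_mass M \<tau> (l * (1 + a)) < 1 / m"
proof (cases "core_mass M \<tau> (l * (1 + a)) = 0")
  case False
  then have "0 < core_mass M \<tau> (l * (1 + a))" using core_mass_nonneg[of \<tau>] by (simp add: less_le)
  then have "a / (1 + a) * core_mass M \<tau> (l * (1 + a)) < r / (1 + r) * core_mass M \<tau> (l * (1 + a))"
    by (intro mult_strict_right_mono frac_strict_mono assms)
  also have "\<dots> \<le> r / (1 + r) * core_mass M \<tau> (l * (1 + r))"
    using assms by (intro mult_left_mono core_mass_mono) auto
  finally show ?thesis using assms(1) by (simp add: root_def)
qed (use assms in simp)

lemma root_greater:
  assumes "root M \<tau> m l r" "1 < m" "0 < l" "r < a"
  shows "1 / m < a / (1 + a) * core_mass M \<tau> (l * (1 + a))"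
proof -
  have r: "0 < r" "1 / m = r / (1 + r) * core_mass M \<tau> (l * (1 + r))"
    using root_pos[OF assms(1,2)] assms(1) by (auto simp: root_def)
  then have "0 < r / (1 + r) * core_mass M \<tau> (l * (1 + r))" unfolding r(2)[symmetric] using assms(2) by simp
  then have "0 < core_mass M \<tau> (l * (1 + r))"
    using r(1) by (simp add: zero_less_mult_iff zero_less_divide_iff)
  then have "r / (1 + r) * core_mass M \<tau> (l * (1 + r)) < a / (1 + a) * core_mass M \<tau> (l * (1 + r))"
    using r assms(4) by (intro mult_strict_right_mono frac_strict_mono) auto
  also have "\<dots> \<le> a / (1 + a) * core_mass M \<tau> (l * (1 + a))"
    using assms r by (intro mult_left_mono core_mass_mono) auto
  finally show ?thesis using r by simp
qed

lemma root_unique: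
  assumes "root M \<tau> m l r" "root M \<tau> m l r'" "1 < m" "0 < l"
  shows "r = r'"
proof (rule ccontr)
  assume "r \<noteq> r'"
  then consider "r < r'" | "r' < r" by linarith
  then show False
    using root_less[OF assms(1,3,4), of r'] root_less[OF assms(2,3,4), of r] assms(1,2)
    by cases (auto simp: root_def)
qed

lemma root_le:
  assumes "root M \<tau> m l r" "1 < m" "0 < l" "0 \<le> a"
    "1 / m \<le> a / (1 + a) * core_mass M \<tau> (l * (1 + a))"
  shows "r \<le> a"
  using root_less[OF assms(1-4)] assms(5) by (meson not_le)

text \<open>Mass at most one forces \<open>1 / m \<le> r / (1 + r)\<close>, uniformly in the law,
  the noise level and the threshold.\<close>

lemma root_ge:
  assumes "root M \<tau> m l r" "1 < m"
  shows "1 / (m - 1) \<le> r"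
proof -
  have "0 < r" using root_pos[OF assms] .
  have "1 / m \<le> r / (1 + r) * 1"
    using assms(1) core_mass_le_1 unfolding root_def by (metis divide_nonneg_nonneg add_nonneg_nonneg
        zero_le_one mult_left_mono)
  then show ?thesis using assms(2) \<open>0 < r\<close> by (simp add: field_simps)
qed

lemma core_mass_tendsto_1:
  assumes "filterlim c at_top sequentially"
  shows "(\<lambda>n. core_mass M \<tau> (c n)) \<longlonglongrightarrow> 1"
proof -
  have "(\<lambda>n. core_mass M \<tau> (c n)) \<longlonglongrightarrow> (\<integral>p. 1 \<partial>(M \<Otimes>\<^sub>M std_normal))"
    unfolding core_mass_eq
  proof (rule integral_dominated_convergence[where w = "\<lambda>_. 1"])
    show "AE p in M \<Otimes>\<^sub>M std_normal.
        (\<lambda>n. indicator {p. \<bar>fst p + \<tau> * snd p\<bar> \<le> c n} p :: real) \<longlonglongrightarrow> 1"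
    proof (rule AE_I2, rule tendsto_eventually)
      fix p
      show "eventually (\<lambda>n. indicator {p. \<bar>fst p + \<tau> * snd p\<bar> \<le> c n} p = (1::real)) sequentially"
        using filterlim_at_top[THEN iffD1, OF assms, rule_format, of "\<bar>fst p + \<tau> * snd p\<bar>"]
        by eventually_elim simp
    qed
  qed auto
  then show ?thesis by (simp add: pair.prob_space)
qed

text \<open>The right side of the equation vanishes at \<open>r = 0\<close> and tends to one, above
  \<open>1 / m\<close>; the noise makes it continuous.\<close>

lemma root_exists:
  assumes "\<tau> \<noteq> 0" "1 < m" "0 < l"
  shows "\<exists>r. root M \<tau> m l r"
proof -
  define G where "G = (\<lambda>r. r / (1 + r) * core_mass M \<tau> (l * (1 + r)))"
  have "(\<lambda>n. G (real n)) \<longlonglongrightarrow> 1 * 1"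
    unfolding G_def
  proof (intro tendsto_mult core_mass_tendsto_1)
    have "(\<lambda>n. 1 - inverse (real (Suc n))) \<longlonglongrightarrow> 1 - 0"
      by (intro tendsto_intros LIMSEQ_inverse_real_of_nat)
    then show "(\<lambda>n. real n / (1 + real n)) \<longlonglongrightarrow> 1"
      by (simp add: field_simps)
    show "filterlim (\<lambda>n. l * (1 + real n)) at_top sequentially"
      using assms by (intro filterlim_tendsto_pos_mult_at_top[OF tendsto_const]
          filterlim_tendsto_add_at_top[OF tendsto_const] filterlim_real_sequentially)
  qed
  then have "eventually (\<lambda>n. 1 / m < G (real n)) sequentially"
    using assms by (intro order_tendstoD(1)) auto
  then obtain n where n: "1 / m < G (real n)"
    using eventually_happens trivial_limit_sequentially by blast
  have "continuous_on {0..real n} G"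
    unfolding continuous_on_sequentially G_def comp_def
    by (auto intro!: tendsto_intros core_mass_tendsto assms)
  then have "\<exists>r\<ge>0. r \<le> real n \<and> G r = 1 / m"
    using n assms(2) by (intro IVT') (auto simp: G_def)
  then show ?thesis by (auto simp: root_def G_def)
qed

text \<open>At a fixed nonnegative \<open>a\<close> beside \<open>r'\<close> the limiting equation
  fails by a strict inequality, which persists for nearby parameters. Monotonicity then keeps
  \<open>r n\<close> on the same side of \<open>a\<close> as \<open>r'\<close>.\<close>

lemma root_tendsto:
  fixes t l r :: "nat \<Rightarrow> real"
  assumes r: "root M \<tau> m l' r'" "\<And>n. root M (t n) m (l n) (r n)"
    and lim: "t \<longlonglongrightarrow> \<tau>" "\<tau> \<noteq> 0" "l \<longlonglongrightarrow> l'"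
    and pos: "\<And>n. 0 < l n" "0 < l'" "1 < m"
  shows "r \<longlonglongrightarrow> r'"
proof (rule order_tendstoI)
  have G: "(\<lambda>n. a / (1 + a) * core_mass M (t n) (l n * (1 + a)))
      \<longlonglongrightarrow> a / (1 + a) * core_mass M \<tau> (l' * (1 + a))" for a
    by (intro tendsto_intros core_mass_tendsto lim)
  fix a
  show "eventually (\<lambda>n. a < r n) sequentially" if "a < r'"
  proof (cases "0 \<le> a")
    case True
    have "eventually (\<lambda>n. a / (1 + a) * core_mass M (t n) (l n * (1 + a)) < 1 / m) sequentially"
      using root_less[OF r(1) pos(3,2) True that] by (rule order_tendstoD(2)[OF G])
    then show ?thesis
    proof eventually_elim
      case (elim n)
      show ?case
      proof (rule ccontr)
        assume "\<not> a < r n"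
        then consider "r n < a" | "r n = a" by linarith
        then show False
          using root_greater[OF r(2) pos(3) pos(1), of n a] r(2)[of n] elim
          by cases (auto simp: root_def)
      qed
    qed
  next
    case False
    have "0 \<le> r n" for n using r(2)[of n] by (simp add: root_def)
    with False show ?thesis by (intro always_eventually allI) (meson not_le order_trans)
  qed
  show "eventually (\<lambda>n. r n < a) sequentially" if "r' < a"
  proof -
    have "0 \<le> a" using r(1) that by (auto simp: root_def)
    have "eventually (\<lambda>n. 1 / m < a / (1 + a) * core_mass M (t n) (l n * (1 + a))) sequentially"
      using root_greater[OF r(1) pos(3,2) that] by (rule order_tendstoD(1)[OF G])
    then show ?thesis
    proof eventually_elim
      case (elim n)
      show ?case
      proof (rule ccontr)
        assume "\<not> r n < a"
        then consider "a < r n" | "r n = a" by linarith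
        then show False
          using root_less[OF r(2) pos(3) pos(1) \<open>0 \<le> a\<close>, of n] r(2)[of n] elim
          by cases (auto simp: root_def)
      qed
    qed
  qed
qed

end


section \<open>Uniqueness for a fixed threshold\<close>

text \<open>The threshold is left free: a constant \<open>l\<close> describes the estimator with
  that threshold, \<open>l = \<kappa> * sqrt (1 + \<tau>\<^sup>2)\<close> the floating one.\<close>

definition se_solution :: "real measure \<Rightarrow> real \<Rightarrow> real \<Rightarrow> real \<Rightarrow> real \<Rightarrow> bool" where
  "se_solution F m \<tau> l r \<longleftrightarrow> 0 < \<tau> \<and> root F \<tau> m l r \<and> \<tau>\<^sup>2 = m * moment F \<tau> l r"

lemma measure_std_normal_open_pos:
  assumes "open S" "x \<in> S"
  shows "0 < measure std_normal S"
proof -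
  obtain e where e: "0 < e" "cball x e \<subseteq> S"
    using assms open_contains_cball by blast
  have "0 < Phi (x + e) - Phi (x - e)"
    using Phi_strict_mono[of "x - e" "x + e"] e by simp
  also have "\<dots> = measure std_normal {x - e..x + e}"
    using e by (simp add: Phi_diff measure_std_normal_Icc)
  also have "\<dots> \<le> measure std_normal S"
    using e assms by (intro std_normal.finite_measure_mono) (auto simp: cball_eq_atLeastAtMost)
  finally show ?thesis .
qed

text \<open>The clipped affine function is a clamp of \<open>z\<close>, scaled and shifted by a
  constant; multiplied by \<open>z\<close>, the shift integrates to zero.\<close>

lemma stein_psi:
  assumes "0 < \<tau>" "0 \<le> l" "0 \<le> r"
  shows "(\<integral>z. z * psi l ((w + \<tau> * z) / (1 + r)) \<partial>std_normal)
    = \<tau> / (1 + r) * measure std_normal {z. \<bar>w + \<tau> * z\<bar> \<le> l * (1 + r)}"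
proof -
  define a b where "a = (- l * (1 + r) - w) / \<tau>" and "b = (l * (1 + r) - w) / \<tau>"
  have ab: "a \<le> b"
    using assms by (auto simp: a_def b_def intro!: divide_right_mono)
  have eq: "z * psi l ((w + \<tau> * z) / (1 + r))
      = \<tau> / (1 + r) * (z * min b (max a z)) + w / (1 + r) * z" for z
  proof -
    have "\<tau> / (1 + r) * min b (max a z) + w / (1 + r)
        = min (\<tau> / (1 + r) * b + w / (1 + r))
           (max (\<tau> / (1 + r) * a + w / (1 + r)) (\<tau> / (1 + r) * z + w / (1 + r)))"
      using assms by (simp add: min_mult_distrib_left max_mult_distrib_left min_add_distrib_left max_add_distrib_left)
    also have "\<tau> / (1 + r) * b + w / (1 + r) = l"
      using assms by (simp add: b_def add_divide_distrib[symmetric])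
    also have "\<tau> / (1 + r) * a + w / (1 + r) = - l"
      using assms by (simp add: a_def add_divide_distrib[symmetric])
    finally have psi: "psi l ((w + \<tau> * z) / (1 + r)) = \<tau> / (1 + r) * min b (max a z) + w / (1 + r)"
      by (simp add: psi_def add_divide_distrib add.commute)
    show ?thesis
      unfolding psi by (simp add: algebra_simps)
  qed
  have "(\<integral>z. z * psi l ((w + \<tau> * z) / (1 + r)) \<partial>std_normal)
      = \<tau> / (1 + r) * (\<integral>z. z * min b (max a z) \<partial>std_normal) + w / (1 + r) * (\<integral>z. z \<partial>std_normal)"
  proof -
    have "integrable std_normal (\<lambda>z. z * min b (max a z))"
      by (rule integrable_std_normal_mult_bounded[where C = "\<bar>a\<bar> + \<bar>b\<bar>"]) (auto simp: ab)
    then show ?thesis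
      unfolding eq by (simp add: integrable_std_normal_ident)
  qed
  also have "\<dots> = \<tau> / (1 + r) * measure std_normal {a..b}"
    by (simp add: stein_clamp[OF ab] integral_std_normal_ident)
  also have "{a..b} = {z. \<bar>w + \<tau> * z\<bar> \<le> l * (1 + r)}"
    using assms by (auto simp: a_def b_def field_simps abs_le_iff)
  finally show ?thesis .
qed

context real_distribution begin

interpretation pair: pair_prob_space M std_normal ..

lemma integrable_snd_mult:
  fixes f :: "real \<times> real \<Rightarrow> real"
  assumes [measurable]: "f \<in> borel_measurable (M \<Otimes>\<^sub>M std_normal)" and "\<And>p. \<bar>f p\<bar> \<le> C"
  shows "integrable (M \<Otimes>\<^sub>M std_normal) (\<lambda>p. snd p * f p)"
proof (rule Bochner_Integration.integrable_bound[of _ "\<lambda>p. C * snd p"])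
  have "integrable (M \<Otimes>\<^sub>M std_normal) (\<lambda>p. snd p)"
  proof (rule pair.Fubini_integrable)
    show "AE x in M. integrable std_normal (\<lambda>y. snd (x, y))"
      by (simp add: integrable_std_normal_ident)
  qed auto
  then show "integrable (M \<Otimes>\<^sub>M std_normal) (\<lambda>p. C * snd p)" by simp
  show "AE p in M \<Otimes>\<^sub>M std_normal. norm (snd p * f p) \<le> norm (C * snd p)"
  proof (rule AE_I2)
    fix p
    have "\<bar>f p\<bar> \<le> \<bar>C\<bar>" using assms(2)[of p] by linarith
    then show "norm (snd p * f p) \<le> norm (C * snd p)"
      using mult_left_mono[OF _ abs_ge_zero[of "snd p"], of "\<bar>f p\<bar>" "\<bar>C\<bar>"]
      by (simp add: abs_mult mult.commute[of "\<bar>C\<bar>"])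
  qed
qed measurable

text \<open>Conditionally on \<open>w\<close> this is Stein's identity. At a root the right side
  becomes \<open>\<tau> / (r * m)\<close>, which is how the equation for \<open>r\<close> enters the
  uniqueness argument.\<close>

lemma stein_pair:
  assumes "0 < \<tau>" "0 \<le> l" "0 \<le> r"
  shows "(\<integral>p. snd p * psi l ((fst p + \<tau> * snd p) / (1 + r)) \<partial>(M \<Otimes>\<^sub>M std_normal))
    = \<tau> / (1 + r) * core_mass M \<tau> (l * (1 + r))"
proof -
  have "integrable (M \<Otimes>\<^sub>M std_normal) (\<lambda>p. snd p * psi l ((fst p + \<tau> * snd p) / (1 + r)))"
    by (rule integrable_snd_mult[where C = "\<bar>l\<bar>"]) (auto simp: abs_psi_le)
  then have "(\<integral>p. snd p * psi l ((fst p + \<tau> * snd p) / (1 + r)) \<partial>(M \<Otimes>\<^sub>M std_normal))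
      = (\<integral>w. (\<integral>z. z * psi l ((w + \<tau> * z) / (1 + r)) \<partial>std_normal) \<partial>M)"
    using pair.integral_fst[of "\<lambda>w z. z * psi l ((w + \<tau> * z) / (1 + r))"]
    by (simp add: case_prod_unfold)
  also have "\<dots> = (\<integral>w. \<tau> / (1 + r) * (\<integral>z. indicator {y. \<bar>y\<bar> \<le> l * (1 + r)} (w + \<tau> * z) \<partial>std_normal) \<partial>M)"
  proof -
    have "measure std_normal {z. \<bar>w + \<tau> * z\<bar> \<le> c}
        = (\<integral>z. indicator {y. \<bar>y\<bar> \<le> c} (w + \<tau> * z) \<partial>std_normal)" for w c :: real
    proof -
      have "indicator {y. \<bar>y\<bar> \<le> c} (w + \<tau> * z) = (indicator {z. \<bar>w + \<tau> * z\<bar> \<le> c} z :: real)" for z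
        by (simp add: indicator_def)
      then show ?thesis by simp
    qed
    then show ?thesis
      unfolding stein_psi[OF assms] by simp
  qed
  also have "\<dots> = \<tau> / (1 + r) * (\<integral>y. indicator {y. \<bar>y\<bar> \<le> l * (1 + r)} y \<partial>noisy M \<tau>)"
    by (subst integral_noisy_iterated[where C = 1]) auto
  also have "\<dots> = \<tau> / (1 + r) * core_mass M \<tau> (l * (1 + r))"
  proof -
    interpret Y: real_distribution "noisy M \<tau>" by (rule real_distribution_noisy)
    show ?thesis by (simp add: core_mass_def)
  qed
  finally show ?thesis .
qed

text \<open>Monotonicity of the score gives \<open>(s\<^sub>1 - s\<^sub>2) (p\<^sub>1 - p\<^sub>2) \<ge> 0\<close> for the residuals
  \<open>p\<^sub>i = x\<^sub>i - r\<^sub>i s\<^sub>i\<close>. Taking expectations, by Stein's identity and the two equations for a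
  solution, this reads \<open>m E (s\<^sub>1 s\<^sub>2) \<ge> \<beta>\<^sub>1 \<beta>\<^sub>2\<close> with \<open>\<beta>\<^sub>i = \<tau>\<^sub>i / r\<^sub>i\<close>, the equality case of
  Cauchy-Schwarz.\<close>

lemma se_solution_proportional:
  assumes "se_solution M m \<tau>1 l r1" "se_solution M m \<tau>2 l r2" "1 < m" "0 < l"
  shows "AE p in M \<Otimes>\<^sub>M std_normal.
    r1 / \<tau>1 * psi l ((fst p + \<tau>1 * snd p) / (1 + r1)) - r2 / \<tau>2 * psi l ((fst p + \<tau>2 * snd p) / (1 + r2)) = 0"
proof -
  let ?P = "M \<Otimes>\<^sub>M std_normal"
  define s where "s = (\<lambda>\<tau> r p. psi l ((fst p + \<tau> * snd p) / (1 + r)))"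
  have [measurable]: "s \<tau> r \<in> borel_measurable ?P" for \<tau> r
    unfolding s_def by measurable
  have s_le: "\<bar>s \<tau> r p\<bar> \<le> l" for \<tau> r p
    using assms(4) abs_psi_le[of l] by (simp add: s_def)
  have int_zs: "integrable ?P (\<lambda>p. snd p * s \<tau> r p)" for \<tau> r
    by (rule integrable_snd_mult) (auto intro: s_le)
  have int_ss: "integrable ?P (\<lambda>p. s \<tau> r p * s \<tau>' r' p)" for \<tau> r \<tau>' r'
    using mult_mono[OF s_le s_le] assms(4)
    by (intro integrable_pair_bounded[where C = "l * l"]) (auto simp: abs_mult)
  have sol: "0 < \<tau>" "0 < r" "(\<integral>p. snd p * s \<tau> r p \<partial>?P) = \<tau> / r / m"
      "(\<integral>p. s \<tau> r p * s \<tau> r p \<partial>?P) = (\<tau> / r)\<^sup>2 / m"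
    if "se_solution M m \<tau> l r" for \<tau> r
  proof -
    have \<tau>: "0 < \<tau>" and root: "root M \<tau> m l r" and fp: "\<tau>\<^sup>2 = m * moment M \<tau> l r"
      using that by (auto simp: se_solution_def)
    show "0 < \<tau>" by fact
    show r: "0 < r" using root_pos[OF root assms(3)] .
    have "(\<integral>p. snd p * s \<tau> r p \<partial>?P) = \<tau> / r * (r / (1 + r) * core_mass M \<tau> (l * (1 + r)))"
      unfolding s_def using stein_pair[of \<tau> l r] \<tau> r assms(4) by simp
    also have "r / (1 + r) * core_mass M \<tau> (l * (1 + r)) = 1 / m"
      using root by (simp only: root_def)
    finally show "(\<integral>p. snd p * s \<tau> r p \<partial>?P) = \<tau> / r / m" by simp
    have "moment M \<tau> l r = r\<^sup>2 * (\<integral>p. s \<tau> r p * s \<tau> r p \<partial>?P)"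
      by (simp add: moment_eq Psi_def s_def power2_eq_square mult_ac flip: integral_mult_right_zero)
    with fp r assms(3) show "(\<integral>p. s \<tau> r p * s \<tau> r p \<partial>?P) = (\<tau> / r)\<^sup>2 / m"
      by (simp add: field_simps)
  qed
  define b1 b2 where "b1 = \<tau>1 / r1" and "b2 = \<tau>2 / r2"
  have pos: "0 < \<tau>1" "0 < \<tau>2" "0 < r1" "0 < r2" "0 < b1" "0 < b2"
    using sol(1,2)[OF assms(1)] sol(1,2)[OF assms(2)] by (auto simp: b1_def b2_def)
  have \<tau>_eq: "\<tau>1 = r1 * b1" "\<tau>2 = r2 * b2"
    using pos by (auto simp: b1_def b2_def)
  define s1 s2 where "s1 = s \<tau>1 r1" and "s2 = s \<tau>2 r2"
  note [measurable] = \<open>s \<tau>1 r1 \<in> _\<close>[folded s1_def] \<open>s \<tau>2 r2 \<in> _\<close>[folded s2_def]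
  have E1: "(\<integral>p. s1 p * s1 p \<partial>?P) = b1\<^sup>2 / m" "(\<integral>p. snd p * s1 p \<partial>?P) = b1 / m"
    and E2: "(\<integral>p. s2 p * s2 p \<partial>?P) = b2\<^sup>2 / m" "(\<integral>p. snd p * s2 p \<partial>?P) = b2 / m"
    using sol[OF assms(1)] sol[OF assms(2)] by (simp_all add: s1_def s2_def b1_def b2_def)
  note int = int_zs[of \<tau>1 r1, folded s1_def] int_zs[of \<tau>2 r2, folded s2_def]
    int_ss[of \<tau>1 r1 \<tau>1 r1, folded s1_def] int_ss[of \<tau>2 r2 \<tau>2 r2, folded s2_def]
    int_ss[of \<tau>1 r1 \<tau>2 r2, folded s1_def s2_def]
  define C where "C = (\<integral>p. s1 p * s2 p \<partial>?P)"
  define D where "D = (\<lambda>p. (\<tau>1 - \<tau>2) * (snd p * s1 p) - (\<tau>1 - \<tau>2) * (snd p * s2 p)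
      - r1 * (s1 p * s1 p) - r2 * (s2 p * s2 p) + (r1 + r2) * (s1 p * s2 p))"
  have "0 \<le> D p" for p
  proof -
    \<comment> \<open>The residual is the proximal point of \<open>x\<close> for \<open>r\<close>
      times Huber's loss, so its score is the score already computed from
      \<open>x / (1 + r)\<close>.\<close>
    have psi_res: "psi l (x - r * psi l (x / (1 + r))) = psi l (x / (1 + r))" if "0 < r" for x r
      using that assms(4) by (auto simp: psi_def min_def max_def field_simps)
    have psi_mono: "0 \<le> (psi l x - psi l y) * (x - y)" for x y
    proof -
      have psi_le: "psi l a \<le> psi l b" if "a \<le> b" for a b
        using that by (auto simp: psi_def)
      show ?thesis
        using psi_le[of x y] psi_le[of y x]
        by (cases "x \<le> y") (auto intro: mult_nonneg_nonneg mult_nonpos_nonpos)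
    qed
    define x1 x2 where "x1 = fst p + \<tau>1 * snd p" and "x2 = fst p + \<tau>2 * snd p"
    have "D p = (s1 p - s2 p) * ((x1 - r1 * s1 p) - (x2 - r2 * s2 p))"
      by (simp add: D_def x1_def x2_def algebra_simps)
    also have "s1 p = psi l (x1 / (1 + r1))"
      by (simp add: s1_def s_def x1_def)
    also have "s2 p = psi l (x2 / (1 + r2))"
      by (simp add: s2_def s_def x2_def)
    finally show ?thesis
      using psi_mono[of "x1 - r1 * psi l (x1 / (1 + r1))" "x2 - r2 * psi l (x2 / (1 + r2))"]
      unfolding psi_res[OF pos(3)] psi_res[OF pos(4)] by simp
  qed
  then have "0 \<le> (\<integral>p. D p \<partial>?P)" by simp
  also have "(\<integral>p. D p \<partial>?P) = (\<tau>1 - \<tau>2) * (b1 / m) - (\<tau>1 - \<tau>2) * (b2 / m)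
      - r1 * (b1\<^sup>2 / m) - r2 * (b2\<^sup>2 / m) + (r1 + r2) * C"
    unfolding D_def by (simp add: int E1 E2 C_def)
  \<comment> \<open>With \<open>\<tau>1 = r1 * b1\<close> and \<open>\<tau>2 = r2 * b2\<close> the
    squares \<open>r1 * b1\<^sup>2\<close> and \<open>r2 * b2\<^sup>2\<close> cancel and only cross
    terms remain.\<close>
  also have "\<dots> = (r1 + r2) * (C - b1 * b2 / m)"
    unfolding \<tau>_eq by (simp add: divide_inverse algebra_simps power2_eq_square)
  finally have "b1 * b2 / m \<le> C"
    using pos by (simp add: zero_le_mult_iff)
  then have C: "1 / m \<le> C / (b1 * b2)"
    using pos by (simp add: field_simps)
  define g where "g = (\<lambda>p. s1 p / b1 - s2 p / b2)"
  have g_sq: "(g p)\<^sup>2 = (s1 p * s1 p) / b1\<^sup>2 + (s2 p * s2 p) / b2\<^sup>2 - 2 * ((s1 p * s2 p) / (b1 * b2))" for p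
    using pos by (simp add: g_def power2_eq_square field_simps)
  have int_g: "integrable ?P (\<lambda>p. (g p)\<^sup>2)"
    unfolding g_sq using int by simp
  have "(\<integral>p. (g p)\<^sup>2 \<partial>?P) = b1\<^sup>2 / m / b1\<^sup>2 + b2\<^sup>2 / m / b2\<^sup>2 - 2 * (C / (b1 * b2))"
    unfolding g_sq by (simp add: int E1 E2 C_def)
  also have "\<dots> \<le> 0"
    using C pos by simp
  finally have "(\<integral>p. (g p)\<^sup>2 \<partial>?P) = 0"
    by (intro antisym) auto
  then have "AE p in ?P. (g p)\<^sup>2 = 0"
    using integral_nonneg_eq_0_iff_AE[OF int_g] by simp
  then show ?thesis
    by eventually_elim (simp add: g_def s1_def s2_def s_def b1_def b2_def mult.commute)
qed

end

locale contaminated = F: real_distribution F + H: real_distribution H for F H :: "real measure" +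
  fixes \<epsilon> :: real
  assumes eps: "0 < \<epsilon>" "\<epsilon> < 1"
    and cdf_mixture: "\<And>x. cdf F x = (1 - \<epsilon>) * Phi x + \<epsilon> * cdf H x"
begin

interpretation pair: pair_prob_space F std_normal ..

text \<open>The Gaussian share \<open>1 - \<epsilon> > 0\<close> of \<open>F\<close> and the noise
  charge every nonempty open rectangle, so null sets have empty interior.\<close>

lemma continuous_AE_0_imp_0:
  fixes f :: "real \<times> real \<Rightarrow> real"
  assumes "continuous_on UNIV f" "AE p in F \<Otimes>\<^sub>M std_normal. f p = 0"
  shows "f p = 0"
proof (rule ccontr)
  assume "f p \<noteq> 0"
  have "open {p. f p \<noteq> 0}"
    by (rule open_Collect_neq[OF assms(1) continuous_on_const])
  then obtain A B where AB: "open A" "open B" "p \<in> A \<times> B" "A \<times> B \<subseteq> {p. f p \<noteq> 0}"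
    using \<open>f p \<noteq> 0\<close> by (elim open_prod_elim[of _ p]) auto
  have [measurable]: "A \<in> sets borel" "B \<in> sets borel" using AB by auto
  have "0 < (1 - \<epsilon>) * measure std_normal A"
    using measure_std_normal_open_pos[OF AB(1), of "fst p"] AB(3) eps by auto
  also have "\<dots> \<le> measure F A"
    using contam_measure[OF F.real_distribution_axioms H.real_distribution_axioms cdf_mixture] eps by simp
  finally have "0 < measure F A * measure std_normal B"
    using measure_std_normal_open_pos[OF AB(2), of "snd p"] AB(3) by auto
  then have "emeasure (F \<Otimes>\<^sub>M std_normal) (A \<times> B) \<noteq> 0"
    by (subst std_normal.emeasure_pair_measure_Times)
      (auto simp: F.emeasure_eq_measure std_normal.emeasure_eq_measure)
  moreover have "AE p in F \<Otimes>\<^sub>M std_normal. p \<notin> A \<times> B"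
    using assms(2) by eventually_elim (use AB(4) in auto)
  then have "emeasure (F \<Otimes>\<^sub>M std_normal) (A \<times> B) = 0"
    by (intro null_setsD1 AE_iff_null_sets[THEN iffD2]) auto
  ultimately show False by contradiction
qed

text \<open>By continuity the proportionality of the scores holds at every point, in particular at
  zero noise, where \<open>\<tau>1\<close> and \<open>\<tau>2\<close> leave the arguments. A large
  \<open>w\<close> saturates both scores and yields \<open>c1 = c2\<close>; at \<open>w = l\<close>
  neither is saturated, which yields \<open>r1 = r2\<close>.\<close>

lemma se_solution_unique:
  assumes "se_solution F m \<tau>1 l r1" "se_solution F m \<tau>2 l r2" "1 < m" "0 < l"
  shows "\<tau>1 = \<tau>2"
proof -
  define c1 c2 where "c1 = r1 / \<tau>1" and "c2 = r2 / \<tau>2"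
  have pos: "0 < \<tau>1" "0 < \<tau>2" "0 < r1" "0 < r2"
    using assms F.root_pos[of \<tau>1 m l r1] F.root_pos[of \<tau>2 m l r2]
    by (simp_all add: se_solution_def)
  have eq: "c1 * psi l ((fst p + \<tau>1 * snd p) / (1 + r1))
      - c2 * psi l ((fst p + \<tau>2 * snd p) / (1 + r2)) = 0" for p
    unfolding c1_def c2_def
    by (rule continuous_AE_0_imp_0[OF _ F.se_solution_proportional[OF assms]])
      (use pos in \<open>auto intro!: continuous_intros\<close>)
  have "c1 * l = c2 * l"
  proof -
    define w where "w = l * (1 + r1) + l * (1 + r2)"
    have "l \<le> w / (1 + r1)" "l \<le> w / (1 + r2)"
      using pos assms(4) by (auto simp: w_def field_simps)
    then have "psi l (w / (1 + r1)) = l" "psi l (w / (1 + r2)) = l"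
      using assms(4) by (auto simp: psi_def)
    then show ?thesis using eq[of "(w, 0)"] by simp
  qed
  then have c: "c1 = c2" using assms(4) by simp
  have "l / (1 + r1) = l / (1 + r2)"
  proof -
    have "l / (1 + r1) \<le> l" "l / (1 + r2) \<le> l" "0 \<le> l / (1 + r1)" "0 \<le> l / (1 + r2)"
      using pos assms(4) by (auto simp: field_simps)
    then have "psi l (l / (1 + r1)) = l / (1 + r1)" "psi l (l / (1 + r2)) = l / (1 + r2)"
      using assms(4) by (auto simp: psi_def)
    then have "c2 * (l / (1 + r1)) = c2 * (l / (1 + r2))"
      using eq[of "(l, 0)"] c by simp
    moreover have "c2 \<noteq> 0" using pos by (simp add: c2_def)
    ultimately show ?thesis by simp
  qed
  then have "r1 = r2" using pos assms(4) by (simp add: frac_eq_eq)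
  then show ?thesis using c pos by (simp add: c1_def c2_def frac_eq_eq)
qed

end


section \<open>Existence of fixed points\<close>

lemma continuous_on_integral_psi_square:
  "continuous_on {0..} (\<lambda>u. \<integral>z. (psi u z)\<^sup>2 \<partial>std_normal)"
proof (rule continuous_on_eq)
  show "continuous_on {0..} (\<lambda>u. (2 * Phi u - 1) - 2 * u * std_normal_density u + u\<^sup>2 * (2 - 2 * Phi u))"
    by (intro continuous_intros continuous_on_Phi continuous_on_std_normal_density)
qed (simp add: integral_psi_square)

lemma psi_square_le: "(psi u z)\<^sup>2 \<le> u\<^sup>2"
  using abs_psi_le by (simp add: abs_le_square_iff)

lemma integrable_psi_square: "integrable std_normal (\<lambda>z. (psi u z)\<^sup>2)"
  by (rule integrable_std_normal_bounded[where C = "u\<^sup>2"]) (auto simp: psi_square_le)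

text \<open>By Stein's identity, \<open>E \<psi>\<^sub>a(Z)\<^sup>2 < E Z \<psi>\<^sub>a(Z) = P(\<bar>Z\<bar> \<le> a)\<close>.\<close>

lemma integral_psi_square_less:
  assumes "0 < a"
  shows "(\<integral>z. (psi a z)\<^sup>2 \<partial>std_normal) < 2 * Phi a - 1"
proof -
  have psi_eq: "psi a = (\<lambda>z. min a (max (- a) z))" by (simp add: psi_def[abs_def])
  have int: "integrable std_normal (\<lambda>z. z * psi a z)"
    by (rule integrable_std_normal_mult_bounded[where C = a]) (use assms in \<open>auto intro: psi_bound\<close>)
  have int': "integrable std_normal (\<lambda>z. z * psi a z - (psi a z)\<^sup>2)"
    using int integrable_psi_square by simp
  \<comment> \<open>The difference vanishes exactly on \<open>{- a..a}\<close>, so equality of the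
    integrals would confine the normal law to that interval.\<close>
  have diff: "z * psi a z - (psi a z)\<^sup>2 = a * max 0 (\<bar>z\<bar> - a)" for z
  proof -
    consider "z < - a" | "\<bar>z\<bar> \<le> a" | "a < z" by linarith
    then show ?thesis
      using assms by cases (auto simp: psi_def power2_eq_square algebra_simps)
  qed
  have nn: "0 \<le> z * psi a z - (psi a z)\<^sup>2" for z
    using assms by (simp add: diff)
  have "(\<integral>z. z * psi a z \<partial>std_normal) = 2 * Phi a - 1"
    using stein_clamp[of "-a" a] Phi_diff[of "-a" a] assms
    by (simp add: psi_eq measure_std_normal_Icc Phi_minus)
  then have "(\<integral>z. z * psi a z - (psi a z)\<^sup>2 \<partial>std_normal)
      = 2 * Phi a - 1 - (\<integral>z. (psi a z)\<^sup>2 \<partial>std_normal)"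
    using int integrable_psi_square by simp
  moreover have "0 \<le> (\<integral>z. z * psi a z - (psi a z)\<^sup>2 \<partial>std_normal)"
    using nn by simp
  moreover have "(\<integral>z. z * psi a z - (psi a z)\<^sup>2 \<partial>std_normal) \<noteq> 0"
  proof
    assume "(\<integral>z. z * psi a z - (psi a z)\<^sup>2 \<partial>std_normal) = 0"
    then have "AE z in std_normal. z * psi a z - (psi a z)\<^sup>2 = 0"
      using integral_nonneg_eq_0_iff_AE[OF int'] nn by simp
    then have "AE z in std_normal. z \<in> {-a..a}"
      unfolding diff by eventually_elim (use assms in \<open>auto simp: max_def split: if_splits\<close>)
    then have "measure std_normal {-a..a} = 1"
      by (intro std_normal.prob_eq_1[THEN iffD2]) auto
    then show False
      using Phi_diff[of "-a" a] assms Phi_less_1[of a] by (simp add: measure_std_normal_Icc Phi_minus)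
  qed
  ultimately show ?thesis by simp
qed

text \<open>Where \<open>2 * Phi a - 1 = 1 / m\<close> the moment inequality is already strict. A
  small step to the right makes the mass condition strict too and, by continuity, keeps the
  other.\<close>

lemma sub_unit_threshold_exists:
  assumes "1 < m"
  obtains a where "0 < a" "1 / m < 2 * Phi a - 1" "m * (\<integral>z. (psi a z)\<^sup>2 \<partial>std_normal) < 1"
proof -
  define K where "K = (\<lambda>u. m * (\<integral>z. (psi u z)\<^sup>2 \<partial>std_normal))"
  have "(\<lambda>n. 2 * Phi (real n) - 1) \<longlonglongrightarrow> 2 * 1 - 1"
    unfolding Phi_def by (intro tendsto_intros std_normal.cdf_lim_at_top_prob
        filterlim_compose[OF std_normal.cdf_lim_at_top_prob filterlim_real_sequentially])
  then have "eventually (\<lambda>n. 1 / m < 2 * Phi (real n) - 1) sequentially"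
    using assms by (intro order_tendstoD(1)) auto
  then obtain n where n: "1 / m < 2 * Phi (real n) - 1"
    using eventually_happens trivial_limit_sequentially by blast
  have "\<exists>a\<ge>0. a \<le> real n \<and> 2 * Phi a - 1 = 1 / m"
    using n assms by (intro IVT') (auto intro!: continuous_intros continuous_on_Phi)
  then obtain a where a: "0 \<le> a" "2 * Phi a - 1 = 1 / m" by auto
  then have "0 < a" using assms by (cases "a = 0") auto
  then have "K a < 1"
  proof -
    have "(\<integral>z. (psi a z)\<^sup>2 \<partial>std_normal) < 1 / m"
      using integral_psi_square_less[OF \<open>0 < a\<close>] a(2) by simp
    then show ?thesis
      using assms by (simp add: K_def pos_less_divide_eq mult.commute)
  qed
  moreover have "isCont K a"
  proof (rule continuous_on_interior)
    show "continuous_on {0..} K"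
      unfolding K_def by (intro continuous_intros continuous_on_integral_psi_square)
  qed (use \<open>0 < a\<close> in simp)
  ultimately have "eventually (\<lambda>b. K b < 1) (at a)"
    unfolding isCont_def by (rule order_tendstoD(2)[rotated])
  then obtain d where d: "0 < d" "\<And>b. b \<noteq> a \<Longrightarrow> dist b a < d \<Longrightarrow> K b < 1"
    unfolding eventually_at by auto
  show ?thesis
  proof (rule that[of "a + d / 2"])
    show "1 / m < 2 * Phi (a + d / 2) - 1"
      using Phi_strict_mono[of a "a + d / 2"] d(1) a by simp
    show "m * (\<integral>z. (psi (a + d / 2) z)\<^sup>2 \<partial>std_normal) < 1"
      using d(1) d(2)[of "a + d / 2"] by (simp add: K_def dist_real_def)
  qed (use \<open>0 < a\<close> d(1) in simp)
qed

context real_distribution begin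

interpretation pair: pair_prob_space M std_normal ..

text \<open>For a fixed threshold, \<open>T(\<tau>) / \<tau>\<^sup>2\<close> has a limit below \<open>1\<close> as \<open>\<tau> \<rightarrow> \<infinity>\<close>.\<close>

lemma moment_le_at_large_scale:
  assumes "1 < m" "0 < l"
  obtains \<tau> r where "0 < \<tau>" "root M \<tau> m l r" "m * moment M \<tau> l r \<le> \<tau>\<^sup>2"
proof -
  let ?P = "M \<Otimes>\<^sub>M std_normal"
  obtain a where a: "0 < a" "1 / m < 2 * Phi a - 1" "m * (\<integral>z. (psi a z)\<^sup>2 \<partial>std_normal) < 1"
    using sub_unit_threshold_exists[OF assms(1)] .
  \<comment> \<open>Along the noise levels \<open>real n\<close> this choice keeps the core
    proportional to the noise: \<open>l * (1 + R n) = a * real n\<close>.\<close>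
  define R where "R = (\<lambda>n. a * real n / l - 1)"
  have lim_arg: "(\<lambda>n. (w + real n * z) / real n) \<longlonglongrightarrow> z" for w z
  proof (rule Lim_transform_eventually)
    have "(\<lambda>n. w * inverse (real n) + z) \<longlonglongrightarrow> w * 0 + z"
      by (intro tendsto_intros lim_inverse_n)
    then show "(\<lambda>n. w * inverse (real n) + z) \<longlonglongrightarrow> z" by simp
    show "eventually (\<lambda>n. w * inverse (real n) + z = (w + real n * z) / real n) sequentially"
      using eventually_gt_at_top[of 0] by eventually_elim (simp add: field_simps)
  qed
  have distr_snd: "(\<integral>p. f (snd p) \<partial>?P) = (\<integral>z. f z \<partial>std_normal)"
    if [measurable]: "f \<in> borel_measurable borel" and f: "\<And>z. \<bar>f z\<bar> \<le> C" for f :: "real \<Rightarrow> real" and C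
  proof -
    have "integrable ?P (\<lambda>(x, y). f y)"
      by (rule integrable_pair_bounded[where C = C]) (use f in auto)
    from pair.integral_fst[OF this] show ?thesis
      using prob_space by (simp add: case_prod_unfold)
  qed
  have "(\<lambda>n. core_mass M (real n) (a * real n)) \<longlonglongrightarrow> (\<integral>p. indicator {z. \<bar>z\<bar> \<le> a} (snd p) \<partial>?P)"
    unfolding core_mass_eq
  proof (rule integral_dominated_convergence[where w = "\<lambda>_. 1"])
    have "AE p in ?P. \<bar>snd p\<bar> \<noteq> a"
    proof (rule pair.AE_pair_measure)
      have "AE z in std_normal. \<bar>z\<bar> \<noteq> a"
        using AE_std_normal_neq[of a] AE_std_normal_neq[of "- a"] by eventually_elim auto
      then show "AE w in M. AE z in std_normal. \<bar>snd (w, z)\<bar> \<noteq> a" by simp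
    qed measurable
    then show "AE p in ?P. (\<lambda>n. indicator {p. \<bar>fst p + real n * snd p\<bar> \<le> a * real n} p :: real)
        \<longlonglongrightarrow> indicator {z. \<bar>z\<bar> \<le> a} (snd p)"
    proof eventually_elim
      fix p :: "real \<times> real" assume p: "\<bar>snd p\<bar> \<noteq> a"
      have lim: "(\<lambda>n. a - \<bar>(fst p + real n * snd p) / real n\<bar>) \<longlonglongrightarrow> a - \<bar>snd p\<bar>"
        by (intro tendsto_intros lim_arg)
      have iff: "\<bar>fst p + real n * snd p\<bar> \<le> a * real n \<longleftrightarrow> 0 \<le> a - \<bar>(fst p + real n * snd p) / real n\<bar>"
        if "0 < n" for n
        using that by (simp add: abs_divide divide_le_eq)
      show "(\<lambda>n. indicator {p. \<bar>fst p + real n * snd p\<bar> \<le> a * real n} p :: real)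
        \<longlonglongrightarrow> indicator {z. \<bar>z\<bar> \<le> a} (snd p)"
      proof (cases "\<bar>snd p\<bar> < a")
        case True
        then have "eventually (\<lambda>n. 0 < a - \<bar>(fst p + real n * snd p) / real n\<bar>) sequentially"
          by (intro order_tendstoD(1)[OF lim]) simp
        then have "eventually (\<lambda>n. indicator {p. \<bar>fst p + real n * snd p\<bar> \<le> a * real n} p
            = (indicator {z. \<bar>z\<bar> \<le> a} (snd p) :: real)) sequentially"
          using eventually_gt_at_top[of 0]
          by eventually_elim (use True iff in \<open>auto simp: indicator_def\<close>)
        then show ?thesis by (rule tendsto_eventually)
      next
        case False
        then have "eventually (\<lambda>n. a - \<bar>(fst p + real n * snd p) / real n\<bar> < 0) sequentially"
          using p by (intro order_tendstoD(2)[OF lim]) simp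
        then have "eventually (\<lambda>n. indicator {p. \<bar>fst p + real n * snd p\<bar> \<le> a * real n} p
            = (indicator {z. \<bar>z\<bar> \<le> a} (snd p) :: real)) sequentially"
          using eventually_gt_at_top[of 0]
          by eventually_elim (use False p iff in \<open>auto simp: indicator_def\<close>)
        then show ?thesis by (rule tendsto_eventually)
      qed
    qed
  qed auto
  also have "(\<integral>p. indicator {z. \<bar>z\<bar> \<le> a} (snd p) \<partial>?P) = 2 * Phi a - 1"
    using a(1) distr_snd[of "indicator {z. \<bar>z\<bar> \<le> a}" 1] by (auto simp: measure_std_normal_abs_le)
  finally have mass: "(\<lambda>n. core_mass M (real n) (a * real n)) \<longlonglongrightarrow> 2 * Phi a - 1" .
  have R1: "1 + R n = a * real n / l" for n by (simp add: R_def)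
  have R_top: "filterlim (\<lambda>n. a / l * real n) at_top sequentially"
    using assms a by (intro filterlim_tendsto_pos_mult_at_top[OF tendsto_const] filterlim_real_sequentially) simp
  have "(\<lambda>n. 1 - inverse (a / l * real n)) \<longlonglongrightarrow> 1 - 0"
    by (intro tendsto_intros filterlim_compose[OF tendsto_inverse_0_at_top R_top] filterlim_ident)
  then have "(\<lambda>n. 1 - inverse (a / l * real n)) \<longlonglongrightarrow> 1"
    by (simp only: diff_zero)
  then have frac: "(\<lambda>n. R n / (1 + R n)) \<longlonglongrightarrow> 1"
  proof (rule Lim_transform_eventually)
    show "eventually (\<lambda>n. 1 - inverse (a / l * real n) = R n / (1 + R n)) sequentially"
      using eventually_gt_at_top[of 0]
      by eventually_elim (use assms a in \<open>simp add: R_def field_simps\<close>)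
  qed
  have sq: "(\<lambda>n. \<integral>p. (psi a ((fst p + real n * snd p) / real n))\<^sup>2 \<partial>?P)
      \<longlonglongrightarrow> (\<integral>p. (psi a (snd p))\<^sup>2 \<partial>?P)"
  proof (rule integral_dominated_convergence[where w = "\<lambda>_. a\<^sup>2"])
    show "AE p in ?P. (\<lambda>n. (psi a ((fst p + real n * snd p) / real n))\<^sup>2) \<longlonglongrightarrow> (psi a (snd p))\<^sup>2"
      unfolding psi_def by (intro AE_I2 tendsto_intros lim_arg)
  qed (auto simp: psi_square_le)
  have "(\<integral>p. (psi a (snd p))\<^sup>2 \<partial>?P) = (\<integral>z. (psi a z)\<^sup>2 \<partial>std_normal)"
    by (rule distr_snd[of _ "a\<^sup>2"]) (auto simp: psi_square_le)
  with sq have "(\<lambda>n. m * (\<integral>p. (psi a ((fst p + real n * snd p) / real n))\<^sup>2 \<partial>?P))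
      \<longlonglongrightarrow> m * (\<integral>z. (psi a z)\<^sup>2 \<partial>std_normal)"
    by (intro tendsto_intros) simp
  then have ev1: "eventually (\<lambda>n. m * (\<integral>p. (psi a ((fst p + real n * snd p) / real n))\<^sup>2 \<partial>?P) < 1) sequentially"
    using a(3) by (rule order_tendstoD(2))
  have "(\<lambda>n. R n / (1 + R n) * core_mass M (real n) (a * real n)) \<longlonglongrightarrow> 1 * (2 * Phi a - 1)"
    by (intro tendsto_mult frac mass)
  then have ev2: "eventually (\<lambda>n. 1 / m < R n / (1 + R n) * core_mass M (real n) (a * real n)) sequentially"
    using a(2) by (intro order_tendstoD(1)) auto
  have ev3: "eventually (\<lambda>n. 1 \<le> a / l * real n) sequentially"
    using R_top by (simp add: filterlim_at_top)
  obtain n where n: "m * (\<integral>p. (psi a ((fst p + real n * snd p) / real n))\<^sup>2 \<partial>?P) < 1"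
      "1 / m < R n / (1 + R n) * core_mass M (real n) (a * real n)" "1 \<le> a / l * real n" "0 < n"
    using eventually_happens[OF eventually_conj[OF ev1 eventually_conj[OF ev2 eventually_conj[OF ev3
      eventually_gt_at_top[of 0]]]]] by auto
  have R0: "0 \<le> R n" using n(3) by (simp add: R_def)
  have lR: "l * (1 + R n) = a * real n" using assms by (simp add: R1)
  obtain r where r: "root M (real n) m l r"
    using root_exists[of "real n" m l] n(4) assms by auto
  \<comment> \<open>The trial value overshoots the equation, so it bounds the root and, by
    monotonicity, the moment.\<close>
  have "r \<le> R n"
    using n(2) lR by (intro root_le[OF r assms R0]) simp
  then have "moment M (real n) l r \<le> moment M (real n) l (R n)"
    using r assms by (intro moment_mono) (auto simp: root_def)
  also have "\<dots> \<le> (\<integral>p. (real n)\<^sup>2 * (psi a ((fst p + real n * snd p) / real n))\<^sup>2 \<partial>?P)"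
    unfolding moment_eq
  proof (rule integral_mono)
    fix p :: "real \<times> real"
    let ?y = "fst p + real n * snd p"
    have "Psi l ?y (R n) = real n * (R n / (1 + R n)) * psi a (?y / real n)"
      using Psi_scale[of "real n" "R n" "l / real n" "?y / real n"] n(4) R0 lR by simp
    then have "(Psi l ?y (R n))\<^sup>2 = (R n / (1 + R n))\<^sup>2 * ((real n)\<^sup>2 * (psi a (?y / real n))\<^sup>2)"
      by (simp add: power_mult_distrib mult_ac power_divide)
    also have "\<dots> \<le> 1 * ((real n)\<^sup>2 * (psi a (?y / real n))\<^sup>2)"
      using R0 by (intro mult_right_mono power_le_one) auto
    finally show "(Psi l ?y (R n))\<^sup>2 \<le> (real n)\<^sup>2 * (psi a (?y / real n))\<^sup>2" by simp
  next
    show "integrable ?P (\<lambda>p. (Psi l (fst p + real n * snd p) (R n))\<^sup>2)"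
      by (rule integrable_pair_bounded[where C = "(R n * l)\<^sup>2"]) (auto simp: Psi_square_le)
    have "integrable ?P (\<lambda>p. (psi a ((fst p + real n * snd p) / real n))\<^sup>2)"
      by (rule integrable_pair_bounded[where C = "a\<^sup>2"])
        (auto simp: psi_square_le)
    then show "integrable ?P (\<lambda>p. (real n)\<^sup>2 * (psi a ((fst p + real n * snd p) / real n))\<^sup>2)"
      by simp
  qed
  also have "\<dots> = (real n)\<^sup>2 * (\<integral>p. (psi a ((fst p + real n * snd p) / real n))\<^sup>2 \<partial>?P)"
    by simp
  finally have "m * moment M (real n) l r
      \<le> (real n)\<^sup>2 * (m * (\<integral>p. (psi a ((fst p + real n * snd p) / real n))\<^sup>2 \<partial>?P))"
    using assms by (simp add: mult_left_mono mult.left_commute)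
  also have "\<dots> \<le> (real n)\<^sup>2 * 1"
    using n(1) by (intro mult_left_mono) auto
  finally show ?thesis
    using that[of "real n" r] n(4) r by simp
qed

end

section \<open>Mass and second moment under contamination\<close>

context contaminated begin

lemma core_mass_contam:
  assumes "0 \<le> c"
  shows "core_mass F \<tau> c = (1 - \<epsilon>) * (2 * Phi (c / sqrt (1 + \<tau>\<^sup>2)) - 1) + \<epsilon> * core_mass H \<tau> c"
proof -
  interpret FY: real_distribution "noisy F \<tau>" by (rule F.real_distribution_noisy)
  interpret HY: real_distribution "noisy H \<tau>" by (rule H.real_distribution_noisy)
  let ?s = "sqrt (1 + \<tau>\<^sup>2)"
  have s: "0 < ?s" by (simp add: add_pos_nonneg)
  have "(\<integral>y. indicator {y. \<bar>y\<bar> \<le> c} y \<partial>noisy F \<tau>)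
      = (1 - \<epsilon>) * (\<integral>z. indicator {y. \<bar>y\<bar> \<le> c} (?s * z) \<partial>std_normal)
        + \<epsilon> * (\<integral>y. indicator {y. \<bar>y\<bar> \<le> c} y \<partial>noisy H \<tau>)"
    by (rule contam_integral_noisy[where C = 1])
      (use eps cdf_mixture F.real_distribution_axioms H.real_distribution_axioms in auto)
  moreover have "indicator {y. \<bar>y\<bar> \<le> c} (?s * z) = (indicator {z. \<bar>z\<bar> \<le> c / ?s} z :: real)" for z
    using s by (auto simp: indicator_def abs_mult field_simps)
  ultimately show ?thesis
    using assms s by (simp add: core_mass_def measure_std_normal_abs_le)
qed

text \<open>Only the Gaussian share is kept, since contamination can only add mass to the
  core.\<close>

lemma core_mass_ge_B_bar:
  assumes "0 < \<kappa>" "0 \<le> r"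
  shows "B_bar (\<kappa> * (1 + r)) \<epsilon> \<le> core_mass F \<tau> (\<kappa> * sqrt (1 + \<tau>\<^sup>2) * (1 + r))"
proof -
  have s: "0 < sqrt (1 + \<tau>\<^sup>2)" by (simp add: add_pos_nonneg)
  have "0 \<le> \<epsilon> * core_mass H \<tau> (\<kappa> * sqrt (1 + \<tau>\<^sup>2) * (1 + r))"
    using eps H.core_mass_nonneg by simp
  then show ?thesis
    using assms s by (simp add: core_mass_contam B_bar_def mult_ac)
qed

lemma moment_contam:
  "moment F \<tau> l r
    = (1 - \<epsilon>) * (\<integral>z. (Psi l (sqrt (1 + \<tau>\<^sup>2) * z) r)\<^sup>2 \<partial>std_normal) + \<epsilon> * moment H \<tau> l r"
  unfolding moment_def
  by (rule contam_integral_noisy[where C = "(r * l)\<^sup>2"])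
    (use eps cdf_mixture F.real_distribution_axioms H.real_distribution_axioms Psi_square_le in auto)

lemma moment_contam_scaled:
  assumes "0 \<le> r"
  shows "moment F \<tau> (\<kappa> * sqrt (1 + \<tau>\<^sup>2)) r
    = (1 - \<epsilon>) * ((1 + \<tau>\<^sup>2) * (r / (1 + r))\<^sup>2 * (\<integral>z. (psi (\<kappa> * (1 + r)) z)\<^sup>2 \<partial>std_normal))
      + \<epsilon> * moment H \<tau> (\<kappa> * sqrt (1 + \<tau>\<^sup>2)) r"
proof -
  have s: "0 < sqrt (1 + \<tau>\<^sup>2)" "(sqrt (1 + \<tau>\<^sup>2))\<^sup>2 = 1 + \<tau>\<^sup>2" by (simp_all add: add_pos_nonneg)
  show ?thesis
    unfolding moment_contam Psi_scale[OF s(1) assms]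
    by (simp add: power_mult_distrib power_divide s(2))
qed

text \<open>\<open>A_bar\<close> is the second moment with every contaminated observation counted as
  saturated, the largest score available.\<close>

lemma moment_le_A_bar:
  assumes "0 < \<kappa>" "0 \<le> r"
  shows "moment F \<tau> (\<kappa> * sqrt (1 + \<tau>\<^sup>2)) r
    \<le> (1 + \<tau>\<^sup>2) * (r / (1 + r))\<^sup>2 * A_bar (\<kappa> * (1 + r)) \<epsilon>"
proof -
  interpret HY: real_distribution "noisy H \<tau>" by (rule H.real_distribution_noisy)
  have s: "(sqrt (1 + \<tau>\<^sup>2))\<^sup>2 = 1 + \<tau>\<^sup>2" by simp
  have "moment H \<tau> (\<kappa> * sqrt (1 + \<tau>\<^sup>2)) r \<le> (\<integral>y. (r * (\<kappa> * sqrt (1 + \<tau>\<^sup>2)))\<^sup>2 \<partial>noisy H \<tau>)"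
    unfolding moment_def by (intro integral_mono H.integrable_Psi_square) (auto simp: Psi_square_le)
  also have "\<dots> = (r * (\<kappa> * sqrt (1 + \<tau>\<^sup>2)))\<^sup>2"
    using HY.prob_space by simp
  also have "\<dots> = (1 + \<tau>\<^sup>2) * (r / (1 + r))\<^sup>2 * (\<kappa> * (1 + r))\<^sup>2"
    using assms by (simp add: power_mult_distrib s power_divide)
  finally have "\<epsilon> * moment H \<tau> (\<kappa> * sqrt (1 + \<tau>\<^sup>2)) r
      \<le> \<epsilon> * ((1 + \<tau>\<^sup>2) * (r / (1 + r))\<^sup>2 * (\<kappa> * (1 + r))\<^sup>2)"
    using eps by (intro mult_left_mono) auto
  then show ?thesis
    unfolding moment_contam_scaled[OF assms(2)] A_bar_def by (simp add: algebra_simps)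
qed

text \<open>Dropping the contamination and shrinking the scale
  \<open>sqrt (1 + \<tau>\<^sup>2)\<close> to one leaves a bound free of \<open>\<tau>\<close> and
  of \<open>H\<close>.\<close>

lemma moment_ge:
  assumes "0 \<le> l" "l \<le> l'" "0 \<le> r" "r \<le> r'"
  shows "(1 - \<epsilon>) * (\<integral>z. (Psi l z r)\<^sup>2 \<partial>std_normal) \<le> moment F \<tau> l' r'"
proof -
  have "(\<integral>z. (Psi l z r)\<^sup>2 \<partial>std_normal) \<le> (\<integral>z. (Psi l' (sqrt (1 + \<tau>\<^sup>2) * z) r')\<^sup>2 \<partial>std_normal)"
  proof (rule integral_mono)
    show "(Psi l z r)\<^sup>2 \<le> (Psi l' (sqrt (1 + \<tau>\<^sup>2) * z) r')\<^sup>2" for z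
      by (rule Psi_square_mono) (use assms in \<open>auto simp: abs_mult intro!: mult_le_cancel_right1[THEN iffD2]\<close>)
    show "integrable std_normal (\<lambda>z. (Psi l z r)\<^sup>2)"
      by (rule integrable_std_normal_bounded[where C = "(r * l)\<^sup>2"]) (auto simp: Psi_square_le)
    show "integrable std_normal (\<lambda>z. (Psi l' (sqrt (1 + \<tau>\<^sup>2) * z) r')\<^sup>2)"
      by (rule integrable_std_normal_bounded[where C = "(r' * l')\<^sup>2"]) (auto simp: Psi_square_le)
  qed
  then have "(1 - \<epsilon>) * (\<integral>z. (Psi l z r)\<^sup>2 \<partial>std_normal)
      \<le> (1 - \<epsilon>) * (\<integral>z. (Psi l' (sqrt (1 + \<tau>\<^sup>2) * z) r')\<^sup>2 \<partial>std_normal)"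
    using eps by (intro mult_left_mono) auto
  then show ?thesis
    unfolding moment_contam using eps H.moment_nonneg[of \<tau> l' r'] by (simp add: add_increasing2)
qed

end

lemma integral_Psi_square_pos:
  assumes "0 < l" "0 < r"
  shows "0 < (\<integral>z. (Psi l z r)\<^sup>2 \<partial>std_normal)"
proof -
  have int: "integrable std_normal (\<lambda>z. (Psi l z r)\<^sup>2)"
    by (rule integrable_std_normal_bounded[where C = "(r * l)\<^sup>2"]) (auto simp: Psi_square_le)
  have "(\<integral>z. (Psi l z r)\<^sup>2 \<partial>std_normal) \<noteq> 0"
  proof
    assume "(\<integral>z. (Psi l z r)\<^sup>2 \<partial>std_normal) = 0"
    then have "AE z in std_normal. (Psi l z r)\<^sup>2 = 0"
      using integral_nonneg_eq_0_iff_AE[OF int] by simp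
    with AE_std_normal_neq[of 0] have "AE z in std_normal. False"
    proof eventually_elim
      case (elim z)
      then have "\<bar>Psi l z r\<bar> = 0" by simp
      then show ?case
        using assms elim(1) by (subst (asm) abs_Psi) (auto simp: min_def split: if_splits)
    qed
    then show False by (simp add: std_normal.AE_False)
  qed
  then show ?thesis by (simp add: less_le)
qed

context contaminated begin

text \<open>The threshold may vary with \<open>\<tau>\<close>, so both parametrizations are covered.
  For small \<open>\<tau>\<close> the map stays above a positive constant and thus above
  \<open>\<tau>\<^sup>2\<close>; the start point provides the opposite inequality.\<close>

lemma se_solution_exists:
  assumes m: "1 < m"
    and l: "continuous_on {0<..} l" "0 < l0" "\<And>\<tau>. 0 < \<tau> \<Longrightarrow> l0 \<le> l \<tau>"
    and start: "0 < \<tau>1" "root F \<tau>1 m (l \<tau>1) r1" "m * moment F \<tau>1 (l \<tau>1) r1 \<le> \<tau>1\<^sup>2"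
  obtains \<tau> r where "se_solution F m \<tau> (l \<tau>) r"
proof -
  define R where "R = (\<lambda>\<tau>. SOME r. root F \<tau> m (l \<tau>) r)"
  have l_pos: "0 < l \<tau>" if "0 < \<tau>" for \<tau>
    using l(2) l(3)[OF that] by simp
  have R: "root F \<tau> m (l \<tau>) (R \<tau>)" if "0 < \<tau>" for \<tau>
    unfolding R_def by (rule someI_ex, rule F.root_exists) (use that m l_pos in auto)
  define T where "T = (\<lambda>\<tau>. m * moment F \<tau> (l \<tau>) (R \<tau>))"
  have T_cont: "continuous_on {0<..} T"
    unfolding continuous_on_sequentially comp_def
  proof (intro ballI allI impI, elim conjE)
    fix t :: "nat \<Rightarrow> real" and \<tau> assume \<tau>: "\<tau> \<in> {0<..}" "\<forall>n. t n \<in> {0<..}" "t \<longlonglongrightarrow> \<tau>"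
    have lim_l: "(\<lambda>n. l (t n)) \<longlonglongrightarrow> l \<tau>"
      using l(1) \<tau> unfolding continuous_on_sequentially comp_def by auto
    have "(\<lambda>n. R (t n)) \<longlonglongrightarrow> R \<tau>"
      by (rule F.root_tendsto[of \<tau> m "l \<tau>" "R \<tau>" t "\<lambda>n. l (t n)"])
        (use \<tau> R lim_l l_pos m in auto)
    then show "(\<lambda>n. T (t n)) \<longlonglongrightarrow> T \<tau>"
      unfolding T_def using \<tau> lim_l R[of \<tau>]
      by (intro tendsto_intros F.moment_tendsto) (auto simp: root_def)
  qed
  \<comment> \<open>\<open>l0\<close> and \<open>1 / (m - 1)\<close> bound threshold and root from
    below at every noise level, so \<open>c\<close> bounds \<open>T\<close> uniformly.\<close>
  define c where "c = m * ((1 - \<epsilon>) * (\<integral>z. (Psi l0 z (1 / (m - 1)))\<^sup>2 \<partial>std_normal))"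
  have "0 < c"
    using m eps l(2) integral_Psi_square_pos[of l0 "1 / (m - 1)"] by (simp add: c_def)
  have T_ge: "c \<le> T \<tau>" if "0 < \<tau>" for \<tau>
    unfolding c_def T_def
    using m l(2) l(3)[OF that] F.root_ge[OF R[OF that] m] by (intro mult_left_mono moment_ge) auto
  define \<tau>0 where "\<tau>0 = min \<tau>1 (sqrt c)"
  have \<tau>0: "0 < \<tau>0" "\<tau>0 \<le> \<tau>1" "\<tau>0\<^sup>2 \<le> c"
  proof -
    show "0 < \<tau>0" "\<tau>0 \<le> \<tau>1" using start(1) \<open>0 < c\<close> by (auto simp: \<tau>0_def)
    have "\<tau>0\<^sup>2 \<le> (sqrt c)\<^sup>2"
      using \<open>0 < \<tau>0\<close> by (intro power_mono) (auto simp: \<tau>0_def)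
    then show "\<tau>0\<^sup>2 \<le> c" using \<open>0 < c\<close> by simp
  qed
  have "R \<tau>1 = r1"
    using F.root_unique[OF R[OF start(1)] start(2) m l_pos[OF start(1)]] .
  then have "T \<tau>1 - \<tau>1\<^sup>2 \<le> 0" using start(3) by (simp add: T_def)
  moreover have "0 \<le> T \<tau>0 - \<tau>0\<^sup>2" using T_ge[OF \<tau>0(1)] \<tau>0(3) by simp
  moreover have "continuous_on {\<tau>0..\<tau>1} (\<lambda>\<tau>. T \<tau> - \<tau>\<^sup>2)"
    using \<tau>0(1) by (intro continuous_intros continuous_on_subset[OF T_cont]) auto
  ultimately have "\<exists>\<tau>\<ge>\<tau>0. \<tau> \<le> \<tau>1 \<and> T \<tau> - \<tau>\<^sup>2 = 0"
    using \<tau>0(2) by (intro IVT2') auto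
  then obtain \<tau> where "\<tau>0 \<le> \<tau>" "T \<tau> = \<tau>\<^sup>2" by auto
  then show ?thesis
    using that[of \<tau> "R \<tau>"] \<tau>0(1) R[of \<tau>] by (auto simp: se_solution_def T_def)
qed

lemma se_solution_exists_const:
  assumes "1 < m" "0 < l"
  obtains \<tau> r where "se_solution F m \<tau> l r"
proof -
  obtain \<tau>1 r1 where "0 < \<tau>1" "root F \<tau>1 m l r1" "m * moment F \<tau>1 l r1 \<le> \<tau>1\<^sup>2"
    using F.moment_le_at_large_scale[OF assms] .
  then show ?thesis
    using se_solution_exists[OF assms(1), of "\<lambda>_. l" l] assms(2) that by auto
qed

end


section \<open>Escaping contamination\<close>

lemma se_A_eq: "se_A t r \<kappa> F = moment F (sqrt t) (\<kappa> * sqrt (1 + t)) r"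
  by (simp add: se_A_def moment_def)

lemma (in real_distribution) se_R_eq_iff:
  "se_R_eq \<tau> m \<kappa> M r \<longleftrightarrow> root M \<tau> m (\<kappa> * sqrt (1 + \<tau>\<^sup>2)) r"
proof -
  interpret Y: real_distribution "noisy M \<tau>" by (rule real_distribution_noisy)
  let ?c = "\<kappa> * sqrt (1 + \<tau>\<^sup>2) * (1 + r)"
  have "(\<integral>y. Psi' (\<kappa> * sqrt (1 + \<tau>\<^sup>2)) y r \<partial>noisy M \<tau>)
      = (\<integral>y. r / (1 + r) * indicator {y. \<bar>y\<bar> \<le> ?c} y \<partial>noisy M \<tau>)"
    by (simp add: Psi'_def indicator_def of_bool_def)
  also have "\<dots> = r / (1 + r) * core_mass M \<tau> ?c"
    by (simp add: core_mass_def)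
  finally show ?thesis by (simp add: se_R_eq_def root_def)
qed

text \<open>The least root chosen by \<open>se_R\<close> is the only one, so a fixed point is a
  solution. The value \<open>t = 0\<close> is excluded because the moment at a root is
  positive.\<close>

lemma (in contaminated) fixed_point_iff:
  assumes "0 < \<kappa>" "1 < m"
  shows "is_fixed_point m \<kappa> F t \<longleftrightarrow> 0 < t \<and> (\<exists>r. se_solution F m (sqrt t) (\<kappa> * sqrt (1 + t)) r)"
proof (cases "0 \<le> t")
  case True
  let ?l = "\<kappa> * sqrt (1 + t)"
  have l: "0 < ?l" using assms True by simp
  have R_eq: "se_R_eq (sqrt t) m \<kappa> F r \<longleftrightarrow> root F (sqrt t) m ?l r" for r
    using True by (simp add: F.se_R_eq_iff)
  have T_eq: "se_T t m \<kappa> F = m * moment F (sqrt t) ?l r" if r: "root F (sqrt t) m ?l r" for r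
  proof -
    have "se_R (sqrt t) m \<kappa> F = r"
      unfolding se_R_def R_eq
    proof (rule Least_equality)
      show "r \<le> y" if "root F (sqrt t) m ?l y" for y
        using F.root_unique[OF r that assms(2) l] by simp
    qed (rule r)
    then show ?thesis by (simp add: se_T_def se_A_eq)
  qed
  have pos: "0 < m * moment F (sqrt t) ?l r" if r: "root F (sqrt t) m ?l r" for r
  proof -
    have "0 < (1 - \<epsilon>) * (\<integral>z. (Psi ?l z r)\<^sup>2 \<partial>std_normal)"
      using eps l integral_Psi_square_pos F.root_pos[OF r assms(2)] by simp
    also have "\<dots> \<le> moment F (sqrt t) ?l r"
      using l F.root_pos[OF r assms(2)] by (intro moment_ge) auto
    finally show ?thesis using assms by simp
  qed
  show ?thesis
  proof
    assume fp: "is_fixed_point m \<kappa> F t"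
    then obtain r where r: "root F (sqrt t) m ?l r" by (auto simp: is_fixed_point_def R_eq)
    moreover have "m * moment F (sqrt t) ?l r = t"
      using fp T_eq[OF r] by (simp add: is_fixed_point_def)
    ultimately show "0 < t \<and> (\<exists>r. se_solution F m (sqrt t) ?l r)"
      using pos[OF r] by (intro conjI exI[of _ r]) (simp_all add: se_solution_def)
  next
    assume "0 < t \<and> (\<exists>r. se_solution F m (sqrt t) ?l r)"
    then obtain r where r: "0 < t" "root F (sqrt t) m ?l r" "t = m * moment F (sqrt t) ?l r"
      by (auto simp: se_solution_def)
    then show "is_fixed_point m \<kappa> F t"
      using T_eq[OF r(2)] unfolding is_fixed_point_def R_eq by auto
  qed
qed (auto simp: is_fixed_point_def)

text \<open>The equation of \<open>r_bar\<close>: contamination at infinity leaves no mass in the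
  core. As a predicate it can be used before its solvability is known.\<close>

definition limit_system :: "real \<Rightarrow> real \<Rightarrow> real \<Rightarrow> real \<Rightarrow> bool" where
  "limit_system m \<epsilon> \<kappa> r \<longleftrightarrow> 0 < \<kappa> \<and> 0 < r \<and> r / (1 + r) * B_bar (\<kappa> * (1 + r)) \<epsilon> = 1 / m"

lemma A_bar_pos:
  assumes "0 < \<epsilon>" "\<epsilon> < 1" "0 < u"
  shows "0 < A_bar u \<epsilon>"
proof -
  have "0 \<le> (1 - \<epsilon>) * (\<integral>x. (psi u x)\<^sup>2 \<partial>std_normal)" using assms by simp
  then show ?thesis using assms by (simp add: A_bar_def add_nonneg_pos)
qed

lemma V_bar_pos: "0 < \<epsilon> \<Longrightarrow> \<epsilon> < 1 \<Longrightarrow> 0 < u \<Longrightarrow> 0 < V_bar u \<epsilon>"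
  using A_bar_pos[of \<epsilon> u] B_bar_pos[of \<epsilon> u] by (simp add: V_bar_def)

lemma limit_system_V_bar:
  assumes "limit_system m \<epsilon> \<kappa> r" "\<epsilon> < 1" "1 < m"
  shows "m * ((r / (1 + r))\<^sup>2 * A_bar (\<kappa> * (1 + r)) \<epsilon>) = V_bar (\<kappa> * (1 + r)) \<epsilon> / m"
proof -
  have "0 < B_bar (\<kappa> * (1 + r)) \<epsilon>"
    using assms by (intro B_bar_pos) (auto simp: limit_system_def)
  moreover have "r / (1 + r) * B_bar (\<kappa> * (1 + r)) \<epsilon> = 1 / m"
    using assms by (simp add: limit_system_def)
  ultimately have "r / (1 + r) = 1 / m / B_bar (\<kappa> * (1 + r)) \<epsilon>"
    by (metis nonzero_eq_divide_eq less_irrefl)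
  then show ?thesis
    using assms by (simp add: V_bar_def power2_eq_square)
qed

context contaminated begin

text \<open>Contamination only adds mass, so the limit value \<open>r\<close> overshoots the root
  equation of every \<open>F\<close> and \<open>r' \<le> r\<close>. The moment increases in
  \<open>r\<close> and is bounded by saturating the contamination, so both effects have the same
  worst case.\<close>

lemma moment_le_limit_system:
  assumes "limit_system m \<epsilon> \<kappa> r" "1 < m" "root F \<tau> m (\<kappa> * sqrt (1 + \<tau>\<^sup>2)) r'"
  shows "m * moment F \<tau> (\<kappa> * sqrt (1 + \<tau>\<^sup>2)) r' \<le> (1 + \<tau>\<^sup>2) * (V_bar (\<kappa> * (1 + r)) \<epsilon> / m)"
proof -
  have \<kappa>: "0 < \<kappa>" and r: "0 < r" "1 / m = r / (1 + r) * B_bar (\<kappa> * (1 + r)) \<epsilon>"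
    using assms(1) by (auto simp: limit_system_def)
  have s: "0 < sqrt (1 + \<tau>\<^sup>2)" by (simp add: add_pos_nonneg)
  have "1 / m \<le> r / (1 + r) * core_mass F \<tau> (\<kappa> * sqrt (1 + \<tau>\<^sup>2) * (1 + r))"
    unfolding r(2) using \<kappa> r(1) by (intro mult_left_mono core_mass_ge_B_bar) auto
  then have "r' \<le> r"
    using r(1) \<kappa> s by (intro F.root_le[OF assms(3,2)]) auto
  then have "moment F \<tau> (\<kappa> * sqrt (1 + \<tau>\<^sup>2)) r' \<le> moment F \<tau> (\<kappa> * sqrt (1 + \<tau>\<^sup>2)) r"
    using assms(3) \<kappa> s by (intro F.moment_mono) (auto simp: root_def)
  also have "\<dots> \<le> (1 + \<tau>\<^sup>2) * (r / (1 + r))\<^sup>2 * A_bar (\<kappa> * (1 + r)) \<epsilon>"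
    using \<kappa> r(1) by (intro moment_le_A_bar) auto
  finally have "m * moment F \<tau> (\<kappa> * sqrt (1 + \<tau>\<^sup>2)) r'
      \<le> (1 + \<tau>\<^sup>2) * (m * ((r / (1 + r))\<^sup>2 * A_bar (\<kappa> * (1 + r)) \<epsilon>))"
    using assms(2) by (simp add: mult_left_mono mult_ac)
  then show ?thesis
    unfolding limit_system_V_bar[OF assms(1) eps(2) assms(2)] .
qed

text \<open>A fixed point satisfies \<open>t \<le> (1 + t) * (W / m)\<close>, which is solved for
  \<open>t\<close> because \<open>W < m\<close>. At the equality case
  \<open>\<tau>1\<^sup>2 = W / (m - W)\<close> the same estimate is a valid start for the
  intermediate value argument.\<close>

lemma fixed_point_bound:
  assumes ls: "limit_system m \<epsilon> \<kappa> r" and m: "1 < m"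
    and V: "V_bar (\<kappa> * (1 + r)) \<epsilon> < m"
  shows "\<exists>t. is_fixed_point m \<kappa> F t"
    and "is_fixed_point m \<kappa> F t \<Longrightarrow> t \<le> V_bar (\<kappa> * (1 + r)) \<epsilon> / (m - V_bar (\<kappa> * (1 + r)) \<epsilon>)"
proof -
  define W where "W = V_bar (\<kappa> * (1 + r)) \<epsilon>"
  have \<kappa>: "0 < \<kappa>" and r: "0 < r" using ls by (auto simp: limit_system_def)
  have W: "0 < W" "W < m"
    using V V_bar_pos[OF eps] \<kappa> r by (auto simp: W_def)
  show "t \<le> W / (m - W)" if fp: "is_fixed_point m \<kappa> F t"
  proof -
    obtain r' where t: "0 < t" and sol: "se_solution F m (sqrt t) (\<kappa> * sqrt (1 + t)) r'"
      using fp unfolding fixed_point_iff[OF \<kappa> m] by blast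
    then have "t \<le> (1 + t) * (W / m)"
      using moment_le_limit_system[OF ls m, of "sqrt t" r'] by (simp add: se_solution_def W_def)
    then show ?thesis using W by (simp add: field_simps)
  qed
  define \<tau>1 where "\<tau>1 = sqrt (W / (m - W))"
  have \<tau>1: "0 < \<tau>1" "(1 + \<tau>1\<^sup>2) * (W / m) = \<tau>1\<^sup>2"
    using W by (simp_all add: \<tau>1_def field_simps)
  define l where "l = (\<lambda>\<tau>. \<kappa> * sqrt (1 + \<tau>\<^sup>2))"
  have l_ge: "\<kappa> \<le> l \<tau>" for \<tau>
    using \<kappa> by (simp add: l_def)
  then have l_pos: "0 < l \<tau>" for \<tau>
    using \<kappa> less_le_trans by blast
  obtain r1 where r1: "root F \<tau>1 m (l \<tau>1) r1"
    using F.root_exists[of \<tau>1 m "l \<tau>1"] \<tau>1 m l_pos by auto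
  then have "m * moment F \<tau>1 (l \<tau>1) r1 \<le> \<tau>1\<^sup>2"
    using moment_le_limit_system[OF ls m, of \<tau>1 r1] \<tau>1(2) by (simp add: l_def W_def)
  moreover have "continuous_on {0<..} l"
    unfolding l_def by (intro continuous_intros)
  ultimately obtain \<tau> r2 where "se_solution F m \<tau> (l \<tau>) r2"
    using se_solution_exists[OF m, of l \<kappa> \<tau>1 r1] \<kappa> l_ge \<tau>1(1) r1 by blast
  then have "is_fixed_point m \<kappa> F (\<tau>\<^sup>2)"
    unfolding fixed_point_iff[OF \<kappa> m] by (auto simp: l_def se_solution_def)
  then show "\<exists>t. is_fixed_point m \<kappa> F t" by blast
qed

end

section \<open>Point masses as contamination\<close>

lemma real_distribution_return: "real_distribution (return borel (x::real))"
proof -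
  interpret prob_space "return borel x" by (rule prob_space_return) simp
  show ?thesis by unfold_locales auto
qed

lemma integral_noisy_return:
  fixes f :: "real \<Rightarrow> real"
  assumes [measurable]: "f \<in> borel_measurable borel" and "\<And>x. \<bar>f x\<bar> \<le> C"
  shows "(\<integral>y. f y \<partial>noisy (return borel x) \<tau>) = (\<integral>z. f (x + \<tau> * z) \<partial>std_normal)"
proof -
  interpret R: real_distribution "return borel x" by (rule real_distribution_return)
  have "(\<lambda>w. \<integral>z. f (w + \<tau> * z) \<partial>std_normal) \<in> borel_measurable borel"
    by (rule std_normal.borel_measurable_lebesgue_integral) simp
  then show ?thesis
    by (simp add: R.integral_noisy_iterated[OF assms] integral_return)
qed

lemma core_mass_return:
  "core_mass (return borel x) \<tau> c = (\<integral>z. indicator {y. \<bar>y\<bar> \<le> c} (x + \<tau> * z) \<partial>std_normal)"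
proof -
  interpret R: real_distribution "return borel x" by (rule real_distribution_return)
  interpret Y: real_distribution "noisy (return borel x) \<tau>" by (rule R.real_distribution_noisy)
  have "core_mass (return borel x) \<tau> c = (\<integral>y. indicator {y. \<bar>y\<bar> \<le> c} y \<partial>noisy (return borel x) \<tau>)"
    by (simp add: core_mass_def)
  then show ?thesis by (subst (asm) integral_noisy_return[where C = 1]) auto
qed

lemma moment_return:
  "moment (return borel x) \<tau> l r = (\<integral>z. (Psi l (x + \<tau> * z) r)\<^sup>2 \<partial>std_normal)"
  unfolding moment_def
  by (rule integral_noisy_return[where C = "(r * l)\<^sup>2"]) (auto simp: Psi_square_le)

text \<open>With probability one half the noise is nonnegative and moves the argument further out,
  where the squared score is no smaller.\<close>

lemma moment_return_ge:
  assumes "0 \<le> x" "0 \<le> \<tau>" "0 \<le> l" "0 \<le> r"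
  shows "(Psi l x r)\<^sup>2 / 2 \<le> moment (return borel x) \<tau> l r"
proof -
  have "measure std_normal {0..} = 1 / 2"
  proof -
    have "measure std_normal {0..} = measure std_normal {0<..}"
      by (rule std_normal.finite_measure_eq_AE) (use AE_std_normal_neq[of 0] in \<open>auto elim!: eventually_mono\<close>)
    also have "\<dots> = 1 - measure std_normal {..0}"
      using std_normal.prob_compl[of "{..0}"] by (simp add: Compl_eq_Diff_UNIV[symmetric])
    finally show ?thesis using Phi_0 by (simp add: Phi_def cdf_def)
  qed
  then have "(Psi l x r)\<^sup>2 / 2 = (\<integral>z. indicator {0..} z * (Psi l x r)\<^sup>2 \<partial>std_normal)"
    by simp
  also have "\<dots> \<le> (\<integral>z. (Psi l (x + \<tau> * z) r)\<^sup>2 \<partial>std_normal)"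
  proof (rule integral_mono)
    show "indicator {0..} z * (Psi l x r)\<^sup>2 \<le> (Psi l (x + \<tau> * z) r)\<^sup>2" for z
      using Psi_square_mono[of l r l r x "x + \<tau> * z"] assms by (auto simp: indicator_def)
    show "integrable std_normal (\<lambda>z. indicator {0..} z * (Psi l x r)\<^sup>2)"
      by (rule integrable_std_normal_bounded[where C = "(r * l)\<^sup>2"])
        (auto simp: indicator_def Psi_square_le)
    show "integrable std_normal (\<lambda>z. (Psi l (x + \<tau> * z) r)\<^sup>2)"
      by (rule integrable_std_normal_bounded[where C = "(r * l)\<^sup>2"]) (auto simp: Psi_square_le)
  qed
  finally show ?thesis by (simp add: moment_return)
qed

lemma core_mass_return_tendsto_0:
  fixes x t c :: "nat \<Rightarrow> real"
  assumes "filterlim x at_top sequentially" "t \<longlonglongrightarrow> \<tau>" "c \<longlonglongrightarrow> d"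
  shows "(\<lambda>n. core_mass (return borel (x n)) (t n) (c n)) \<longlonglongrightarrow> 0"
proof -
  have "(\<lambda>n. \<integral>z. indicator {y. \<bar>y\<bar> \<le> c n} (x n + t n * z) \<partial>std_normal)
      \<longlonglongrightarrow> (\<integral>z. (0::real) \<partial>std_normal)"
  proof (rule integral_dominated_convergence[where w = "\<lambda>_. 1"])
    show "AE z in std_normal. (\<lambda>n. indicator {y. \<bar>y\<bar> \<le> c n} (x n + t n * z) :: real) \<longlonglongrightarrow> 0"
    proof (rule AE_I2, rule tendsto_eventually)
      fix z :: real
      have "filterlim (\<lambda>n. (t n * z - c n) + x n) at_top sequentially"
        by (rule filterlim_tendsto_add_at_top[OF tendsto_diff[OF
              tendsto_mult[OF assms(2) tendsto_const] assms(3)] assms(1)])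
      then have "eventually (\<lambda>n. 0 < (t n * z - c n) + x n) sequentially"
        by (simp add: filterlim_at_top_dense)
      then show "eventually (\<lambda>n. indicator {y. \<bar>y\<bar> \<le> c n} (x n + t n * z) = (0::real)) sequentially"
        by eventually_elim (auto simp: indicator_def)
    qed
  qed auto
  then show ?thesis by (simp add: core_mass_return)
qed

lemma moment_return_tendsto:
  fixes x t l r :: "nat \<Rightarrow> real"
  assumes x: "filterlim x at_top sequentially"
    and lim: "t \<longlonglongrightarrow> \<tau>" "l \<longlonglongrightarrow> l'" "r \<longlonglongrightarrow> r'" and pos: "\<And>n. 0 \<le> l n" "\<And>n. 0 \<le> r n"
  shows "(\<lambda>n. moment (return borel (x n)) (t n) (l n) (r n)) \<longlonglongrightarrow> (r' * l')\<^sup>2"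
proof -
  have conv: "(\<lambda>n. (r n * l n)\<^sup>2) \<longlonglongrightarrow> (r' * l')\<^sup>2"
    by (intro tendsto_intros lim)
  then have "Bseq (\<lambda>n. (r n * l n)\<^sup>2)"
    by (intro convergent_imp_Bseq convergentI)
  then obtain K where "\<And>n. norm ((r n * l n)\<^sup>2) \<le> K"
    by (auto simp: Bseq_def)
  then have K: "(r n * l n)\<^sup>2 \<le> K" for n by simp
  have "(\<lambda>n. \<integral>z. (Psi (l n) (x n + t n * z) (r n))\<^sup>2 \<partial>std_normal)
      \<longlonglongrightarrow> (\<integral>z. (r' * l')\<^sup>2 \<partial>std_normal)"
  proof (rule integral_dominated_convergence[where w = "\<lambda>_. K"])
    show "AE z in std_normal. (\<lambda>n. (Psi (l n) (x n + t n * z) (r n))\<^sup>2) \<longlonglongrightarrow> (r' * l')\<^sup>2"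
    proof (rule AE_I2, rule Lim_transform_eventually[OF conv])
      fix z :: real
      have "filterlim (\<lambda>n. (t n * z - l n * (1 + r n)) + x n) at_top sequentially"
        by (rule filterlim_tendsto_add_at_top[OF tendsto_diff[OF tendsto_mult[OF lim(1) tendsto_const]
              tendsto_mult[OF lim(2) tendsto_add[OF tendsto_const lim(3)]]] x])
      then have "eventually (\<lambda>n. 0 < (t n * z - l n * (1 + r n)) + x n) sequentially"
        by (simp add: filterlim_at_top_dense)
      then show "eventually (\<lambda>n. (r n * l n)\<^sup>2 = (Psi (l n) (x n + t n * z) (r n))\<^sup>2) sequentially"
      proof eventually_elim
        case (elim n)
        then have "l n \<le> (x n + t n * z) / (1 + r n)"
          using pos(2)[of n] by (simp add: field_simps)
        then have "psi (l n) ((x n + t n * z) / (1 + r n)) = l n"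
          using pos(1)[of n] by (simp add: psi_def)
        then show ?case by (simp add: Psi_def)
      qed
    qed
    show "AE z in std_normal. norm ((Psi (l n) (x n + t n * z) (r n))\<^sup>2) \<le> K" for n
      using order_trans[OF Psi_square_le K] by auto
  qed auto
  then show ?thesis
    using std_normal.prob_space by (simp add: moment_return)
qed

text \<open>With the contamination escaping to infinity, solutions with bounded \<open>\<tau>\<close> accumulate at a
  solution of the limit system; a bounded \<open>\<tau>\<close> forces a bounded \<open>r\<close>, because the contamination
  contributes at least a multiple of \<open>min (r l) (n r / (1 + r))\<^sup>2\<close> to \<open>\<tau>\<^sup>2\<close>.\<close>

lemma escaping_contamination_limit:
  fixes F :: "nat \<Rightarrow> real measure" and \<kappa> \<tau> r :: "nat \<Rightarrow> real"
  assumes F: "\<And>n. contaminated (F n) (return borel (real n)) \<epsilon>"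
    and m: "1 < m"
    and sol: "\<And>n. se_solution (F n) m (\<tau> n) (\<kappa> n * sqrt (1 + (\<tau> n)\<^sup>2)) (r n)"
    and \<kappa>: "0 < k1" "\<And>n. k1 \<le> \<kappa> n" "\<And>n. \<kappa> n \<le> k2"
    and \<tau>: "\<And>n. \<tau> n \<le> T"
  obtains \<kappa>' \<tau>' r' s where "strict_mono s" "(\<kappa> \<circ> s) \<longlonglongrightarrow> \<kappa>'" "(\<tau> \<circ> s) \<longlonglongrightarrow> \<tau>'"
    "limit_system m \<epsilon> \<kappa>' r'" "\<tau>'\<^sup>2 = (1 + \<tau>'\<^sup>2) * (V_bar (\<kappa>' * (1 + r')) \<epsilon> / m)"
proof -
  have eps: "0 < \<epsilon>" "\<epsilon> < 1" using F[of 0] by (auto simp: contaminated_def contaminated_axioms_def)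
  define l where "l = (\<lambda>n. \<kappa> n * sqrt (1 + (\<tau> n)\<^sup>2))"
  have \<tau>_pos: "0 < \<tau> n" and root: "root (F n) (\<tau> n) m (l n) (r n)"
    and fp: "(\<tau> n)\<^sup>2 = m * moment (F n) (\<tau> n) (l n) (r n)" for n
    using sol[of n] by (auto simp: se_solution_def l_def)
  have F_rd: "real_distribution (F n)" for n
    using F[of n] by (simp add: contaminated_def)
  have \<kappa>_pos: "0 < \<kappa> n" for n using \<kappa>(1) \<kappa>(2)[of n] by simp
  have r_pos: "0 < r n" for n using real_distribution.root_pos[OF F_rd root m] .
  have l_ge: "k1 \<le> l n" for n
  proof -
    have "\<kappa> n * 1 \<le> l n" unfolding l_def using \<kappa>_pos[of n] by (intro mult_left_mono) auto
    then show ?thesis using \<kappa>(2)[of n] by simp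
  qed
  have l_pos: "0 < l n" for n using l_ge[of n] \<kappa>(1) by simp
  have frac_ge: "1 / m \<le> r n / (1 + r n)" for n
    using real_distribution.root_ge[OF F_rd root m, of n] m r_pos[of n] by (simp add: field_simps)
  \<comment> \<open>Obtained by solving
    \<open>m * \<epsilon> * Psi\<^sup>2 / 2 \<le> T\<^sup>2\<close> for the score at the point
    mass.\<close>
  define K where "K = sqrt (2 * T\<^sup>2 / (m * \<epsilon>))"
  have "0 \<le> K" using m eps by (simp add: K_def)
  have min_le: "min (r n * l n) (r n / (1 + r n) * real n) \<le> K" for n
  proof -
    interpret contaminated "F n" "return borel (real n)" \<epsilon> by (rule F)
    have "\<epsilon> * ((Psi (l n) (real n) (r n))\<^sup>2 / 2) \<le> \<epsilon> * moment (return borel (real n)) (\<tau> n) (l n) (r n)"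
      using eps r_pos[of n] \<tau>_pos[of n] l_pos[of n] by (intro mult_left_mono moment_return_ge) auto
    also have "\<dots> \<le> moment (F n) (\<tau> n) (l n) (r n)"
      unfolding moment_contam using eps by simp
    finally have "m * (\<epsilon> * ((Psi (l n) (real n) (r n))\<^sup>2 / 2)) \<le> (\<tau> n)\<^sup>2"
      unfolding fp using m by (intro mult_left_mono) auto
    also have "\<dots> \<le> T\<^sup>2" using \<tau>[of n] \<tau>_pos[of n] by (intro power_mono) auto
    finally have "(Psi (l n) (real n) (r n))\<^sup>2 \<le> 2 * T\<^sup>2 / (m * \<epsilon>)"
      using m eps by (simp add: field_simps)
    then have "\<bar>Psi (l n) (real n) (r n)\<bar> \<le> K"
      unfolding K_def by (intro real_le_rsqrt) simp
    then show ?thesis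
      using abs_Psi[of "l n" "r n" "real n"] l_pos[of n] r_pos[of n] by simp
  qed
  \<comment> \<open>From \<open>N\<close> on, \<open>1 / m \<le> r / (1 + r)\<close> lifts the
    second entry of the minimum above \<open>K\<close>, so the first entry has to obey the
    bound.\<close>
  obtain N where N: "m * K < real N" using reals_Archimedean2 by blast
  have r_le: "r n \<le> K / k1" if "N \<le> n" for n
  proof -
    have "K < real n / m" using N that m by (simp add: field_simps)
    also have "\<dots> \<le> r n / (1 + r n) * real n"
      using mult_right_mono[OF frac_ge, of "real n" n] by simp
    finally have "r n * l n \<le> K" using min_le[of n] by linarith
    moreover have "r n * k1 \<le> r n * l n" using l_ge r_pos[of n] by (intro mult_left_mono) auto
    ultimately show ?thesis using \<kappa>(1) by (simp add: field_simps)
  qed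
  define S where "S = {k1..k2} \<times> {0..T} \<times> {0..K / k1}"
  have "compact S" unfolding S_def by (intro compact_Times compact_Icc)
  moreover have "(\<kappa> (n + N), \<tau> (n + N), r (n + N)) \<in> S" for n
    using \<kappa> \<tau> r_le[of "n + N"] less_imp_le[OF \<tau>_pos] less_imp_le[OF r_pos] by (simp add: S_def)
  ultimately obtain p f where p: "p \<in> S" "strict_mono f"
      "((\<lambda>n. (\<kappa> (n + N), \<tau> (n + N), r (n + N))) \<circ> f) \<longlonglongrightarrow> p"
    unfolding compact_eq_seq_compact_metric seq_compact_def by meson
  obtain \<kappa>' \<tau>' r' where p_eq: "p = (\<kappa>', \<tau>', r')" by (cases p) auto
  define s where "s = (\<lambda>n. f n + N)"
  have s: "strict_mono s" using p(2) by (auto simp: s_def strict_mono_def)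
  have lim: "(\<lambda>n. \<kappa> (s n)) \<longlonglongrightarrow> \<kappa>'" "(\<lambda>n. \<tau> (s n)) \<longlonglongrightarrow> \<tau>'" "(\<lambda>n. r (s n)) \<longlonglongrightarrow> r'"
    using tendsto_fst[OF p(3)] tendsto_fst[OF tendsto_snd[OF p(3)]] tendsto_snd[OF tendsto_snd[OF p(3)]]
    by (simp_all add: p_eq s_def comp_def)
  have \<kappa>': "0 < \<kappa>'" and r'0: "0 \<le> r'" using p(1) \<kappa>(1) by (auto simp: S_def p_eq)
  have x: "filterlim (\<lambda>n. real (s n)) at_top sequentially"
    by (rule filterlim_compose[OF filterlim_real_sequentially filterlim_subseq[OF s]])
  define l' where "l' = \<kappa>' * sqrt (1 + \<tau>'\<^sup>2)"
  have lim_l: "(\<lambda>n. l (s n)) \<longlonglongrightarrow> l'"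
    unfolding l_def l'_def by (intro tendsto_intros lim)
  have lim_frac: "(\<lambda>n. r (s n) / (1 + r (s n))) \<longlonglongrightarrow> r' / (1 + r')"
    using r'0 by (intro tendsto_intros lim) auto
  have lim_u: "(\<lambda>n. \<kappa> (s n) * (1 + r (s n))) \<longlonglongrightarrow> \<kappa>' * (1 + r')"
    by (intro tendsto_intros lim)
  have u_nonneg: "0 \<le> \<kappa> n * (1 + r n)" for n
    using \<kappa>_pos[of n] r_pos[of n] by simp
  have mass_eq: "1 / m = r n / (1 + r n) * (B_bar (\<kappa> n * (1 + r n)) \<epsilon>
      + \<epsilon> * core_mass (return borel (real n)) (\<tau> n) (l n * (1 + r n)))" for n
  proof -
    interpret contaminated "F n" "return borel (real n)" \<epsilon> by (rule F)
    have "sqrt (1 + (\<tau> n)\<^sup>2) \<noteq> 0" by (simp add: add_nonneg_eq_0_iff)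
    then have "l n * (1 + r n) / sqrt (1 + (\<tau> n)\<^sup>2) = \<kappa> n * (1 + r n)"
      by (simp add: l_def)
    then show ?thesis
      using root[of n] l_pos[of n] r_pos[of n] by (simp add: root_def core_mass_contam B_bar_def)
  qed
  have "(\<lambda>n. r (s n) / (1 + r (s n)) * (B_bar (\<kappa> (s n) * (1 + r (s n))) \<epsilon>
      + \<epsilon> * core_mass (return borel (real (s n))) (\<tau> (s n)) (l (s n) * (1 + r (s n)))))
      \<longlonglongrightarrow> r' / (1 + r') * (B_bar (\<kappa>' * (1 + r')) \<epsilon> + \<epsilon> * 0)"
  proof (intro tendsto_mult tendsto_add tendsto_const lim_frac)
    show "(\<lambda>n. B_bar (\<kappa> (s n) * (1 + r (s n))) \<epsilon>) \<longlonglongrightarrow> B_bar (\<kappa>' * (1 + r')) \<epsilon>"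
      by (rule continuous_on_tendsto_compose[OF continuous_on_B_bar[of UNIV] lim_u]) auto
    show "(\<lambda>n. core_mass (return borel (real (s n))) (\<tau> (s n)) (l (s n) * (1 + r (s n)))) \<longlonglongrightarrow> 0"
      by (rule core_mass_return_tendsto_0[OF x lim(2)
            tendsto_mult[OF lim_l tendsto_add[OF tendsto_const lim(3)]]])
  qed
  then have B_eq: "1 / m = r' / (1 + r') * B_bar (\<kappa>' * (1 + r')) \<epsilon>"
    unfolding mass_eq[symmetric] by (simp add: LIMSEQ_const_iff)
  \<comment> \<open>The compact box contains \<open>r' = 0\<close>; the positive value
    \<open>1 / m\<close> in the limit equation excludes it.\<close>
  have "r' \<noteq> 0" using B_eq m by auto
  then have ls: "limit_system m \<epsilon> \<kappa>' r'"
    using \<kappa>' r'0 B_eq by (simp add: limit_system_def)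
  have fp_eq: "(\<tau> n)\<^sup>2 = m * ((1 - \<epsilon>) * ((1 + (\<tau> n)\<^sup>2) * (r n / (1 + r n))\<^sup>2
      * (\<integral>z. (psi (\<kappa> n * (1 + r n)) z)\<^sup>2 \<partial>std_normal))
      + \<epsilon> * moment (return borel (real n)) (\<tau> n) (l n) (r n))" for n
  proof -
    interpret contaminated "F n" "return borel (real n)" \<epsilon> by (rule F)
    show ?thesis
      using fp[of n] r_pos[of n] moment_contam_scaled[of "r n" "\<tau> n" "\<kappa> n"] by (simp add: l_def)
  qed
  have "(\<lambda>n. m * ((1 - \<epsilon>) * ((1 + (\<tau> (s n))\<^sup>2) * (r (s n) / (1 + r (s n)))\<^sup>2
      * (\<integral>z. (psi (\<kappa> (s n) * (1 + r (s n))) z)\<^sup>2 \<partial>std_normal))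
      + \<epsilon> * moment (return borel (real (s n))) (\<tau> (s n)) (l (s n)) (r (s n))))
    \<longlonglongrightarrow> m * ((1 - \<epsilon>) * ((1 + \<tau>'\<^sup>2) * (r' / (1 + r'))\<^sup>2
      * (\<integral>z. (psi (\<kappa>' * (1 + r')) z)\<^sup>2 \<partial>std_normal)) + \<epsilon> * (r' * l')\<^sup>2)"
  proof (intro tendsto_mult tendsto_add tendsto_const tendsto_power lim_frac lim)
    show "(\<lambda>n. \<integral>z. (psi (\<kappa> (s n) * (1 + r (s n))) z)\<^sup>2 \<partial>std_normal)
        \<longlonglongrightarrow> (\<integral>z. (psi (\<kappa>' * (1 + r')) z)\<^sup>2 \<partial>std_normal)"
      by (rule continuous_on_tendsto_compose[OF continuous_on_integral_psi_square lim_u])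
        (use \<kappa>' r'0 u_nonneg in auto)
    show "(\<lambda>n. moment (return borel (real (s n))) (\<tau> (s n)) (l (s n)) (r (s n))) \<longlonglongrightarrow> (r' * l')\<^sup>2"
      by (rule moment_return_tendsto[OF x lim(2) lim_l lim(3)]) (auto intro: less_imp_le l_pos r_pos)
  qed
  then have "(\<lambda>n. (\<tau> (s n))\<^sup>2) \<longlonglongrightarrow> m * ((1 - \<epsilon>) * ((1 + \<tau>'\<^sup>2) * (r' / (1 + r'))\<^sup>2
      * (\<integral>z. (psi (\<kappa>' * (1 + r')) z)\<^sup>2 \<partial>std_normal)) + \<epsilon> * (r' * l')\<^sup>2)"
    unfolding fp_eq[symmetric] .
  moreover have "(\<lambda>n. (\<tau> (s n))\<^sup>2) \<longlonglongrightarrow> \<tau>'\<^sup>2"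
    by (intro tendsto_intros lim)
  ultimately have "\<tau>'\<^sup>2 = m * ((1 - \<epsilon>) * ((1 + \<tau>'\<^sup>2) * (r' / (1 + r'))\<^sup>2
      * (\<integral>z. (psi (\<kappa>' * (1 + r')) z)\<^sup>2 \<partial>std_normal)) + \<epsilon> * (r' * l')\<^sup>2)"
    by (rule LIMSEQ_unique[rotated])
  \<comment> \<open>In noise units the saturated contamination contributes the square of the cap,
    which is the contamination term of \<open>A_bar\<close>.\<close>
  also have "(r' * l')\<^sup>2 = (1 + \<tau>'\<^sup>2) * (r' / (1 + r'))\<^sup>2 * (\<kappa>' * (1 + r'))\<^sup>2"
    using r'0 by (simp add: l'_def power_mult_distrib power_divide)
  finally have "\<tau>'\<^sup>2 = (1 + \<tau>'\<^sup>2) * (m * ((r' / (1 + r'))\<^sup>2 * A_bar (\<kappa>' * (1 + r')) \<epsilon>))"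
    by (simp add: A_bar_def algebra_simps)
  then have "\<tau>'\<^sup>2 = (1 + \<tau>'\<^sup>2) * (V_bar (\<kappa>' * (1 + r')) \<epsilon> / m)"
    unfolding limit_system_V_bar[OF ls eps(2) m] .
  then show ?thesis
    using that[OF s _ _ ls] lim by (simp add: comp_def)
qed


section \<open>The two minimax problems\<close>

lemma contam_contaminated:
  assumes "F \<in> contam \<epsilon>" "0 < \<epsilon>" "\<epsilon> < 1"
  obtains H where "contaminated F H \<epsilon>"
  using assms by (elim contamE) (auto simp: contaminated_def contaminated_axioms_def)

lemma escaping_contamination:
  assumes "0 < \<epsilon>" "\<epsilon> < 1"
  obtains F where "\<And>n. F n \<in> contam \<epsilon>" "\<And>n. contaminated (F n) (return borel (real n)) \<epsilon>"
proof -
  have "\<exists>F. F \<in> contam \<epsilon> \<and> contaminated F (return borel (real n)) \<epsilon>" for n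
    by (rule contam_mixture_exists[OF _ _ real_distribution_return, of \<epsilon> "real n"])
      (use assms real_distribution_return in \<open>auto simp: contaminated_def contaminated_axioms_def\<close>)
  then show ?thesis using that by metis
qed

section \<open>The limit system parametrized by the cap\<close>

lemma limit_system_of_cap:
  assumes "0 < u" "1 < m * B_bar u \<epsilon>" "0 < m"
  defines "\<kappa> \<equiv> u * (1 - 1 / (m * B_bar u \<epsilon>))" and "r \<equiv> 1 / (m * B_bar u \<epsilon> - 1)"
  shows "limit_system m \<epsilon> \<kappa> r" "\<kappa> * (1 + r) = u"
proof -
  define b where "b = m * B_bar u \<epsilon>"
  have b: "1 < b" "B_bar u \<epsilon> = b / m" using assms by (auto simp: b_def)
  have \<kappa>: "\<kappa> = u * ((b - 1) / b)" and r: "1 + r = b / (b - 1)" "r = 1 / (b - 1)"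
    using b(1) unfolding \<kappa>_def r_def b_def[symmetric] by (simp_all add: field_simps)
  show u: "\<kappa> * (1 + r) = u" unfolding \<kappa> r(1) using b(1) by simp
  have "r / (1 + r) = 1 / b" unfolding r(1) unfolding r(2) using b by simp
  then show "limit_system m \<epsilon> \<kappa> r"
    unfolding limit_system_def u b(2) using b assms(1) by (auto simp: \<kappa> r(2))
qed

text \<open>The equation amounts to \<open>m * B = (1 + r) / r\<close>. Together with the converse
  construction, solutions \<open>(\<kappa>, r)\<close> correspond one to one to positive caps with
  \<open>1 < m * B\<close>.\<close>

lemma limit_system_cap:
  assumes "limit_system m \<epsilon> \<kappa> r" "1 < m" "\<epsilon> < 1"
  shows "1 < m * B_bar (\<kappa> * (1 + r)) \<epsilon>"
    "\<kappa> = \<kappa> * (1 + r) * (1 - 1 / (m * B_bar (\<kappa> * (1 + r)) \<epsilon>))"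
proof -
  define B where "B = B_bar (\<kappa> * (1 + r)) \<epsilon>"
  have \<kappa>: "0 < \<kappa>" and r: "0 < r" and eq: "r / (1 + r) * B = 1 / m"
    using assms(1) by (auto simp: limit_system_def B_def)
  then have "m * B * r = 1 + r" using assms(2) by (simp add: field_simps)
  then have mB: "m * B = (1 + r) / r" using r by (simp add: field_simps)
  show "1 < m * B_bar (\<kappa> * (1 + r)) \<epsilon>" "\<kappa> = \<kappa> * (1 + r) * (1 - 1 / (m * B_bar (\<kappa> * (1 + r)) \<epsilon>))"
    unfolding B_def[symmetric] mB using r by (simp_all add: field_simps)
qed

lemma limit_system_unique:
  assumes "limit_system m \<epsilon> \<kappa> r" "limit_system m \<epsilon> \<kappa> r'" "\<epsilon> < 1"
  shows "r = r'"
proof -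
  have less: "a / (1 + a) * B_bar (\<kappa> * (1 + a)) \<epsilon> < b / (1 + b) * B_bar (\<kappa> * (1 + b)) \<epsilon>"
    if "0 < a" "a < b" for a b
  proof -
    have \<kappa>: "0 < \<kappa>" using assms(1) by (simp add: limit_system_def)
    have "a / (1 + a) * B_bar (\<kappa> * (1 + a)) \<epsilon> < a / (1 + a) * B_bar (\<kappa> * (1 + b)) \<epsilon>"
      using that \<kappa> assms(3) by (intro mult_strict_left_mono B_bar_strict_mono) auto
    also have "\<dots> \<le> b / (1 + b) * B_bar (\<kappa> * (1 + b)) \<epsilon>"
      using that \<kappa> assms(3) B_bar_pos[of \<epsilon> "\<kappa> * (1 + b)"] by (intro mult_right_mono frac_mono) auto
    finally show ?thesis .
  qed
  show ?thesis
    using less[of r r'] less[of r' r] assms(1,2)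
    by (cases r r' rule: linorder_cases) (auto simp: limit_system_def)
qed

lemma r_bar_eq:
  assumes "limit_system m \<epsilon> \<kappa> r" "\<epsilon> < 1"
  shows "r_bar m \<epsilon> \<kappa> = r"
  unfolding r_bar_def
proof (rule the_equality)
  show "0 < r \<and> r / (1 + r) * B_bar (\<kappa> * (1 + r)) \<epsilon> = 1 / m"
    using assms by (simp add: limit_system_def)
  show "r' = r" if "0 < r' \<and> r' / (1 + r') * B_bar (\<kappa> * (1 + r')) \<epsilon> = 1 / m" for r'
    using limit_system_unique[OF _ assms(1,2)] assms(1) that by (simp add: limit_system_def)
qed

lemma limit_system_exists:
  assumes "\<epsilon> < 1" "1 < m" "0 < \<kappa>" "0 < u" "1 < m * B_bar u \<epsilon>"
  obtains r where "limit_system m \<epsilon> \<kappa> r"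
proof -
  define b where "b = m * B_bar u \<epsilon>"
  \<comment> \<open>The first entry makes \<open>R / (1 + R)\<close> at least \<open>1 / b\<close>,
    the second makes the cap \<open>\<kappa> * (1 + R)\<close> at least \<open>u\<close>; the
    product then reaches \<open>1 / m\<close>.\<close>
  define R where "R = max (1 / (b - 1)) (u / \<kappa>)"
  have b: "1 < b" using assms by (simp add: b_def)
  have R: "1 / (b - 1) \<le> R" "u / \<kappa> \<le> R" by (auto simp: R_def)
  have R_pos: "0 < R" using R(1) b by (meson less_le_trans zero_less_divide_1_iff diff_gt_0_iff_gt)
  have "1 / b \<le> R / (1 + R)"
    using R(1) b R_pos by (simp add: field_simps)
  have "u \<le> \<kappa> * (1 + R)"
    using R(2) assms(3) by (simp add: field_simps)
  then have B: "B_bar u \<epsilon> \<le> B_bar (\<kappa> * (1 + R)) \<epsilon>"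
    using B_bar_strict_mono[OF assms(1), of u "\<kappa> * (1 + R)"] by (cases "u = \<kappa> * (1 + R)") auto
  have "1 / m = 1 / b * B_bar u \<epsilon>"
    using B_bar_pos[OF assms(1,4)] assms(2) by (simp add: b_def)
  also have "\<dots> \<le> R / (1 + R) * B_bar (\<kappa> * (1 + R)) \<epsilon>"
    using \<open>1 / b \<le> R / (1 + R)\<close> B b R_pos B_bar_pos[OF assms(1,4)] by (intro mult_mono) auto
  finally have upper: "1 / m \<le> R / (1 + R) * B_bar (\<kappa> * (1 + R)) \<epsilon>" .
  have "continuous_on {0..R} (\<lambda>r. r / (1 + r) * B_bar (\<kappa> * (1 + r)) \<epsilon>)"
    by (intro continuous_intros continuous_on_compose2[OF continuous_on_B_bar[of UNIV]]) auto
  then have "\<exists>r\<ge>0. r \<le> R \<and> r / (1 + r) * B_bar (\<kappa> * (1 + r)) \<epsilon> = 1 / m"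
    using upper R_pos assms(2) by (intro IVT') auto
  then obtain r where "0 \<le> r" "r / (1 + r) * B_bar (\<kappa> * (1 + r)) \<epsilon> = 1 / m" by auto
  moreover from this have "r \<noteq> 0" using assms(2) by auto
  ultimately show ?thesis
    using that[of r] assms(3) by (simp add: limit_system_def)
qed

text \<open>Two definite descriptions are nested. For a competing \<open>\<kappa>\<close> the
  equation of \<open>r_bar\<close> must be known to be solvable before its value says anything;
  after that the common cap determines \<open>\<kappa>\<close>.\<close>

lemma kappa_under_star_limit_system:
  assumes "0 < \<epsilon>" "\<epsilon> < 1" "1 < m" "1 < m * B_bar (kappa_star \<epsilon>) \<epsilon>"
  obtains r where "limit_system m \<epsilon> (kappa_under_star m \<epsilon>) r"
    "kappa_under_star m \<epsilon> * (1 + r) = kappa_star \<epsilon>"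
proof -
  define u where "u = kappa_star \<epsilon>"
  have u: "0 < u" "1 < m * B_bar u \<epsilon>"
    using assms kappa_star_pos by (auto simp: u_def)
  define \<kappa>0 where "\<kappa>0 = u * (1 - 1 / (m * B_bar u \<epsilon>))"
  obtain r where r: "limit_system m \<epsilon> \<kappa>0 r" "\<kappa>0 * (1 + r) = u"
    using limit_system_of_cap[OF u] assms by (auto simp: \<kappa>0_def)
  have "kappa_under_star m \<epsilon> = \<kappa>0"
    unfolding kappa_under_star_def u_def[symmetric]
  proof (rule the_equality)
    show "0 < \<kappa>0 \<and> \<kappa>0 * (1 + r_bar m \<epsilon> \<kappa>0) = u"
      using r r_bar_eq[OF r(1) assms(2)] by (auto simp: limit_system_def)
    fix \<kappa> assume \<kappa>: "0 < \<kappa> \<and> \<kappa> * (1 + r_bar m \<epsilon> \<kappa>) = u"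
    obtain r' where r': "limit_system m \<epsilon> \<kappa> r'"
      using limit_system_exists[OF assms(2,3) _ u] \<kappa> by blast
    then have "\<kappa> * (1 + r') = u"
      using \<kappa> r_bar_eq[OF r' assms(2)] by simp
    then show "\<kappa> = \<kappa>0"
      using limit_system_cap(2)[OF r' assms(3,2)] by (simp add: \<kappa>0_def)
  qed
  then show ?thesis using that r by (simp add: u_def)
qed

section \<open>Worst cases in the two parametrizations\<close>

locale unique_state_evolution =
  fixes \<epsilon> m :: real
  assumes eps: "0 < \<epsilon>" "\<epsilon> < 1"
    and m: "1 < m"
    and unique_fixed_point:
      "\<And>\<kappa> F s t. 0 < \<kappa> \<Longrightarrow> F \<in> contam \<epsilon> \<Longrightarrow>
         is_fixed_point m \<kappa> F s \<Longrightarrow> is_fixed_point m \<kappa> F t \<Longrightarrow> s = t"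
begin

abbreviation worst_float :: "real \<Rightarrow> ereal" where
  "worst_float \<kappa> \<equiv> SUP F\<in>contam \<epsilon>. V_float m \<kappa> F"

abbreviation worst_huber :: "real \<Rightarrow> ereal" where
  "worst_huber l \<equiv> SUP F\<in>contam \<epsilon>. V_huber m l F"

lemma tau2_inf_eq:
  assumes "0 < \<kappa>" "F \<in> contam \<epsilon>" "is_fixed_point m \<kappa> F t"
  shows "tau2_inf m \<kappa> F = t"
  unfolding tau2_inf_def using assms unique_fixed_point by (intro the_equality) auto

lemma V_float_eq:
  assumes "0 < \<kappa>" "F \<in> contam \<epsilon>" "is_fixed_point m \<kappa> F t"
  shows "V_float m \<kappa> F = ereal (m * t)"
  using assms tau2_inf_eq[OF assms] by (auto simp: V_float_def)

lemma lambda_inf_eq: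
  assumes "0 < \<kappa>" "F \<in> contam \<epsilon>" "is_fixed_point m \<kappa> F t"
  shows "lambda_inf m \<kappa> F = ereal (\<kappa> * sqrt (1 + t))"
  using assms tau2_inf_eq[OF assms] by (auto simp: lambda_inf_def)

lemma V_float_nonneg:
  assumes "0 < \<kappa>" "F \<in> contam \<epsilon>"
  shows "0 \<le> V_float m \<kappa> F"
proof (cases "\<exists>t. is_fixed_point m \<kappa> F t")
  case True
  then obtain t where t: "is_fixed_point m \<kappa> F t" by blast
  then show ?thesis using V_float_eq[OF assms t] m by (simp add: is_fixed_point_def)
qed (simp add: V_float_def)

text \<open>A solution for the constant threshold \<open>l\<close> yields
  \<open>\<kappa> = l / sqrt (1 + \<tau>\<^sup>2)\<close>, so the infinite branch of
  \<open>V_huber\<close> does not occur. Any other \<open>\<kappa>'\<close> calibrated to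
  \<open>l\<close> gives a solution with the same threshold, hence the same
  \<open>\<tau>\<close>.\<close>

lemma V_huber_eq:
  assumes "0 < l" "F \<in> contam \<epsilon>"
  obtains \<kappa> t where "0 < \<kappa>" "is_fixed_point m \<kappa> F t" "\<kappa> * sqrt (1 + t) = l"
    "lambda_inf m \<kappa> F = ereal l" "V_huber m l F = ereal (m * t)"
proof -
  obtain H where "contaminated F H \<epsilon>"
    using contam_contaminated[OF assms(2) eps] .
  then interpret contaminated F H \<epsilon> .
  obtain \<tau> r where sol: "se_solution F m \<tau> l r"
    using se_solution_exists_const[OF m assms(1)] .
  then have \<tau>: "0 < \<tau>" by (simp add: se_solution_def)
  have s: "0 < sqrt (1 + \<tau>\<^sup>2)" by (simp add: add_pos_nonneg)
  define \<kappa> where "\<kappa> = l / sqrt (1 + \<tau>\<^sup>2)"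
  have \<kappa>: "0 < \<kappa>" "\<kappa> * sqrt (1 + \<tau>\<^sup>2) = l"
    using assms s by (auto simp: \<kappa>_def)
  have fp: "is_fixed_point m \<kappa> F (\<tau>\<^sup>2)"
    unfolding fixed_point_iff[OF \<kappa>(1) m] \<kappa>(2) using \<tau> sol by auto
  have lam: "lambda_inf m \<kappa> F = ereal l"
    using lambda_inf_eq[OF \<kappa>(1) assms(2) fp] \<kappa>(2) by simp
  have "kappa_inf m l F = \<kappa>"
    unfolding kappa_inf_def
  proof (rule the_equality)
    show "0 < \<kappa> \<and> lambda_inf m \<kappa> F = ereal l" using \<kappa> lam by simp
    fix \<kappa>' assume \<kappa>': "0 < \<kappa>' \<and> lambda_inf m \<kappa>' F = ereal l"
    then obtain t where t: "is_fixed_point m \<kappa>' F t"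
      by (auto simp: lambda_inf_def split: if_splits)
    then have l: "\<kappa>' * sqrt (1 + t) = l"
      using lambda_inf_eq[of \<kappa>' F t] \<kappa>' assms(2) by simp
    obtain r' where "0 < t" "se_solution F m (sqrt t) l r'"
      using t \<kappa>' unfolding fixed_point_iff[OF conjunct1[OF \<kappa>'] m] l by blast
    then have "sqrt t = \<tau>"
      using se_solution_unique[OF _ sol m assms(1)] by blast
    then have "t = \<tau>\<^sup>2" using \<open>0 < t\<close> by auto
    then show "\<kappa>' = \<kappa>" using l s by (auto simp: \<kappa>_def)
  qed
  then have "V_huber m l F = ereal (m * \<tau>\<^sup>2)"
    using V_float_eq[OF \<kappa>(1) assms(2) fp] \<kappa>(1) lam by (auto simp: V_huber_def)
  then show ?thesis using that \<kappa> fp lam by blast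
qed

lemma worst_float_le:
  assumes "limit_system m \<epsilon> \<kappa> r" "V_bar (\<kappa> * (1 + r)) \<epsilon> < m"
  shows "worst_float \<kappa> \<le> ereal (m * (V_bar (\<kappa> * (1 + r)) \<epsilon> / (m - V_bar (\<kappa> * (1 + r)) \<epsilon>)))"
proof (rule SUP_least)
  fix F assume F: "F \<in> contam \<epsilon>"
  have \<kappa>: "0 < \<kappa>" using assms(1) by (simp add: limit_system_def)
  obtain H where "contaminated F H \<epsilon>"
    using contam_contaminated[OF F eps] .
  then interpret contaminated F H \<epsilon> .
  obtain t where t: "is_fixed_point m \<kappa> F t"
    using fixed_point_bound(1)[OF assms(1) m assms(2)] by blast
  have "m * t \<le> m * (V_bar (\<kappa> * (1 + r)) \<epsilon> / (m - V_bar (\<kappa> * (1 + r)) \<epsilon>))"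
    using fixed_point_bound(2)[OF assms(1) m assms(2) t] m by (intro mult_left_mono) auto
  then show "V_float m \<kappa> F \<le> ereal (m * (V_bar (\<kappa> * (1 + r)) \<epsilon> / (m - V_bar (\<kappa> * (1 + r)) \<epsilon>)))"
    unfolding V_float_eq[OF \<kappa> F t] by (simp only: ereal_less_eq)
qed

text \<open>The common core of both comparisons: \<open>\<kappa>\<close> is constant in one application and
  \<open>\<kappa> \<surd>(1 + t)\<close> in the other.\<close>

lemma escaping_fixed_points:
  fixes F :: "nat \<Rightarrow> real measure" and \<kappa> t :: "nat \<Rightarrow> real"
  assumes F: "\<And>n. contaminated (F n) (return borel (real n)) \<epsilon>"
    and fp: "\<And>n. is_fixed_point m (\<kappa> n) (F n) (t n)"
    and \<kappa>: "0 < k1" "\<And>n. k1 \<le> \<kappa> n" "\<And>n. \<kappa> n \<le> k2"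
    and t: "\<And>n. m * t n \<le> v"
  obtains \<kappa>' r s where "strict_mono s" "(\<kappa> \<circ> s) \<longlonglongrightarrow> \<kappa>'" "limit_system m \<epsilon> \<kappa>' r"
    "V_bar (\<kappa>' * (1 + r)) \<epsilon> < m"
    "m * (V_bar (\<kappa>' * (1 + r)) \<epsilon> / (m - V_bar (\<kappa>' * (1 + r)) \<epsilon>)) \<le> v"
proof -
  have \<kappa>_pos: "0 < \<kappa> n" for n using \<kappa>(1) \<kappa>(2)[of n] by simp
  have "\<exists>r. 0 < t n \<and> se_solution (F n) m (sqrt (t n)) (\<kappa> n * sqrt (1 + (sqrt (t n))\<^sup>2)) r" for n
    using fp[of n] unfolding contaminated.fixed_point_iff[OF F \<kappa>_pos m] by auto
  then obtain r where t_pos: "\<And>n. 0 < t n"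
    and sol: "\<And>n. se_solution (F n) m (sqrt (t n)) (\<kappa> n * sqrt (1 + (sqrt (t n))\<^sup>2)) (r n)"
    by metis
  have bound: "sqrt (t n) \<le> sqrt (v / m)" for n
    using t[of n] m by (simp add: field_simps)
  obtain \<kappa>' \<tau>' r' s where s: "strict_mono s" "(\<kappa> \<circ> s) \<longlonglongrightarrow> \<kappa>'"
      "((\<lambda>n. sqrt (t n)) \<circ> s) \<longlonglongrightarrow> \<tau>'" "limit_system m \<epsilon> \<kappa>' r'"
      "\<tau>'\<^sup>2 = (1 + \<tau>'\<^sup>2) * (V_bar (\<kappa>' * (1 + r')) \<epsilon> / m)"
    using escaping_contamination_limit[OF F m sol \<kappa> bound] .
  define W where "W = V_bar (\<kappa>' * (1 + r')) \<epsilon>"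
  have "0 < W"
    using V_bar_pos[OF eps] s(4) by (simp add: W_def limit_system_def)
  have eq: "\<tau>'\<^sup>2 * (m - W) = W"
    using s(5) m by (simp add: W_def field_simps)
  have "W < m"
    using eq \<open>0 < W\<close> by (metis diff_gt_0_iff_gt zero_le_power2 zero_less_mult_pos le_less mult_zero_left)
  have "(\<lambda>n. m * (sqrt (t (s n)))\<^sup>2) \<longlonglongrightarrow> m * \<tau>'\<^sup>2"
    using s(3) by (intro tendsto_intros) (simp add: comp_def)
  moreover have "m * (sqrt (t (s n)))\<^sup>2 \<le> v" for n
    using t[of "s n"] t_pos[of "s n"] by simp
  ultimately have "m * \<tau>'\<^sup>2 \<le> v"
    using LIMSEQ_le_const2 by blast
  moreover have "\<tau>'\<^sup>2 = W / (m - W)"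
    using eq \<open>W < m\<close> by (simp add: field_simps)
  ultimately show ?thesis
    using that[OF s(1,2,4)] \<open>W < m\<close> by (simp add: W_def)
qed

lemma worst_float_finite:
  assumes "0 < \<kappa>" "worst_float \<kappa> < \<infinity>"
  obtains v where "worst_float \<kappa> = ereal v" "0 \<le> v"
    "\<And>F. F \<in> contam \<epsilon> \<Longrightarrow> \<exists>t. is_fixed_point m \<kappa> F t \<and> m * t \<le> v"
proof -
  obtain F0 where "F0 \<in> contam \<epsilon>"
    using escaping_contamination[OF eps] by blast
  then have "0 \<le> worst_float \<kappa>"
    using V_float_nonneg[OF assms(1)] by (meson SUP_upper2)
  with assms(2) obtain v where v: "worst_float \<kappa> = ereal v" "0 \<le> v"
    by (cases "worst_float \<kappa>") auto
  have "\<exists>t. is_fixed_point m \<kappa> F t \<and> m * t \<le> v" if F: "F \<in> contam \<epsilon>" for F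
  proof -
    have le: "V_float m \<kappa> F \<le> ereal v"
      unfolding v(1)[symmetric] by (rule SUP_upper[OF F])
    then obtain t where t: "is_fixed_point m \<kappa> F t"
      by (auto simp: V_float_def split: if_splits)
    then show ?thesis using le V_float_eq[OF assms(1) F t] by auto
  qed
  with v show ?thesis using that by blast
qed

text \<open>With constant \<open>\<kappa>\<close> the accumulation point is \<open>\<kappa>\<close>
  itself. A finite worst case thus forces a solvable limit system with \<open>V_bar < m\<close>, and
  the bound matches \<open>worst_float_le\<close>.\<close>

lemma worst_float_limit_system:
  assumes "0 < \<kappa>" "worst_float \<kappa> < \<infinity>"
  obtains r where "limit_system m \<epsilon> \<kappa> r" "V_bar (\<kappa> * (1 + r)) \<epsilon> < m"
    "ereal (m * (V_bar (\<kappa> * (1 + r)) \<epsilon> / (m - V_bar (\<kappa> * (1 + r)) \<epsilon>))) \<le> worst_float \<kappa>"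
proof -
  obtain v where v: "worst_float \<kappa> = ereal v"
    "\<And>F. F \<in> contam \<epsilon> \<Longrightarrow> \<exists>t. is_fixed_point m \<kappa> F t \<and> m * t \<le> v"
    using worst_float_finite[OF assms] by metis
  obtain F where F: "\<And>n. F n \<in> contam \<epsilon>" "\<And>n. contaminated (F n) (return borel (real n)) \<epsilon>"
    using escaping_contamination[OF eps] by blast
  obtain t where t: "\<And>n. is_fixed_point m \<kappa> (F n) (t n)" "\<And>n. m * t n \<le> v"
    using v(2)[OF F(1)] by metis
  obtain \<kappa>' r and s :: "nat \<Rightarrow> nat" where lim: "strict_mono s" "((\<lambda>n. \<kappa>) \<circ> s) \<longlonglongrightarrow> \<kappa>'" "limit_system m \<epsilon> \<kappa>' r"
    "V_bar (\<kappa>' * (1 + r)) \<epsilon> < m"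
    "m * (V_bar (\<kappa>' * (1 + r)) \<epsilon> / (m - V_bar (\<kappa>' * (1 + r)) \<epsilon>)) \<le> v"
    using escaping_fixed_points[where \<kappa> = "\<lambda>_. \<kappa>", OF F(2) t(1) assms(1) order_refl order_refl t(2)] .
  have "\<kappa>' = \<kappa>" using lim(2) by (simp add: comp_def LIMSEQ_const_iff)
  then show ?thesis using that[of r] lim v(1) by simp
qed

text \<open>Monotonicity is available only strictly below \<open>kappa_plus\<close>, so the supremum
  must not be attained. A slightly larger cap still has \<open>V_bar < m\<close>, and it belongs to
  a larger \<open>\<kappa>\<close> because \<open>u * (1 - 1 / (m * B_bar u \<epsilon>))\<close>
  increases.\<close>

lemma kappa_less_kappa_plus:
  assumes "0 < \<kappa>" "worst_float \<kappa> < \<infinity>"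
  shows "ereal \<kappa> < kappa_plus m \<epsilon>"
proof -
  obtain r where r: "limit_system m \<epsilon> \<kappa> r" "V_bar (\<kappa> * (1 + r)) \<epsilon> < m"
    using worst_float_limit_system[OF assms] .
  define u where "u = \<kappa> * (1 + r)"
  have u: "0 < u" "1 < m * B_bar u \<epsilon>" "\<kappa> = u * (1 - 1 / (m * B_bar u \<epsilon>))" "V_bar u \<epsilon> < m"
    using r limit_system_cap[OF r(1) m eps(2)] by (auto simp: u_def limit_system_def)
  have "isCont (\<lambda>u. V_bar u \<epsilon>) u"
    by (rule DERIV_isCont[OF V_bar_has_real_derivative[OF eps(2) u(1)]])
  then have "eventually (\<lambda>v. V_bar v \<epsilon> < m) (at u)"
    unfolding isCont_def using u(4) by (rule order_tendstoD(2))
  then obtain d where d: "0 < d" "\<And>v. v \<noteq> u \<Longrightarrow> dist v u < d \<Longrightarrow> V_bar v \<epsilon> < m"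
    unfolding eventually_at by auto
  define u' where "u' = u + d / 2"
  have u': "u < u'" "V_bar u' \<epsilon> < m"
    using d(1) d(2)[of u'] by (auto simp: u'_def dist_real_def)
  have B: "B_bar u \<epsilon> < B_bar u' \<epsilon>"
    by (rule B_bar_strict_mono[OF eps(2) u'(1)])
  then have mB: "m * B_bar u \<epsilon> < m * B_bar u' \<epsilon>" using m by simp
  define \<kappa>' where "\<kappa>' = u' * (1 - 1 / (m * B_bar u' \<epsilon>))"
  obtain r' where r': "limit_system m \<epsilon> \<kappa>' r'" "\<kappa>' * (1 + r') = u'"
    using limit_system_of_cap[of u' m \<epsilon>] u u' mB m by (auto simp: \<kappa>'_def)
  have "worst_float \<kappa>' \<le> ereal (m * (V_bar u' \<epsilon> / (m - V_bar u' \<epsilon>)))"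
    using worst_float_le[OF r'(1)] r'(2) u'(2) by simp
  then have "worst_float \<kappa>' < \<infinity>"
    by (rule le_less_trans) simp
  then have "ereal \<kappa>' \<le> kappa_plus m \<epsilon>"
    unfolding kappa_plus_def using r'(1) by (intro Sup_upper) (auto simp: limit_system_def)
  moreover have "\<kappa> < \<kappa>'"
    unfolding u(3) \<kappa>'_def
  proof (rule mult_strict_mono)
    show "1 - 1 / (m * B_bar u \<epsilon>) < 1 - 1 / (m * B_bar u' \<epsilon>)"
      using u(2) mB by (simp add: frac_less2)
  qed (use u u' in auto)
  ultimately show ?thesis by (meson less_le_trans less_ereal.simps(1))
qed

text \<open>A finite worst case \<open>v\<close> confines the calibrated \<open>\<kappa>\<close>,
  which varies with the law, to an interval from \<open>l / sqrt (1 + v / m)\<close> to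
  \<open>l\<close>. This keeps it away from zero, as the accumulation argument requires.\<close>

lemma worst_huber_ge:
  assumes "0 < l"
  shows "(INF \<kappa>\<in>{0<..}. worst_float \<kappa>) \<le> worst_huber l"
proof (cases "worst_huber l = \<infinity>")
  case False
  obtain F where F: "\<And>n. F n \<in> contam \<epsilon>" "\<And>n. contaminated (F n) (return borel (real n)) \<epsilon>"
    using escaping_contamination[OF eps] by blast
  have "\<exists>\<kappa> t. 0 < \<kappa> \<and> is_fixed_point m \<kappa> (F n) t \<and> \<kappa> * sqrt (1 + t) = l
      \<and> V_huber m l (F n) = ereal (m * t)" for n
    using V_huber_eq[OF assms F(1)] by metis
  then obtain \<kappa> t where \<kappa>: "\<And>n. 0 < \<kappa> n" "\<And>n. \<kappa> n * sqrt (1 + t n) = l"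
    and fp: "\<And>n. is_fixed_point m (\<kappa> n) (F n) (t n)"
    and V: "\<And>n. V_huber m l (F n) = ereal (m * t n)" by metis
  have t_nonneg: "0 \<le> t n" for n using fp by (simp add: is_fixed_point_def)
  have V_le: "ereal (m * t n) \<le> worst_huber l" for n
    unfolding V[symmetric] by (rule SUP_upper[OF F(1)])
  then obtain v where v: "worst_huber l = ereal v"
    using False V_le[of 0] by (cases "worst_huber l") auto
  then have t_le: "m * t n \<le> v" for n using V_le by simp
  have "0 \<le> v" using t_le[of 0] t_nonneg[of 0] m by (meson mult_nonneg_nonneg order_trans less_imp_le zero_less_one)
  have \<kappa>_eq: "\<kappa> n = l / sqrt (1 + t n)" for n
    using \<kappa>(2)[of n] t_nonneg[of n] by (simp add: field_simps)
  have \<kappa>_le: "\<kappa> n \<le> l" for n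
    unfolding \<kappa>_eq using assms t_nonneg[of n] by (simp add: divide_le_eq)
  have \<kappa>_ge: "l / sqrt (1 + v / m) \<le> \<kappa> n" for n
  proof -
    have "t n \<le> v / m" using t_le[of n] m by (simp add: field_simps)
    then show ?thesis
      unfolding \<kappa>_eq using assms t_nonneg[of n] by (intro divide_left_mono mult_pos_pos) auto
  qed
  have "0 < l / sqrt (1 + v / m)" using assms \<open>0 \<le> v\<close> m by (simp add: add_pos_nonneg)
  then obtain \<kappa>' r s where lim: "limit_system m \<epsilon> \<kappa>' r" "V_bar (\<kappa>' * (1 + r)) \<epsilon> < m"
    "m * (V_bar (\<kappa>' * (1 + r)) \<epsilon> / (m - V_bar (\<kappa>' * (1 + r)) \<epsilon>)) \<le> v"
    using escaping_fixed_points[OF F(2) fp _ \<kappa>_ge \<kappa>_le t_le] by metis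
  have "(INF \<kappa>\<in>{0<..}. worst_float \<kappa>) \<le> worst_float \<kappa>'"
    using lim(1) by (intro INF_lower) (simp add: limit_system_def)
  also have "\<dots> \<le> ereal (m * (V_bar (\<kappa>' * (1 + r)) \<epsilon> / (m - V_bar (\<kappa>' * (1 + r)) \<epsilon>)))"
    by (rule worst_float_le[OF lim(1,2)])
  also have "\<dots> \<le> worst_huber l" using lim(3) v by simp
  finally show ?thesis .
qed simp

text \<open>If \<open>\<lambda> = \<lambda>\<^sub>\<infinity>(\<kappa>\<^sub>F, F)\<close>, then \<open>\<lambda> \<le> lambda_bar \<kappa>\<^sub>F\<close>, so monotonicity of \<open>lambda_bar\<close> gives
  \<open>\<kappa> \<le> \<kappa>\<^sub>F\<close>; since \<open>\<lambda>\<close> fixes the product \<open>\<kappa>\<^sub>F \<surd>(1 + \<tau>\<^sup>2)\<close>, the variance is at most the worst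
  case for \<open>\<kappa>\<close>.\<close>

lemma worst_huber_lambda_bar_le:
  assumes mono: "strict_mono_on {\<kappa>. 0 < \<kappa> \<and> ereal \<kappa> < kappa_plus m \<epsilon>} (\<lambda>\<kappa>. lambda_bar \<kappa> m \<epsilon>)"
    and "0 < \<kappa>" "worst_float \<kappa> < \<infinity>"
  obtains l where "0 < l" "ereal l = lambda_bar \<kappa> m \<epsilon>" "worst_huber l \<le> worst_float \<kappa>"
proof -
  obtain v where v: "worst_float \<kappa> = ereal v" "0 \<le> v"
    "\<And>F. F \<in> contam \<epsilon> \<Longrightarrow> \<exists>t. is_fixed_point m \<kappa> F t \<and> m * t \<le> v"
    using worst_float_finite[OF assms(2,3)] by metis
  have upper: "lambda_bar \<kappa> m \<epsilon> \<le> ereal (\<kappa> * sqrt (1 + v / m))"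
    unfolding lambda_bar_def
  proof (rule SUP_least)
    fix F assume F: "F \<in> contam \<epsilon>"
    then obtain t where t: "is_fixed_point m \<kappa> F t" "m * t \<le> v" using v(3) by blast
    then have "t \<le> v / m" using m by (simp add: field_simps)
    then show "lambda_inf m \<kappa> F \<le> ereal (\<kappa> * sqrt (1 + v / m))"
      using lambda_inf_eq[OF assms(2) F t(1)] assms(2) by simp
  qed
  \<comment> \<open>Makes the threshold positive; together with \<open>upper\<close> it shows that
    the supremum is a real number.\<close>
  have lower: "ereal \<kappa> \<le> lambda_bar \<kappa> m \<epsilon>"
  proof -
    obtain F where F: "F \<in> contam \<epsilon>"
      using escaping_contamination[OF eps] by blast
    then obtain t where t: "is_fixed_point m \<kappa> F t" using v(3) by blast
    have "\<kappa> * 1 \<le> \<kappa> * sqrt (1 + t)"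
      using t assms(2) by (intro mult_left_mono) (auto simp: is_fixed_point_def)
    then have "ereal \<kappa> \<le> lambda_inf m \<kappa> F"
      using lambda_inf_eq[OF assms(2) F t] by simp
    then show ?thesis unfolding lambda_bar_def using F by (rule SUP_upper2[rotated])
  qed
  obtain l where l: "lambda_bar \<kappa> m \<epsilon> = ereal l"
    using upper lower by (cases "lambda_bar \<kappa> m \<epsilon>") auto
  have "0 < l" using lower assms(2) by (simp add: l)
  have "l \<le> \<kappa> * sqrt (1 + v / m)" using upper by (simp add: l)
  have "worst_huber l \<le> ereal v"
  proof (rule SUP_least)
    fix F assume F: "F \<in> contam \<epsilon>"
    obtain \<kappa>' t where \<kappa>': "0 < \<kappa>'" "is_fixed_point m \<kappa>' F t" "\<kappa>' * sqrt (1 + t) = l"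
        "lambda_inf m \<kappa>' F = ereal l" "V_huber m l F = ereal (m * t)"
      using V_huber_eq[OF \<open>0 < l\<close> F] .
    have t: "0 \<le> t" using \<kappa>'(2) by (simp add: is_fixed_point_def)
    have "\<kappa> \<le> \<kappa>'"
    proof (rule ccontr)
      assume "\<not> \<kappa> \<le> \<kappa>'"
      then have "\<kappa>' < \<kappa>" by simp
      moreover have \<kappa>_plus: "ereal \<kappa> < kappa_plus m \<epsilon>"
        by (rule kappa_less_kappa_plus[OF assms(2,3)])
      moreover have "ereal \<kappa>' < kappa_plus m \<epsilon>"
        using \<open>\<kappa>' < \<kappa>\<close> \<kappa>_plus by (meson less_ereal.simps(1) less_trans)
      ultimately have "lambda_bar \<kappa>' m \<epsilon> < ereal l"
        using strict_mono_onD[OF mono, of \<kappa>' \<kappa>] \<kappa>'(1) assms(2) l by simp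
      \<comment> \<open>\<open>F\<close> itself realizes the threshold \<open>l\<close> at
        \<open>\<kappa>'\<close>.\<close>
      moreover have "ereal l \<le> lambda_bar \<kappa>' m \<epsilon>"
        unfolding lambda_bar_def \<kappa>'(4)[symmetric] by (rule SUP_upper[OF F])
      ultimately show False by simp
    qed
    then have "\<kappa> * sqrt (1 + t) \<le> \<kappa>' * sqrt (1 + t)"
      using t by (intro mult_right_mono) auto
    also have "\<dots> \<le> \<kappa> * sqrt (1 + v / m)"
      using \<kappa>'(3) \<open>l \<le> \<kappa> * sqrt (1 + v / m)\<close> by simp
    finally have "t \<le> v / m" using assms(2) by simp
    then show "V_huber m l F \<le> ereal v"
      using m by (simp add: \<kappa>'(5) field_simps)
  qed
  then show ?thesis using that[OF \<open>0 < l\<close>] l v(1) by simp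
qed

text \<open>Minimizing the worst-case variance means minimizing \<open>V_bar\<close>, that is,
  placing the cap at \<open>kappa_star\<close>. There \<open>V_bar\<close> is
  \<open>1 / B_bar\<close>, so the hypothesis says \<open>W < m\<close>.\<close>

lemma worst_float_kappa_under_star:
  assumes "1 < m * B_bar (kappa_star \<epsilon>) \<epsilon>"
  shows "0 < kappa_under_star m \<epsilon>" "worst_float (kappa_under_star m \<epsilon>) < \<infinity>"
    "worst_float (kappa_under_star m \<epsilon>) = (INF \<kappa>\<in>{0<..}. worst_float \<kappa>)"
proof -
  define W where "W = V_bar (kappa_star \<epsilon>) \<epsilon>"
  have B: "0 < B_bar (kappa_star \<epsilon>) \<epsilon>"
    using B_bar_pos[OF eps(2) kappa_star_pos[OF eps]] .
  have "W < m"
    using A_bar_kappa_star[OF eps] B assms m by (simp add: W_def V_bar_def power2_eq_square field_simps)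
  obtain r where r: "limit_system m \<epsilon> (kappa_under_star m \<epsilon>) r"
    "kappa_under_star m \<epsilon> * (1 + r) = kappa_star \<epsilon>"
    using kappa_under_star_limit_system[OF eps m assms] .
  show pos: "0 < kappa_under_star m \<epsilon>" using r(1) by (simp add: limit_system_def)
  have le: "worst_float (kappa_under_star m \<epsilon>) \<le> ereal (m * (W / (m - W)))"
    using worst_float_le[OF r(1)] \<open>W < m\<close> unfolding r(2) W_def by simp
  then show "worst_float (kappa_under_star m \<epsilon>) < \<infinity>"
    by (rule le_less_trans) simp
  show "worst_float (kappa_under_star m \<epsilon>) = (INF \<kappa>\<in>{0<..}. worst_float \<kappa>)"
  proof (rule antisym[OF INF_greatest INF_lower])
    fix \<kappa> :: real assume "\<kappa> \<in> {0<..}"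
    show "worst_float (kappa_under_star m \<epsilon>) \<le> worst_float \<kappa>"
    proof (cases "worst_float \<kappa> < \<infinity>")
      case True
      have "0 < \<kappa>" using \<open>\<kappa> \<in> {0<..}\<close> by simp
      obtain r' where r': "limit_system m \<epsilon> \<kappa> r'" "V_bar (\<kappa> * (1 + r')) \<epsilon> < m"
        "ereal (m * (V_bar (\<kappa> * (1 + r')) \<epsilon> / (m - V_bar (\<kappa> * (1 + r')) \<epsilon>))) \<le> worst_float \<kappa>"
        using worst_float_limit_system[OF \<open>0 < \<kappa>\<close> True] .
      have W_le: "W \<le> V_bar (\<kappa> * (1 + r')) \<epsilon>"
        unfolding W_def using r'(1) by (intro kappa_star_minimum[OF eps]) (simp add: limit_system_def)
      have "0 < W" unfolding W_def using V_bar_pos[OF eps kappa_star_pos[OF eps]] .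
      then have "W / (m - W) \<le> V_bar (\<kappa> * (1 + r')) \<epsilon> / (m - V_bar (\<kappa> * (1 + r')) \<epsilon>)"
        using W_le r'(2) by (intro frac_le) auto
      then have "ereal (m * (W / (m - W)))
          \<le> ereal (m * (V_bar (\<kappa> * (1 + r')) \<epsilon> / (m - V_bar (\<kappa> * (1 + r')) \<epsilon>)))"
        using m by (simp only: ereal_less_eq) (rule mult_left_mono, auto)
      with le r'(3) show ?thesis by (meson order_trans)
    qed simp
  qed (use pos in simp)
qed

end

theorem theorem5p4:
  fixes \<epsilon> m :: real
  assumes eps: "0 < \<epsilon>" "\<epsilon> < 1"
    and m: "1 < m"
    and unique_fixed_point:
      "\<And>\<kappa> F s t. 0 < \<kappa> \<Longrightarrow> F \<in> contam \<epsilon> \<Longrightarrow>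
         is_fixed_point m \<kappa> F s \<Longrightarrow> is_fixed_point m \<kappa> F t \<Longrightarrow> s = t"
    and mono: "strict_mono_on {\<kappa>. 0 < \<kappa> \<and> ereal \<kappa> < kappa_plus m \<epsilon>} (\<lambda>\<kappa>. lambda_bar \<kappa> m \<epsilon>)"
  shows "(INF lam\<in>{0<..}. SUP F\<in>contam \<epsilon>. V_huber m lam F)
           = (INF \<kappa>\<in>{0<..}. SUP F\<in>contam \<epsilon>. V_float m \<kappa> F)
       \<and> (\<forall>Fstar. fisher_minimizer \<epsilon> Fstar \<and> ennreal m * fisher_information Fstar > 1 \<longrightarrow>
            (\<exists>lam_star>0. ereal lam_star = lambda_bar (kappa_under_star m \<epsilon>) m \<epsilon> \<and>
               (SUP F\<in>contam \<epsilon>. V_huber m lam_star F)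
                 = (INF lam\<in>{0<..}. SUP F\<in>contam \<epsilon>. V_huber m lam F)))"
proof -
  interpret unique_state_evolution \<epsilon> m
    using eps m unique_fixed_point by unfold_locales
  have INF_eq: "(INF lam\<in>{0<..}. worst_huber lam) = (INF \<kappa>\<in>{0<..}. worst_float \<kappa>)"
  proof (rule antisym)
    show "(INF lam\<in>{0<..}. worst_huber lam) \<le> (INF \<kappa>\<in>{0<..}. worst_float \<kappa>)"
    proof (rule INF_greatest)
      fix \<kappa> :: real assume \<kappa>: "\<kappa> \<in> {0<..}"
      show "(INF lam\<in>{0<..}. worst_huber lam) \<le> worst_float \<kappa>"
      proof (cases "worst_float \<kappa> < \<infinity>")
        case True
        \<comment> \<open>Each \<open>\<kappa>\<close> with finite worst case is matched by its own
          threshold \<open>lambda_bar \<kappa> m \<epsilon>\<close>.\<close>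
        then obtain l where "0 < l" "worst_huber l \<le> worst_float \<kappa>"
          using worst_huber_lambda_bar_le[OF mono] \<kappa> by auto
        then show ?thesis by (intro INF_lower2[of l]) auto
      qed simp
    qed
    show "(INF \<kappa>\<in>{0<..}. worst_float \<kappa>) \<le> (INF lam\<in>{0<..}. worst_huber lam)"
      by (rule INF_greatest) (simp add: worst_huber_ge)
  qed
  moreover have "\<exists>lam_star>0. ereal lam_star = lambda_bar (kappa_under_star m \<epsilon>) m \<epsilon> \<and>
      worst_huber lam_star = (INF lam\<in>{0<..}. worst_huber lam)"
    if Fstar: "fisher_minimizer \<epsilon> Fstar" "ennreal m * fisher_information Fstar > 1" for Fstar
  proof -
    have B: "1 < m * B_bar (kappa_star \<epsilon>) \<epsilon>"
      using fisher_minimizer_B_bar[OF eps _ Fstar] m by simp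
    \<comment> \<open>The same matching at the optimal \<open>\<kappa>\<close>: its bound is the
      common infimum, which is therefore attained.\<close>
    obtain l where l: "0 < l" "ereal l = lambda_bar (kappa_under_star m \<epsilon>) m \<epsilon>"
        "worst_huber l \<le> worst_float (kappa_under_star m \<epsilon>)"
      using worst_huber_lambda_bar_le[OF mono worst_float_kappa_under_star(1,2)[OF B]] .
    have "worst_huber l = (INF lam\<in>{0<..}. worst_huber lam)"
    proof (rule antisym)
      show "worst_huber l \<le> (INF lam\<in>{0<..}. worst_huber lam)"
        using l(3) unfolding worst_float_kappa_under_star(3)[OF B] INF_eq .
      show "(INF lam\<in>{0<..}. worst_huber lam) \<le> worst_huber l"
        using l(1) by (intro INF_lower) simp
    qed
    with l show ?thesis by blast
  qed
  ultimately show ?thesis by blast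
qed

end
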